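(* Let $Q$ be a Dynkin quiver with vertices $1,\dots,n$ and path matrix $(a_{ij})$, and let $A=kQ$ with $k=\mathbb{F}_q$. For any $1\leq i\neq j\leq n$: (1) if $a_{ij}=0$, then $[C_{P_i}][C_{P_j}]=[C_{P_j}][C_{P_i}]=[C_{P_i\oplus P_j}]$ in $\mathcal{H}(C_1(\mathscr{P}))$; (2) if $a_{ij}=1$, then the following relations hold in $\mathcal{H}(C_1(\mathscr{P}))$: $$\begin{cases} [C_{P_j}]^2[C_{P_i}]=(q+1)[C_{P_i\oplus2P_j}]+(q+1)[C_{P_j}\oplus C_{M_{ij}}]+[C_{P_i}\oplus K_{P_j}]\\ [C_{P_j}][C_{P_i}][C_{P_j}]=q(q+1)[C_{P_i\oplus2P_j}]+q[C_{P_j}\oplus C_{M_{ij}}]+q[C_{P_i}\oplus K_{P_j}]\\ [C_{P_i}][C_{P_j}]^2=q^2(q+1)[C_{P_i\oplus2P_j}]+q[C_{P_i}\oplus K_{P_j}] \end{cases}$$ and $$\begin{cases} [C_{P_i}]^2[C_{P_j}]=q^2(q+1)[C_{P_j\oplus2P_i}]+q[C_{P_j}\oplus K_{P_i}]\\ [C_{P_i}][C_{P_j}][C_{P_i}]=q(q+1)[C_{P_j\oplus2P_i}]+q[C_{P_i}\oplus C_{M_{ij}}]+q[C_{P_j}\oplus K_{P_i}]\\ [C_{P_j}][C_{P_i}]^2=(q+1)[C_{P_j\oplus2P_i}]+(q+1)[C_{P_i}\oplus C_{M_{ij}}]+[C_{P_j}\oplus K_{P_i}]. \end{cases}$$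
   Context: Dynkin means that the underlying graph is of type $\mathbb{A}$, $\mathbb{D}$ or $\mathbb{E}$. Path matrix: if there is a directed path from $i$ to $j$ ($i\ne j$) then $a_{ij}=1$ and $a_{ji}=-1$; if there is no path between $i$ and $j$ in either direction, or $i=j$, then $a_{ij}=0$. $A$-modules are finite dimensional left modules, $\mathscr{P}$ is the category of projective $A$-modules, $S_i$ the simple module at $i$, $P_i$ its projective cover; $mM$ is the direct sum of $m$ copies of $M$. Conventions are such that if there is a path from $i$ to $j$ then $\operatorname{Hom}_A(P_j,P_i)\cong k$ and $\operatorname{Hom}_A(P_i,P_j)=0$. If $a_{ij}=1$, every nonzero $f:P_j\to P_i$ is a monomorphism, and $M_{ij}:=\operatorname{Coker}f$ is an indecomposable module, independent of $f\ne0$ up to isomorphism. A 1-cyclic complex is a pair $(M,d)$ with $M$ an $A$-module and $d\in\operatorname{End}_A(M)$, $d^2=0$; morphisms are $A$-homomorphisms commuting with the differentials. $C_1(\mathscr{P})$ is the exact category of 1-cyclic complexes of projective modules (exact sequences: those short exact on underlying modules). For an $A$-module $M$ with minimal projective resolution $0\to\Omega_M\xrightarrow{\delta_M}P_M\to M\to0$, set $C_M=\left(P_M\oplus\Omega_M,\begin{pmatrix}0&\delta_M\\0&0\end{pmatrix}\right)$ (so $C_P=(P,0)$ for $P$ projective); for $P\in\mathscr{P}$ set $K_P=\left(P\oplus P,\begin{pmatrix}0&1\\0&0\end{pmatrix}\right)$. Hall algebra: let $W_{XY}^Z$ be the set of pairs $(\varphi,\psi)$ with $0\to Y\xrightarrow{\varphi}Z\xrightarrow{\psi}X\to0$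 exact in $C_1(\mathscr{P})$, and $F_{XY}^Z:=|W_{XY}^Z|/(|\operatorname{Aut}X||\operatorname{Aut}Y|)$. $\mathcal{H}(C_1(\mathscr{P}))$ is the $\mathbb{C}$-vector space with basis the isoclasses $[X]$ and multiplication $[X]\cdot[Y]=\sum_{[Z]}F_{XY}^Z[Z]$. *)

theory Defs
  imports Complex_Main "HOL-Library.FuncSet" "HOL-Library.Cardinality" "HOL-Algebra.Module" "HOL-Algebra.AbelCoset"
    "Graph_Theory.Digraph" "Graph_Theory.Arc_Walk"
begin

section \<open>Dynkin quivers and their path matrices\<close>

text \<open>
  A quiver is a digraph with an arbitrary set of arcs, so that loops and parallel arrows are
  not excluded a priori. The Dynkin diagrams are the following sets of undirected edges on the
  vertices \<open>1,\<dots>,m\<close>; in types D and E a chain is extended by a last vertex \<open>m\<close>, attached to the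
  vertex \<open>m - 2\<close> resp. \<open>3\<close> of the chain.
\<close>

definition chain_edges :: "nat \<Rightarrow> nat set set" where
  "chain_edges m = {{t, t + 1} | t. 1 \<le> t \<and> t < m}"

definition dynkin_diagram :: "nat \<Rightarrow> nat set set \<Rightarrow> bool" where
  "dynkin_diagram m E \<longleftrightarrow>
     1 \<le> m \<and> E = chain_edges m \<or>
     4 \<le> m \<and> E = chain_edges (m - 1) \<union> {{m - 2, m}} \<or>
     m \<in> {6, 7, 8} \<and> E = chain_edges (m - 1) \<union> {{3, m}}"

text \<open>
  Since the ends of the arrows are matched bijectively with the edges of the diagram, two vertices
  are joined by at most one arrow.
\<close>

definition dynkin_quiver :: "('v, 'e) pre_digraph \<Rightarrow> bool" where
  "dynkin_quiver Q \<longleftrightarrow> fin_digraph Q \<and>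
     (\<exists>m E \<sigma>. dynkin_diagram m E \<and> bij_betw \<sigma> (verts Q) {1..m} \<and>
        bij_betw (\<lambda>e. {\<sigma> (tail Q e), \<sigma> (head Q e)}) (arcs Q) E)"

definition path_matrix :: "('v, 'e) pre_digraph \<Rightarrow> 'v \<Rightarrow> 'v \<Rightarrow> int" where
  "path_matrix Q i j =
     (if i = j then 0
      else if \<exists>w. pre_digraph.awalk Q i w j then 1
      else if \<exists>w. pre_digraph.awalk Q j w i then - 1
      else 0)"


section \<open>The path algebra\<close>

text \<open>
  A path is a triple (source, list of arrows in the order of traversal, target); the trivial path
  at \<open>v\<close> is \<open>(v, [], v)\<close>. In a product \<open>p \<cdot> q\<close> of paths, \<open>q\<close> is traversed first. With this
  convention \<open>A e\<^sub>i\<close> is spanned by the paths starting at \<open>i\<close>, so that for left modules a path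
  from \<open>i\<close> to \<open>j\<close> gives a nonzero map from \<open>P\<^sub>j\<close> to \<open>P\<^sub>i\<close>.

  The record type \<open>('k, 'x) module\<close> is used in its role as signature of a \<open>'k\<close>-algebra with
  elements in \<open>'x\<close>, as in the locale \<open>algebra\<close>.
\<close>

type_synonym ('v, 'e) qpath = "'v \<times> 'e list \<times> 'v"

definition qpaths :: "('v, 'e) pre_digraph \<Rightarrow> ('v, 'e) qpath set" where
  "qpaths Q = {(u, w, v). pre_digraph.awalk Q u w v}"

fun qpath_comp :: "('v, 'e) qpath \<Rightarrow> ('v, 'e) qpath \<Rightarrow> ('v, 'e) qpath" where
  "qpath_comp (x, w', v) (u, w, x') = (u, w @ w', v)"

definition qpath_factorizations ::
    "('v, 'e) pre_digraph \<Rightarrow> ('v, 'e) qpath \<Rightarrow> (('v, 'e) qpath \<times> ('v, 'e) qpath) set" where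
  "qpath_factorizations Q r =
     {(p, p'). p \<in> qpaths Q \<and> p' \<in> qpaths Q \<and> fst p = snd (snd p') \<and> qpath_comp p p' = r}"

definition path_algebra ::
    "('v, 'e) pre_digraph \<Rightarrow> ('k::field, ('v, 'e) qpath \<Rightarrow> 'k) module" where
  "path_algebra Q =
     \<lparr>carrier = {a. finite {p. a p \<noteq> 0} \<and> {p. a p \<noteq> 0} \<subseteq> qpaths Q},
      monoid.mult = (\<lambda>a b r. \<Sum>(p, p')\<in>qpath_factorizations Q r. a p * b p'),
      one = (\<lambda>p. if \<exists>v\<in>verts Q. p = (v, [], v) then 1 else 0),
      ring.zero = (\<lambda>p. 0),
      add = (\<lambda>a b p. a p + b p),
      smult = (\<lambda>c a p. c * a p)\<rparr>"


section \<open>Finite dimensional left modules\<close>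

text \<open>
  This is the locale \<open>module\<close> of HOL-Algebra with the commutativity of the ring dropped. The
  fields \<open>mult\<close> and \<open>one\<close> that a module record inherits from ring records play no role.
\<close>

locale left_module = R?: ring R + M?: abelian_group M for R (structure) and M (structure) +
  assumes smult_closed:
      "\<lbrakk>a \<in> carrier R; x \<in> carrier M\<rbrakk> \<Longrightarrow> a \<odot>\<^bsub>M\<^esub> x \<in> carrier M"
    and smult_l_distr:
      "\<lbrakk>a \<in> carrier R; b \<in> carrier R; x \<in> carrier M\<rbrakk> \<Longrightarrow>
       (a \<oplus>\<^bsub>R\<^esub> b) \<odot>\<^bsub>M\<^esub> x = a \<odot>\<^bsub>M\<^esub> x \<oplus>\<^bsub>M\<^esub> b \<odot>\<^bsub>M\<^esub> x"
    and smult_r_distr: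
      "\<lbrakk>a \<in> carrier R; x \<in> carrier M; y \<in> carrier M\<rbrakk> \<Longrightarrow>
       a \<odot>\<^bsub>M\<^esub> (x \<oplus>\<^bsub>M\<^esub> y) = a \<odot>\<^bsub>M\<^esub> x \<oplus>\<^bsub>M\<^esub> a \<odot>\<^bsub>M\<^esub> y"
    and smult_assoc:
      "\<lbrakk>a \<in> carrier R; b \<in> carrier R; x \<in> carrier M\<rbrakk> \<Longrightarrow>
       (a \<otimes>\<^bsub>R\<^esub> b) \<odot>\<^bsub>M\<^esub> x = a \<odot>\<^bsub>M\<^esub> (b \<odot>\<^bsub>M\<^esub> x)"
    and smult_one:
      "x \<in> carrier M \<Longrightarrow> \<one>\<^bsub>R\<^esub> \<odot>\<^bsub>M\<^esub> x = x"

text \<open>The ground field acts on an \<open>A\<close>-module through \<open>c \<mapsto> c \<cdot> 1\<^sub>A\<close>.\<close>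

definition fd_module :: "('k::field, 'x) module \<Rightarrow> ('x, 'm) module \<Rightarrow> bool" where
  "fd_module A M \<longleftrightarrow> left_module A M \<and>
     (\<exists>B. finite B \<and> B \<subseteq> carrier M \<and>
        (\<forall>x\<in>carrier M. \<exists>c :: 'm \<Rightarrow> 'k. x = (\<Oplus>\<^bsub>M\<^esub>b\<in>B. (c b \<odot>\<^bsub>A\<^esub> \<one>\<^bsub>A\<^esub>) \<odot>\<^bsub>M\<^esub> b)))"

text \<open>Homomorphisms are extensional functions, so that they can be counted.\<close>

definition mod_hom ::
    "('k, 'x) module \<Rightarrow> ('x, 'm) module \<Rightarrow> ('x, 'n) module \<Rightarrow> ('m \<Rightarrow> 'n) set" where
  "mod_hom A M N =
     {f \<in> carrier M \<rightarrow>\<^sub>E carrier N.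
        (\<forall>x\<in>carrier M. \<forall>y\<in>carrier M. f (x \<oplus>\<^bsub>M\<^esub> y) = f x \<oplus>\<^bsub>N\<^esub> f y) \<and>
        (\<forall>a\<in>carrier A. \<forall>x\<in>carrier M. f (a \<odot>\<^bsub>M\<^esub> x) = a \<odot>\<^bsub>N\<^esub> f x)}"

definition short_exact ::
    "('x, 'l) module \<Rightarrow> ('x, 'm) module \<Rightarrow> ('x, 'n) module \<Rightarrow> ('l \<Rightarrow> 'm) \<Rightarrow> ('m \<Rightarrow> 'n) \<Rightarrow> bool" where
  "short_exact L M N f g \<longleftrightarrow>
     inj_on f (carrier L) \<and> f ` carrier L = a_kernel M N g \<and> g ` carrier M = carrier N"

definition dsum :: "('x, 'm) module \<Rightarrow> ('x, 'n) module \<Rightarrow> ('x, 'm \<times> 'n) module"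
    (infixr \<open>\<oplus>\<^sub>m\<close> 65) where
  "M \<oplus>\<^sub>m N =
     \<lparr>carrier = carrier M \<times> carrier N, monoid.mult = undefined, one = undefined,
      ring.zero = (\<zero>\<^bsub>M\<^esub>, \<zero>\<^bsub>N\<^esub>),
      add = (\<lambda>(x, y) (x', y'). (x \<oplus>\<^bsub>M\<^esub> x', y \<oplus>\<^bsub>N\<^esub> y')),
      smult = (\<lambda>a (x, y). (a \<odot>\<^bsub>M\<^esub> x, a \<odot>\<^bsub>N\<^esub> y))\<rparr>"

definition quot_module :: "('x, 'm) module \<Rightarrow> 'm set \<Rightarrow> ('x, 'm set) module" where
  "quot_module M N =
     \<lparr>carrier = a_rcosets\<^bsub>M\<^esub> N, monoid.mult = undefined, one = undefined,
      ring.zero = N, add = set_add M,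
      smult = (\<lambda>a X. \<Union>x\<in>X. N +>\<^bsub>M\<^esub> (a \<odot>\<^bsub>M\<^esub> x))\<rparr>"

definition coker :: "('x, 'm) module \<Rightarrow> ('x, 'n) module \<Rightarrow> ('m \<Rightarrow> 'n) \<Rightarrow> ('x, 'n set) module" where
  "coker M N f = quot_module N (f ` carrier M)"

text \<open>
  Over a finite field every finite dimensional module is a finite set, hence isomorphic to a
  module with carrier in \<^typ>\<open>nat\<close>. Below, modules with carrier in \<^typ>\<open>nat\<close> are therefore used
  wherever one has to quantify over all finite dimensional modules, and wherever a module that is
  only determined up to isomorphism is chosen.
\<close>

definition projective :: "('k::{field,finite}, 'x) module \<Rightarrow> ('x, 'm) module \<Rightarrow> bool" where
  "projective A P \<longleftrightarrow> fd_module A P \<and>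
     (\<forall>(X :: ('x, nat) module) (Y :: ('x, nat) module). fd_module A X \<longrightarrow> fd_module A Y \<longrightarrow>
        (\<forall>g\<in>mod_hom A X Y. \<forall>h\<in>mod_hom A P Y. g ` carrier X = carrier Y \<longrightarrow>
           (\<exists>l\<in>mod_hom A P X. \<forall>x\<in>carrier P. g (l x) = h x)))"

definition projective_cover ::
    "('k::{field,finite}, 'x) module \<Rightarrow> ('x, 'm) module \<Rightarrow> ('m \<Rightarrow> 'n) \<Rightarrow> ('x, 'n) module \<Rightarrow> bool" where
  "projective_cover A P \<pi> M \<longleftrightarrow>
     projective A P \<and> fd_module A M \<and> \<pi> \<in> mod_hom A P M \<and> \<pi> ` carrier P = carrier M \<and>
     (\<forall>U. submodule U A P \<longrightarrow> U <+>\<^bsub>P\<^esub> a_kernel P M \<pi> = carrier P \<longrightarrow> U = carrier P)"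

definition minimal_projective_resolution ::
    "('k::{field,finite}, 'x) module \<Rightarrow> ('x, 'l) module \<Rightarrow> ('l \<Rightarrow> 'm) \<Rightarrow> ('x, 'm) module \<Rightarrow>
     ('m \<Rightarrow> 'n) \<Rightarrow> ('x, 'n) module \<Rightarrow> bool" where
  "minimal_projective_resolution A \<Omega> \<delta> P \<epsilon> M \<longleftrightarrow>
     projective A \<Omega> \<and> \<delta> \<in> mod_hom A \<Omega> P \<and> projective_cover A P \<epsilon> M \<and> short_exact \<Omega> P M \<delta> \<epsilon>"


section \<open>1-cyclic complexes of projective modules\<close>

type_synonym ('x, 'm) cyc = "('x, 'm) module \<times> ('m \<Rightarrow> 'm)"

definition C1_proj :: "('k::{field,finite}, 'x) module \<Rightarrow> ('x, 'm) cyc set" where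
  "C1_proj A = {(M, d). projective A M \<and> d \<in> mod_hom A M M \<and> (\<forall>x\<in>carrier M. d (d x) = \<zero>\<^bsub>M\<^esub>)}"

definition cyc_hom ::
    "('k, 'x) module \<Rightarrow> ('x, 'm) cyc \<Rightarrow> ('x, 'n) cyc \<Rightarrow> ('m \<Rightarrow> 'n) set" where
  "cyc_hom A X Y =
     {f \<in> mod_hom A (fst X) (fst Y). \<forall>x\<in>carrier (fst X). f (snd X x) = snd Y (f x)}"

definition cyc_iso ::
    "('k, 'x) module \<Rightarrow> ('x, 'm) cyc \<Rightarrow> ('x, 'n) cyc \<Rightarrow> ('m \<Rightarrow> 'n) set" where
  "cyc_iso A X Y = {f \<in> cyc_hom A X Y. bij_betw f (carrier (fst X)) (carrier (fst Y))}"

definition cyc_dsum :: "('x, 'm) cyc \<Rightarrow> ('x, 'n) cyc \<Rightarrow> ('x, 'm \<times> 'n) cyc"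
    (infixr \<open>\<oplus>\<^sub>c\<close> 65) where
  "X \<oplus>\<^sub>c Y =
     (fst X \<oplus>\<^sub>m fst Y, \<lambda>(x, y)\<in>carrier (fst X) \<times> carrier (fst Y). (snd X x, snd Y y))"

text \<open>\<open>(x, y) \<mapsto> (\<delta> y, 0)\<close> is the matrix with rows \<open>0 \<delta>\<close> and \<open>0 0\<close> acting on columns.\<close>

definition upper_cyc :: "('x, 'm) module \<Rightarrow> ('x, 'n) module \<Rightarrow> ('n \<Rightarrow> 'm) \<Rightarrow> ('x, 'm \<times> 'n) cyc" where
  "upper_cyc P \<Omega> \<delta> = (P \<oplus>\<^sub>m \<Omega>, \<lambda>(x, y)\<in>carrier P \<times> carrier \<Omega>. (\<delta> y, \<zero>\<^bsub>\<Omega>\<^esub>))"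

definition C_cyc ::
    "('k::{field,finite}, 'x) module \<Rightarrow> ('x, 'm) module \<Rightarrow> ('x, nat \<times> nat) cyc" where
  "C_cyc A M =
     (SOME X. \<exists>\<Omega> \<delta> P \<epsilon>. minimal_projective_resolution A \<Omega> \<delta> P \<epsilon> M \<and> X = upper_cyc P \<Omega> \<delta>)"

definition K_cyc :: "('x, 'm) module \<Rightarrow> ('x, 'm \<times> 'm) cyc" where
  "K_cyc P = upper_cyc P P (\<lambda>x\<in>carrier P. x)"

definition zero_module :: "('x, unit) module" where
  "zero_module =
     \<lparr>carrier = {()}, monoid.mult = undefined, one = undefined, ring.zero = (),
      add = (\<lambda>_ _. ()), smult = (\<lambda>_ _. ())\<rparr>"


section \<open>The Hall algebra\<close>

text \<open>
  \<open>hall_number A X Y Z\<close> is \<open>F\<^sub>X\<^sub>Y\<^sup>Z\<close>; in the counted exact sequences \<open>Y\<close> is the subobject and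
  \<open>X\<close> the quotient.
\<close>

definition hall_number ::
    "('k, 'x) module \<Rightarrow> ('x, 'l) cyc \<Rightarrow> ('x, 'm) cyc \<Rightarrow> ('x, 'n) cyc \<Rightarrow> complex" where
  "hall_number A X Y Z =
     of_nat (card {(\<phi>, \<psi>). \<phi> \<in> cyc_hom A Y Z \<and> \<psi> \<in> cyc_hom A Z X \<and>
                           short_exact (fst Y) (fst Z) (fst X) \<phi> \<psi>}) /
     (of_nat (card (cyc_iso A X X)) * of_nat (card (cyc_iso A Y Y)))"

text \<open>
  The isoclass of \<open>X\<close> is taken among the complexes with carrier in \<^typ>\<open>nat\<close>, whatever the type of
  the elements of \<open>X\<close> is; so the isoclasses of isomorphic complexes on different types coincide.
\<close>

definition isoclass ::
    "('k::{field,finite}, 'x) module \<Rightarrow> ('x, 'm) cyc \<Rightarrow> ('x, nat) cyc set" where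
  "isoclass A X = {Z \<in> C1_proj A. cyc_iso A Z X \<noteq> {}}"

definition isoclasses :: "('k::{field,finite}, 'x) module \<Rightarrow> ('x, nat) cyc set set" where
  "isoclasses A = isoclass A ` (C1_proj A :: ('x, nat) cyc set)"

definition rep :: "('x, nat) cyc set \<Rightarrow> ('x, nat) cyc" where
  "rep c = (SOME X. X \<in> c)"

definition hall_basis ::
    "('k::{field,finite}, 'x) module \<Rightarrow> ('x, 'm) cyc \<Rightarrow> (('x, nat) cyc set \<Rightarrow> complex)" where
  "hall_basis A X = (\<lambda>c. if c = isoclass A X then 1 else 0)"

text \<open>
  The elements of the Hall algebra are the finitely supported functions on the isoclasses. Its
  multiplication is the bilinear extension of \<open>[X] \<cdot> [Y] = \<Sum> F\<^sub>X\<^sub>Y\<^sup>Z [Z]\<close>.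
\<close>

definition hall_algebra ::
    "('k::{field,finite}, 'x) module \<Rightarrow> (complex, ('x, nat) cyc set \<Rightarrow> complex) module" where
  "hall_algebra A =
     \<lparr>carrier = {f. finite {c. f c \<noteq> 0} \<and> {c. f c \<noteq> 0} \<subseteq> isoclasses A},
      monoid.mult = (\<lambda>f g c.
        if c \<in> isoclasses A
        then \<Sum>a | f a \<noteq> 0. \<Sum>b | g b \<noteq> 0. f a * g b * hall_number A (rep a) (rep b) (rep c)
        else 0),
      one = hall_basis A (zero_module, \<lambda>_. ()),
      ring.zero = (\<lambda>c. 0),
      add = (\<lambda>f g c. f c + g c),
      smult = (\<lambda>s f c. s * f c)\<rparr>"


section \<open>The modules attached to the vertices\<close>

text \<open>The trivial path at \<open>i\<close> acts as the identity, all other paths act by zero.\<close>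

definition simple_at :: "'v \<Rightarrow> ('k::field, ('v, 'e) qpath \<Rightarrow> 'k) module \<Rightarrow>
    (('v, 'e) qpath \<Rightarrow> 'k, 'k) module" where
  "simple_at i A =
     \<lparr>carrier = UNIV, monoid.mult = undefined, one = undefined, ring.zero = 0,
      add = (+), smult = (\<lambda>a x. a (i, [], i) * x)\<rparr>"

definition P_at :: "('k::{field,finite}, ('v, 'e) qpath \<Rightarrow> 'k) module \<Rightarrow> 'v \<Rightarrow>
    (('v, 'e) qpath \<Rightarrow> 'k, nat) module" where
  "P_at A i = (SOME P. \<exists>\<pi>. projective_cover A P \<pi> (simple_at i A))"

text \<open>Up to isomorphism the cokernel does not depend on the nonzero map that is chosen.\<close>

definition M_at :: "('k::{field,finite}, ('v, 'e) qpath \<Rightarrow> 'k) module \<Rightarrow> 'v \<Rightarrow> 'v \<Rightarrow>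
    (('v, 'e) qpath \<Rightarrow> 'k, nat set) module" where
  "M_at A i j =
     coker (P_at A j) (P_at A i)
       (SOME f. f \<in> mod_hom A (P_at A j) (P_at A i) \<and>
                (\<exists>x\<in>carrier (P_at A j). f x \<noteq> \<zero>\<^bsub>P_at A i\<^esub>))"

end

theory Submission
  imports Defs
begin

text \<open>
  A Dynkin quiver is a tree, so there is at most one path between two vertices. Hence the additive
  category of projective modules consists of matrices over the ground field that are supported on
  the reachability order of the vertices, and a 1-cyclic complex of projectives is a matrix with
  square zero. An extension of such complexes splits as a sequence of modules; Riedtmann's formula
  therefore expresses \<open>F\<^sub>X\<^sub>Y\<^sup>Z\<close> by the orders of automorphism groups, the order of \<open>Hom(X, Y)\<close>
  and the number of those homomorphisms from \<open>X\<close> to \<open>Y\<close> which, taken as an off-diagonal entry of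
  the differential, give a middle term isomorphic to \<open>Z\<close>. The relations reduce to normal forms
  and centralizers of matrices with square zero of size at most 3.
\<close>

section \<open>Directed walks in a Dynkin quiver\<close>

text \<open>\<open>P_at\<close>, \<open>M_at\<close> and \<open>C_cyc\<close> are choices, each
  determined up to isomorphism only, and Hall numbers are evaluated at representatives with carrier
  in \<open>nat\<close>. So the notions involved are first shown to be invariant under isomorphisms
  between modules on different types; only then can complexes be exchanged for explicit matrices. A
  short exact sequence of complexes of projectives splits as a sequence of modules because its
  quotient is projective. The splitting need not respect the differentials, and the defect is a
  homomorphism \<open>h\<close> from the quotient to the subobject. Not every \<open>h\<close> gives
  a differential of square zero: those that do not still count in the order of
  \<open>Hom(X, Y)\<close>, but they belong to no middle term. The asymmetry of the relations stems
  from \<open>Hom(P_i, P_j) = 0\<close>. With \<open>P_i\<close> as quotient and copies of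
  \<open>P_j\<close> below, \<open>h\<close> must vanish, and the powers of \<open>q\<close> come
  from automorphisms of the middle term; in the other order the nonzero \<open>h\<close> produce the
  summand \<open>C_M\<close> of the cokernel.\<close>

context wf_digraph
begin

text \<open>For the labels of a Dynkin diagram \<open>top\<close> holds because every vertex has at
  most one neighbour of smaller label, so that an arc is determined by its upper end.\<close>

context
  fixes \<sigma> :: "'a \<Rightarrow> nat"
  assumes ne: "\<And>e. e \<in> arcs G \<Longrightarrow> \<sigma> (tail G e) \<noteq> \<sigma> (head G e)"
    and top: "\<And>e e'. e \<in> arcs G \<Longrightarrow> e' \<in> arcs G \<Longrightarrow>
      max (\<sigma> (tail G e)) (\<sigma> (head G e)) = max (\<sigma> (tail G e')) (\<sigma> (head G e')) \<Longrightarrow> e = e'"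
begin

text \<open>After an ascending arc the next arc cannot descend: it would have the same upper end, so
  by \<open>top\<close> it would be the same arc, and that arc would be a loop.\<close>

lemma ascending_walk:
  assumes "awalk u (e # p) v" "\<sigma> u < \<sigma> (head G e)"
  shows "\<sigma> u < \<sigma> v"
  using assms
proof (induction p arbitrary: u e)
  case Nil
  then show ?case by (auto simp: awalk_Cons_iff awalk_Nil_iff)
next
  case (Cons e' p)
  have w: "awalk (head G e) (e' # p) v" and t: "tail G e' = head G e" and u: "tail G e = u"
    and a: "e \<in> arcs G" "e' \<in> arcs G"
    using Cons.prems(1) by (auto simp: awalk_Cons_iff)
  have "\<sigma> (head G e) < \<sigma> (head G e')"
  proof (rule ccontr)
    assume "\<not> \<sigma> (head G e) < \<sigma> (head G e')"
    then have "e = e'" using top[OF a] ne[OF a(2)] Cons.prems(2) u t by (simp add: max_def)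
    then show False using Cons.prems(2) t u by simp
  qed
  from Cons.IH[OF w this] Cons.prems(2) show ?case by simp
qed

text \<open>Mirror image of \<open>ascending_walk\<close>: the arc before a descending arc descends
  too. Hence the induction starts from the end of the walk.\<close>

lemma descending_walk:
  assumes "awalk u (p @ [e]) v" "\<sigma> v < \<sigma> (tail G e)"
  shows "\<sigma> v < \<sigma> u"
  using assms
proof (induction p arbitrary: v e rule: rev_induct)
  case Nil
  then show ?case by (auto simp: awalk_Cons_iff awalk_Nil_iff)
next
  case (snoc e' p)
  have w: "awalk u (p @ [e']) (tail G e)" and t: "tail G e = head G e'" and v: "head G e = v"
    and a: "e \<in> arcs G" "e' \<in> arcs G"
    using snoc.prems(1) by (auto simp: awalk_Cons_iff awalk_Nil_iff)
  have "\<sigma> (tail G e) < \<sigma> (tail G e')"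
  proof (rule ccontr)
    assume "\<not> \<sigma> (tail G e) < \<sigma> (tail G e')"
    then have "e = e'" using top[OF a] ne[OF a(2)] snoc.prems(2) v t by (simp add: max_def)
    then show False using snoc.prems(2) t v by simp
  qed
  from snoc.IH[OF w this] snoc.prems(2) show ?case by simp
qed

text \<open>An initial ascent is never undone, so a walk that ends no higher than it begins descends
  at once. Its first arc has upper end \<open>u\<close> and is therefore determined by
  \<open>u\<close>.\<close>

lemma walk_start:
  assumes w: "awalk u (e # p) v" and le: "\<sigma> v \<le> \<sigma> u"
  shows "max (\<sigma> (tail G e)) (\<sigma> (head G e)) = \<sigma> u" "\<sigma> (head G e) < \<sigma> u"
proof -
  have "\<not> \<sigma> u < \<sigma> (head G e)" using ascending_walk[OF w] le by auto
  moreover have "tail G e = u" "e \<in> arcs G" using w by (auto simp: awalk_Cons_iff)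
  ultimately show "max (\<sigma> (tail G e)) (\<sigma> (head G e)) = \<sigma> u" "\<sigma> (head G e) < \<sigma> u"
    using ne[of e] by auto
qed

lemma walk_end:
  assumes w: "awalk u (p @ [e]) v" and le: "\<sigma> u \<le> \<sigma> v"
  shows "max (\<sigma> (tail G e)) (\<sigma> (head G e)) = \<sigma> v" "\<sigma> (tail G e) < \<sigma> v"
proof -
  have "\<not> \<sigma> v < \<sigma> (tail G e)" using descending_walk[OF w] le by auto
  moreover have "head G e = v" "e \<in> arcs G" using w by (auto simp: awalk_Cons_iff awalk_Nil_iff)
  ultimately show "max (\<sigma> (tail G e)) (\<sigma> (head G e)) = \<sigma> v" "\<sigma> (tail G e) < \<sigma> v"
    using ne[of e] by auto
qed

text \<open>A walk descends to a smallest label and ascends from there, along arcs that are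
  determined by their upper ends; so the end with the larger label fixes an arc of the walk.\<close>

lemma walk_unique_if_labelled:
  assumes "inj_on \<sigma> (verts G)" "awalk u p v" "awalk u p' v"
  shows "p = p'"
  using assms(2,3)
\<comment> \<open>Whichever end is the higher one loses its arc, so the measure involves both
  labels.\<close>
proof (induction "\<sigma> u + \<sigma> v" arbitrary: u p v p' rule: less_induct)
  case less
  consider "\<sigma> u = \<sigma> v" | "\<sigma> v < \<sigma> u" | "\<sigma> u < \<sigma> v" by linarith
  then show ?case
  proof cases
    case 1
    \<comment> \<open>In a nonempty walk between equal labels the first arc descends from that label
      and the last arc ascends to it. Both have it as upper end, so they would be one and the same
      arc.\<close>
    have "r = []" if w: "awalk u r v" for r
    proof (rule ccontr)
      assume "r \<noteq> []"
      then obtain e s where r1: "r = e # s" by (cases r) auto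
      obtain e' s' where r2: "r = s' @ [e']" using \<open>r \<noteq> []\<close> by (cases r rule: rev_cases) auto
      note A = walk_start[of u e s v] walk_end[of u s' e' v]
      have w1: "awalk u (e # s) v" and w2: "awalk u (s' @ [e']) v" using w r1 r2 by auto
      have "e \<in> arcs G" "e' \<in> arcs G" using w1 w2 by (auto simp: awalk_Cons_iff)
      then have "e = e'" by (rule top) (simp add: A(1)[OF w1] A(3)[OF w2] 1)
      moreover have "tail G e = u" using w1 by (simp add: awalk_Cons_iff)
      ultimately show False using A(4)[OF w2] 1 by simp
    qed
    then show ?thesis using less.prems by blast
  next
    case 2
    then have "p \<noteq> []" "p' \<noteq> []" using less.prems by (auto simp: awalk_Nil_iff)
    then obtain e r e' r' where p: "p = e # r" "p' = e' # r'"
      by (cases p; cases p') auto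
    note w = less.prems[unfolded p]
    have "e \<in> arcs G" "e' \<in> arcs G" using w by (auto simp: awalk_Cons_iff)
    then have "e = e'" by (rule top) (use 2 in \<open>simp add: walk_start(1)[OF w(1)] walk_start(1)[OF w(2)]\<close>)
    moreover have "r = r'"
      using less.hyps[of "head G e" v r r'] walk_start(2)[OF w(1)] w 2 \<open>e = e'\<close>
      by (simp add: awalk_Cons_iff)
    ultimately show ?thesis using p by simp
  next
    case 3
    then have "p \<noteq> []" "p' \<noteq> []" using less.prems by (auto simp: awalk_Nil_iff)
    then obtain e r e' r' where p: "p = r @ [e]" "p' = r' @ [e']"
      by (cases p rule: rev_cases; cases p' rule: rev_cases) auto
    note w = less.prems[unfolded p]
    have "e \<in> arcs G" "e' \<in> arcs G" using w by (auto simp: awalk_Cons_iff)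
    then have "e = e'" by (rule top) (use 3 in \<open>simp add: walk_end(1)[OF w(1)] walk_end(1)[OF w(2)]\<close>)
    moreover have "r = r'"
      using less.hyps[of u "tail G e" r r'] walk_end(2)[OF w(1)] w 3 \<open>e = e'\<close>
      by (auto simp: awalk_Cons_iff awalk_Nil_iff)
    ultimately show ?thesis using p by simp
  qed
qed

end

end

section \<open>Dynkin diagrams as trees grown leaf by leaf\<close>

lemma dynkin_edge:
  assumes "dynkin_diagram m E" "X \<in> E"
  shows "\<exists>a b. X = {a, b} \<and> a < b"
  using assms unfolding dynkin_diagram_def chain_edges_def
  by (elim disjE) (force simp: doubleton_eq_iff)+

text \<open>Each diagram arises from vertex 1 by attaching the other vertices in order, each to
  exactly one earlier vertex; this includes the last vertex of types D and E.\<close>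

lemma dynkin_edge_unique:
  assumes "dynkin_diagram m E" "{a, b} \<in> E" "{a', b} \<in> E" "a < b" "a' < b"
  shows "a = a'"
  using assms unfolding dynkin_diagram_def chain_edges_def
  by (elim disjE) (auto simp: doubleton_eq_iff)

lemma dynkin_walk_unique:
  assumes Q: "dynkin_quiver Q" and w: "pre_digraph.awalk Q u p v" "pre_digraph.awalk Q u p' v"
  shows "p = p'"
proof -
  obtain m E \<sigma> where fin: "fin_digraph Q" and E: "dynkin_diagram m E"
    and \<sigma>: "bij_betw \<sigma> (verts Q) {1..m}" and b: "bij_betw (\<lambda>e. {\<sigma> (tail Q e), \<sigma> (head Q e)}) (arcs Q) E"
    using Q by (auto simp: dynkin_quiver_def)
  interpret fin_digraph Q by (fact fin)
  have edge: "{\<sigma> (tail Q e), \<sigma> (head Q e)} \<in> E" if "e \<in> arcs Q" for e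
    using b that by (auto simp: bij_betw_def)
  have ne: "\<sigma> (tail Q e) \<noteq> \<sigma> (head Q e)" if "e \<in> arcs Q" for e
    using dynkin_edge[OF E edge[OF that]] by (auto simp: doubleton_eq_iff)
  have set: "{min s t, max s t} = {s, t}" for s t :: nat by (auto simp: min_def max_def)
  \<comment> \<open>The larger label determines the edge of the diagram, and the bijection between
    arcs and edges then determines the arc.\<close>
  have top: "e = e'" if e: "e \<in> arcs Q" "e' \<in> arcs Q"
    and eq: "max (\<sigma> (tail Q e)) (\<sigma> (head Q e)) = max (\<sigma> (tail Q e')) (\<sigma> (head Q e'))" for e e'
  proof -
    let ?a = "min (\<sigma> (tail Q e)) (\<sigma> (head Q e))" and ?a' = "min (\<sigma> (tail Q e')) (\<sigma> (head Q e'))"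
      and ?b = "max (\<sigma> (tail Q e)) (\<sigma> (head Q e))"
    have "{?a, ?b} \<in> E" unfolding set by (rule edge[OF e(1)])
    moreover have "{?a', ?b} \<in> E" unfolding eq set by (rule edge[OF e(2)])
    moreover have "?a < ?b" using ne[OF e(1)] by auto
    moreover have "?a' < ?b" using ne[OF e(2)] unfolding eq by auto
    ultimately have "?a = ?a'" by (rule dynkin_edge_unique[OF E])
    have "{\<sigma> (tail Q e), \<sigma> (head Q e)} = {?a, ?b}" by (rule set[symmetric])
    also have "\<dots> = {?a', max (\<sigma> (tail Q e')) (\<sigma> (head Q e'))}" by (simp only: \<open>?a = ?a'\<close> eq)
    also have "\<dots> = {\<sigma> (tail Q e'), \<sigma> (head Q e')}" by (rule set)
    finally have "{\<sigma> (tail Q e), \<sigma> (head Q e)} = {\<sigma> (tail Q e'), \<sigma> (head Q e')}" .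
    then show ?thesis using b e by (auto simp: bij_betw_def inj_on_def)
  qed
  show ?thesis
    by (rule walk_unique_if_labelled[of \<sigma>, OF ne top _ w]) (use \<sigma> in \<open>auto simp: bij_betw_def\<close>)
qed

section \<open>The path algebra of a quiver with unique paths\<close>

locale thin_quiver = fin_digraph Q for Q :: "('v, 'e) pre_digraph" +
  assumes walk_unique: "awalk u p v \<Longrightarrow> awalk u p' v \<Longrightarrow> p = p'"
begin

definition reach :: "'v \<Rightarrow> 'v \<Rightarrow> bool" where
  "reach u v \<longleftrightarrow> (\<exists>p. awalk u p v)"

definition path :: "'v \<Rightarrow> 'v \<Rightarrow> ('v, 'e) qpath" where
  "path u v = (u, THE p. awalk u p v, v)"

text \<open>An element of the path algebra is identified with the matrix of its coefficients at the
  unique paths; multiplication becomes the product of matrices.\<close>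

definition coef :: "(('v, 'e) qpath \<Rightarrow> 'k::field) \<Rightarrow> 'v \<Rightarrow> 'v \<Rightarrow> 'k" where
  "coef a u v = (if reach u v then a (path u v) else 0)"

definition of_coef :: "('v \<Rightarrow> 'v \<Rightarrow> 'k::field) \<Rightarrow> ('v, 'e) qpath \<Rightarrow> 'k" where
  "of_coef c p = (if p \<in> qpaths Q then c (fst p) (snd (snd p)) else 0)"

lemma reach_verts: "reach u v \<Longrightarrow> u \<in> verts Q \<and> v \<in> verts Q"
  by (auto simp: reach_def awalk_hd_in_verts awalk_last_in_verts)

lemma reach_refl: "u \<in> verts Q \<Longrightarrow> reach u u"
  by (auto simp: reach_def awalk_Nil_iff intro!: exI[of _ "[]"])

lemma reach_trans: "reach u v \<Longrightarrow> reach v w \<Longrightarrow> reach u w"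
  by (auto simp: reach_def intro: awalk_appendI)

text \<open>A directed cycle through \<open>u\<close> would be a second walk from \<open>u\<close>
  to \<open>u\<close> besides the empty one.\<close>

lemma reach_antisym:
  assumes "reach u v" "reach v u"
  shows "u = v"
proof -
  obtain p p' where w: "awalk u p v" "awalk v p' u" using assms by (auto simp: reach_def)
  then have "awalk u (p @ p') u" "awalk u [] u"
    by (auto intro: awalk_appendI simp: awalk_Nil_iff awalk_hd_in_verts)
  then have "p @ p' = []" by (rule walk_unique)
  then show ?thesis using w by (auto simp: awalk_Nil_iff)
qed

lemma path_eq: "awalk u p v \<Longrightarrow> path u v = (u, p, v)"
  unfolding path_def by (auto intro: the_equality walk_unique)

lemma path_refl: "u \<in> verts Q \<Longrightarrow> path u u = (u, [], u)"
  by (rule path_eq) (simp add: awalk_Nil_iff)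

lemma path_in: "reach u v \<Longrightarrow> path u v \<in> qpaths Q"
  by (auto simp: reach_def qpaths_def path_eq)

lemma qpathsE:
  assumes "r \<in> qpaths Q"
  obtains u v where "r = path u v" "reach u v"
proof -
  obtain u p v where "r = (u, p, v)" "awalk u p v" using assms by (auto simp: qpaths_def)
  then show ?thesis using that[of u v] by (auto simp: path_eq reach_def)
qed

lemma path_ends [simp]: "fst (path u v) = u" "snd (snd (path u v)) = v"
  by (auto simp: path_def)

lemma path_comp:
  assumes "reach u m" "reach m v"
  shows "qpath_comp (path m v) (path u m) = path u v"
proof -
  obtain p p' where w: "awalk u p m" "awalk m p' v" using assms by (auto simp: reach_def)
  then have "awalk u (p @ p') v" by (rule awalk_appendI)
  then show ?thesis using w by (simp add: path_eq del: awalk_append_iff)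
qed

lemma finite_qpaths: "finite (qpaths Q)"
proof (rule finite_subset)
  show "qpaths Q \<subseteq> (\<lambda>(u, v). path u v) ` (verts Q \<times> verts Q)"
  proof
    fix r
    assume "r \<in> qpaths Q"
    then obtain u v where "r = path u v" "reach u v" by (rule qpathsE)
    then show "r \<in> (\<lambda>(u, v). path u v) ` (verts Q \<times> verts Q)"
      using reach_verts by (intro image_eqI[of _ _ "(u, v)"]) auto
  qed
qed simp

text \<open>Paths are determined by their ends, so a factorization amounts to the choice of an
  intermediate vertex. This is what turns the convolution product into a matrix product.\<close>

lemma factorizations_path:
  assumes "reach u v"
  shows "qpath_factorizations Q (path u v) =
    (\<lambda>m. (path m v, path u m)) ` {m \<in> verts Q. reach u m \<and> reach m v}"
proof (intro equalityI subsetI)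
  fix x
  assume "x \<in> qpath_factorizations Q (path u v)"
  then obtain p p' where x: "x = (p, p')" "p \<in> qpaths Q" "p' \<in> qpaths Q" "fst p = snd (snd p')"
    "qpath_comp p p' = path u v"
    by (auto simp: qpath_factorizations_def)
  obtain a b c where p: "p = path b c" "reach b c" "p' = path a b" "reach a b"
    using x by (metis path_ends qpathsE)
  then have "path a c = path u v" using x path_comp by simp
  then have "a = u" "c = v" by (metis path_ends)+
  then show "x \<in> (\<lambda>m. (path m v, path u m)) ` {m \<in> verts Q. reach u m \<and> reach m v}"
    using p x by (auto dest: reach_verts)
next
  fix x
  assume "x \<in> (\<lambda>m. (path m v, path u m)) ` {m \<in> verts Q. reach u m \<and> reach m v}"
  then show "x \<in> qpath_factorizations Q (path u v)"
    by (auto simp: qpath_factorizations_def path_in path_comp)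
qed

text \<open>Composites of paths are paths; hence a product in the algebra again vanishes off the
  paths.\<close>

lemma factorizations_empty:
  assumes "r \<notin> qpaths Q"
  shows "qpath_factorizations Q r = {}"
proof -
  have False if "(p, p') \<in> qpath_factorizations Q r" for p p'
  proof -
    have x: "p \<in> qpaths Q" "p' \<in> qpaths Q" "fst p = snd (snd p')" "qpath_comp p p' = r"
      using that by (auto simp: qpath_factorizations_def)
    obtain a b c where p: "p = path b c" "reach b c" "p' = path a b" "reach a b"
      using x by (metis path_ends qpathsE)
    then have "r = path a c" using x path_comp by simp
    then show False using assms p path_in reach_trans by blast
  qed
  then show ?thesis by auto
qed

lemma coef_nz: "coef a u v \<noteq> 0 \<Longrightarrow> reach u v"
  by (auto simp: coef_def split: if_splits)

lemma coef_of_coef: "coef (of_coef c) u v = (if reach u v then c u v else 0)"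
  by (auto simp: coef_def of_coef_def path_in)

abbreviation PA :: "('k::field, ('v, 'e) qpath \<Rightarrow> 'k) module" where
  "PA \<equiv> path_algebra Q"

lemma PA_carrier: "carrier PA = {a. {p. a p \<noteq> 0} \<subseteq> qpaths Q}"
  using finite_qpaths by (auto simp: path_algebra_def dest: finite_subset)

lemma of_coef_closed: "of_coef c \<in> carrier PA"
  by (auto simp: PA_carrier of_coef_def)

lemma PA_eqI:
  assumes "a \<in> carrier PA" "b \<in> carrier PA" "\<And>u v. reach u v \<Longrightarrow> coef a u v = coef b u v"
  shows "a = b"
proof
  fix r
  show "a r = b r"
  proof (cases "r \<in> qpaths Q")
    case True
    then obtain u v where "r = path u v" "reach u v" by (rule qpathsE)
    then show ?thesis using assms(3)[of u v] by (simp add: coef_def)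
  next
    case False
    then have "a r = 0" "b r = 0" using assms(1,2) by (auto simp: PA_carrier)
    then show ?thesis by simp
  qed
qed

lemma coef_add: "coef (a \<oplus>\<^bsub>PA\<^esub> b) u v = coef a u v + coef b u v"
  by (simp add: coef_def path_algebra_def)

lemma coef_smult: "coef (c \<odot>\<^bsub>PA\<^esub> a) u v = c * coef a u v"
  by (simp add: coef_def path_algebra_def)

lemma coef_zero: "coef \<zero>\<^bsub>PA\<^esub> u v = 0"
  by (simp add: coef_def path_algebra_def)

lemma coef_one: "coef \<one>\<^bsub>PA\<^esub> u v = (if u = v \<and> u \<in> verts Q then 1 else 0)"
proof (cases "reach u v")
  case True
  have "\<exists>x\<in>verts Q. path u v = (x, [], x) \<Longrightarrow> u = v" by (auto simp: path_def)
  then show ?thesis using True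
    by (auto simp: coef_def path_algebra_def path_refl dest: reach_verts)
next
  case False
  then show ?thesis by (auto simp: coef_def reach_refl)
qed

text \<open>The right factor is traversed first, so it supplies the segment that leaves
  \<open>u\<close>. Vertices that are not on the way from \<open>u\<close> to \<open>v\<close>
  contribute zero, which lets the sum run over all vertices.\<close>

lemma coef_mult: "coef (a \<otimes>\<^bsub>PA\<^esub> b) u v = (\<Sum>m\<in>verts Q. coef a m v * coef b u m)"
proof (cases "reach u v")
  case True
  have inj: "inj_on (\<lambda>m. (path m v, path u m)) S" for S
    by (auto simp: inj_on_def) (metis path_ends)
  have "coef (a \<otimes>\<^bsub>PA\<^esub> b) u v = (\<Sum>m\<in>{m \<in> verts Q. reach u m \<and> reach m v}. a (path m v) * b (path u m))"
    using True by (simp add: coef_def path_algebra_def factorizations_path sum.reindex[OF inj])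
  also have "\<dots> = (\<Sum>m\<in>verts Q. coef a m v * coef b u m)"
    by (rule sum.mono_neutral_cong_left) (auto simp: coef_def)
  finally show ?thesis .
next
  case False
  then have "coef a m v * coef b u m = 0" for m
    using reach_trans[of u m v] by (auto simp: coef_def)
  then have "(\<Sum>m\<in>verts Q. coef a m v * coef b u m) = 0" by (intro sum.neutral) blast
  then show ?thesis using False by (simp add: coef_def[of "_ \<otimes>\<^bsub>PA\<^esub> _"])
qed

lemma PA_closed:
  "a \<in> carrier PA \<Longrightarrow> b \<in> carrier PA \<Longrightarrow> a \<oplus>\<^bsub>PA\<^esub> b \<in> carrier PA"
  "a \<in> carrier PA \<Longrightarrow> c \<odot>\<^bsub>PA\<^esub> a \<in> carrier PA"
  "\<zero>\<^bsub>PA\<^esub> \<in> carrier PA" "\<one>\<^bsub>PA\<^esub> \<in> carrier PA" "a \<otimes>\<^bsub>PA\<^esub> b \<in> carrier PA"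
proof -
  show "a \<otimes>\<^bsub>PA\<^esub> b \<in> carrier PA"
    unfolding PA_carrier
    by (clarsimp simp: path_algebra_def, rule ccontr) (simp add: factorizations_empty)
next
  assume "a \<in> carrier PA"
  then have a: "a p \<noteq> 0 \<Longrightarrow> p \<in> qpaths Q" for p by (auto simp: PA_carrier)
  then show "c \<odot>\<^bsub>PA\<^esub> a \<in> carrier PA"
    unfolding PA_carrier by (auto simp: path_algebra_def)
  assume "b \<in> carrier PA"
  then have b: "b p \<noteq> 0 \<Longrightarrow> p \<in> qpaths Q" for p by (auto simp: PA_carrier)
  show "a \<oplus>\<^bsub>PA\<^esub> b \<in> carrier PA"
    unfolding PA_carrier using a b by (simp add: path_algebra_def) (metis (mono_tags) add.right_neutral mem_Collect_eq subsetI)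
next
  show "\<zero>\<^bsub>PA\<^esub> \<in> carrier PA" "\<one>\<^bsub>PA\<^esub> \<in> carrier PA"
    unfolding PA_carrier by (auto simp: path_algebra_def qpaths_def awalk_Nil_iff)
qed

lemma PA_ring: "ring (PA :: ('k::field, _) module)"
proof (rule ringI)
  show "abelian_group (PA :: ('k, _) module)"
  proof (rule abelian_groupI)
    fix a :: "('v, 'e) qpath \<Rightarrow> 'k"
    assume a: "a \<in> carrier PA"
    show "\<exists>y\<in>carrier PA. y \<oplus>\<^bsub>PA\<^esub> a = \<zero>\<^bsub>PA\<^esub>"
      using a by (intro bexI[of _ "(-1) \<odot>\<^bsub>PA\<^esub> a"] PA_eqI PA_closed)
        (auto simp: coef_add coef_smult coef_zero)
  qed (auto intro!: PA_eqI PA_closed simp: coef_add coef_zero)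
  show "Group.monoid (PA :: ('k, _) module)"
  proof (rule monoidI)
    fix a b c :: "('v, 'e) qpath \<Rightarrow> 'k"
    show "a \<otimes>\<^bsub>PA\<^esub> b \<otimes>\<^bsub>PA\<^esub> c = a \<otimes>\<^bsub>PA\<^esub> (b \<otimes>\<^bsub>PA\<^esub> c)"
    proof (intro PA_eqI PA_closed)
      fix u v
      have "coef (a \<otimes>\<^bsub>PA\<^esub> b \<otimes>\<^bsub>PA\<^esub> c) u v =
        (\<Sum>m\<in>verts Q. \<Sum>l\<in>verts Q. coef a l v * coef b m l * coef c u m)"
        by (simp add: coef_mult sum_distrib_right)
      also have "\<dots> = (\<Sum>l\<in>verts Q. \<Sum>m\<in>verts Q. coef a l v * coef b m l * coef c u m)"
        by (rule sum.swap)
      also have "\<dots> = coef (a \<otimes>\<^bsub>PA\<^esub> (b \<otimes>\<^bsub>PA\<^esub> c)) u v"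
        by (simp add: coef_mult sum_distrib_left mult.assoc)
      finally show "coef (a \<otimes>\<^bsub>PA\<^esub> b \<otimes>\<^bsub>PA\<^esub> c) u v = coef (a \<otimes>\<^bsub>PA\<^esub> (b \<otimes>\<^bsub>PA\<^esub> c)) u v" .
    qed
    assume a: "a \<in> carrier PA"
    have l: "(\<Sum>m\<in>verts Q. coef \<one>\<^bsub>PA\<^esub> m v * coef a u m) = coef a u v" if "v \<in> verts Q" for u v
    proof -
      have "(\<Sum>m\<in>verts Q. coef \<one>\<^bsub>PA\<^esub> m v * coef a u m) = (\<Sum>m\<in>verts Q. if m = v then coef a u m else 0)"
        by (rule sum.cong) (auto simp: coef_one)
      then show ?thesis using that by simp
    qed
    have r: "(\<Sum>m\<in>verts Q. coef a m v * coef \<one>\<^bsub>PA\<^esub> u m) = coef a u v" if "u \<in> verts Q" for u v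
    proof -
      have "(\<Sum>m\<in>verts Q. coef a m v * coef \<one>\<^bsub>PA\<^esub> u m) = (\<Sum>m\<in>verts Q. if u = m then coef a m v else 0)"
        by (rule sum.cong) (auto simp: coef_one that)
      then show ?thesis using that by simp
    qed
    show "\<one>\<^bsub>PA\<^esub> \<otimes>\<^bsub>PA\<^esub> a = a"
      by (intro PA_eqI PA_closed a) (simp add: coef_mult l reach_verts)
    show "a \<otimes>\<^bsub>PA\<^esub> \<one>\<^bsub>PA\<^esub> = a"
      by (intro PA_eqI PA_closed a) (simp add: coef_mult r reach_verts)
  qed (auto intro: PA_closed)
next
  fix a b c :: "('v, 'e) qpath \<Rightarrow> 'k"
  show "(a \<oplus>\<^bsub>PA\<^esub> b) \<otimes>\<^bsub>PA\<^esub> c = a \<otimes>\<^bsub>PA\<^esub> c \<oplus>\<^bsub>PA\<^esub> b \<otimes>\<^bsub>PA\<^esub> c"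
    by (intro PA_eqI PA_closed) (simp add: coef_add coef_mult sum.distrib distrib_right)
  show "c \<otimes>\<^bsub>PA\<^esub> (a \<oplus>\<^bsub>PA\<^esub> b) = c \<otimes>\<^bsub>PA\<^esub> a \<oplus>\<^bsub>PA\<^esub> c \<otimes>\<^bsub>PA\<^esub> b"
    by (intro PA_eqI PA_closed) (simp add: coef_add coef_mult sum.distrib distrib_left)
qed

end

section \<open>Modules and isomorphisms\<close>

lemma mod_homI:
  assumes "f \<in> extensional (carrier M)" "\<And>x. x \<in> carrier M \<Longrightarrow> f x \<in> carrier N"
    "\<And>x y. x \<in> carrier M \<Longrightarrow> y \<in> carrier M \<Longrightarrow> f (x \<oplus>\<^bsub>M\<^esub> y) = f x \<oplus>\<^bsub>N\<^esub> f y"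
    "\<And>a x. a \<in> carrier A \<Longrightarrow> x \<in> carrier M \<Longrightarrow> f (a \<odot>\<^bsub>M\<^esub> x) = a \<odot>\<^bsub>N\<^esub> f x"
  shows "f \<in> mod_hom A M N"
  using assms by (auto simp: mod_hom_def PiE_def)

lemma mod_homD:
  assumes "f \<in> mod_hom A M N"
  shows "f \<in> extensional (carrier M)" "\<And>x. x \<in> carrier M \<Longrightarrow> f x \<in> carrier N"
    "\<And>x y. x \<in> carrier M \<Longrightarrow> y \<in> carrier M \<Longrightarrow> f (x \<oplus>\<^bsub>M\<^esub> y) = f x \<oplus>\<^bsub>N\<^esub> f y"
    "\<And>a x. a \<in> carrier A \<Longrightarrow> x \<in> carrier M \<Longrightarrow> f (a \<odot>\<^bsub>M\<^esub> x) = a \<odot>\<^bsub>N\<^esub> f x"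
  using assms by (auto simp: mod_hom_def PiE_def Pi_def)

lemma mod_hom_eqI:
  assumes "f \<in> mod_hom A M N" "g \<in> mod_hom A M N'" "\<And>x. x \<in> carrier M \<Longrightarrow> f x = g x"
  shows "f = g"
  using mod_homD(1)[OF assms(1)] mod_homD(1)[OF assms(2)] assms(3) by (rule extensionalityI)

lemma finite_mod_hom: "finite (carrier M) \<Longrightarrow> finite (carrier N) \<Longrightarrow> finite (mod_hom A M N)"
  by (rule finite_subset[OF _ finite_PiE[of "carrier M" "\<lambda>_. carrier N"]]) (auto simp: mod_hom_def)

lemma left_moduleD:
  assumes "left_module A M"
  shows "ring A" "abelian_group M"
    "\<And>a x. a \<in> carrier A \<Longrightarrow> x \<in> carrier M \<Longrightarrow> a \<odot>\<^bsub>M\<^esub> x \<in> carrier M"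
    "\<And>x y. x \<in> carrier M \<Longrightarrow> y \<in> carrier M \<Longrightarrow> x \<oplus>\<^bsub>M\<^esub> y \<in> carrier M"
    "\<zero>\<^bsub>M\<^esub> \<in> carrier M"
  using assms
  by (auto simp: left_module_def abelian_group.axioms abelian_monoid.a_closed
      left_module_axioms_def abelian_monoid.zero_closed)

lemma left_module_zero_smult:
  assumes "left_module A M" "x \<in> carrier M"
  shows "\<zero>\<^bsub>A\<^esub> \<odot>\<^bsub>M\<^esub> x = \<zero>\<^bsub>M\<^esub>"
proof -
  interpret left_module A M by (fact assms)
  have "\<zero>\<^bsub>A\<^esub> \<odot>\<^bsub>M\<^esub> x = \<zero>\<^bsub>A\<^esub> \<odot>\<^bsub>M\<^esub> x \<oplus>\<^bsub>M\<^esub> \<zero>\<^bsub>A\<^esub> \<odot>\<^bsub>M\<^esub> x"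
    using smult_l_distr[of "\<zero>\<^bsub>A\<^esub>" "\<zero>\<^bsub>A\<^esub>" x] assms(2) by simp
  then show ?thesis
    using assms(2) smult_closed[of "\<zero>\<^bsub>A\<^esub>" x] by (metis M.add.r_cancel_one' R.zero_closed)
qed

lemma mod_hom_zero:
  assumes "left_module A M" "left_module A N" "f \<in> mod_hom A M N"
  shows "f \<zero>\<^bsub>M\<^esub> = \<zero>\<^bsub>N\<^esub>"
proof -
  interpret M: left_module A M by (fact assms)
  have "f \<zero>\<^bsub>M\<^esub> = f (\<zero>\<^bsub>A\<^esub> \<odot>\<^bsub>M\<^esub> \<zero>\<^bsub>M\<^esub>)"
    using left_module_zero_smult[OF assms(1)] by simp
  also have "\<dots> = \<zero>\<^bsub>A\<^esub> \<odot>\<^bsub>N\<^esub> f \<zero>\<^bsub>M\<^esub>" using mod_homD(4)[OF assms(3)] by simp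
  also have "\<dots> = \<zero>\<^bsub>N\<^esub>"
    using left_module_zero_smult[OF assms(2)] mod_homD(2)[OF assms(3)] by simp
  finally show ?thesis .
qed

lemma mod_hom_compose:
  assumes "f \<in> mod_hom A L M" "g \<in> mod_hom A M N" "left_module A L"
  shows "compose (carrier L) g f \<in> mod_hom A L N"
  using mod_homD[OF assms(1)] mod_homD[OF assms(2)] left_moduleD[OF assms(3)]
  by (intro mod_homI) (auto simp: compose_def)

lemma mod_hom_diff:
  assumes "f \<in> mod_hom A M N" "left_module A M" "left_module A N" "x \<in> carrier M" "y \<in> carrier M"
  shows "f (x \<ominus>\<^bsub>M\<^esub> y) = f x \<ominus>\<^bsub>N\<^esub> f y"
proof -
  interpret M: left_module A M by (fact assms)
  interpret N: left_module A N by (fact assms)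
  note f = mod_homD[OF assms(1)]
  have "f (x \<ominus>\<^bsub>M\<^esub> y) \<oplus>\<^bsub>N\<^esub> f y = f x"
    using f(3)[of "x \<ominus>\<^bsub>M\<^esub> y" y] assms(4,5) by (simp add: a_minus_def M.M.a_assoc M.M.l_neg)
  then show ?thesis
    using f(2) assms(4,5) by (metis M.M.minus_closed N.M.add.inv_solve_right' a_minus_def)
qed

section \<open>Isomorphisms and transport of structure\<close>

definition mod_iso ::
    "('k, 'x) module \<Rightarrow> ('x, 'm) module \<Rightarrow> ('x, 'n) module \<Rightarrow> ('m \<Rightarrow> 'n) set" where
  "mod_iso A M N = {f \<in> mod_hom A M N. bij_betw f (carrier M) (carrier N)}"

text \<open>Cut down to the carrier, since members of \<open>mod_hom\<close> are
  extensional.\<close>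

definition inv_hom ::
    "('x, 'm) module \<Rightarrow> ('x, 'n) module \<Rightarrow> ('m \<Rightarrow> 'n) \<Rightarrow> 'n \<Rightarrow> 'm" where
  "inv_hom M N f = (\<lambda>y\<in>carrier N. inv_into (carrier M) f y)"

lemma mod_isoD:
  assumes "f \<in> mod_iso A M N"
  shows "f \<in> mod_hom A M N" "bij_betw f (carrier M) (carrier N)"
    "inj_on f (carrier M)" "f ` carrier M = carrier N"
  using assms by (auto simp: mod_iso_def bij_betw_def)

lemma inv_hom:
  assumes "f \<in> mod_iso A M N"
  shows "\<And>x. x \<in> carrier M \<Longrightarrow> inv_hom M N f (f x) = x"
    "\<And>y. y \<in> carrier N \<Longrightarrow> f (inv_hom M N f y) = y"
    "\<And>y. y \<in> carrier N \<Longrightarrow> inv_hom M N f y \<in> carrier M"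
  using mod_isoD[OF assms]
  by (auto simp: inv_hom_def inv_into_f_f f_inv_into_f inv_into_into mod_homD)

lemma mod_iso_inv:
  assumes "f \<in> mod_iso A M N" "left_module A M"
  shows "inv_hom M N f \<in> mod_iso A N M"
proof -
  note i = inv_hom[OF assms(1)] and f = mod_homD[OF mod_isoD(1)[OF assms(1)]]
  have inj: "x = y" if "x \<in> carrier M" "y \<in> carrier M" "f x = f y" for x y
    using that i(1) by metis
  have "inv_hom M N f \<in> mod_hom A N M"
  proof (rule mod_homI)
    show "inv_hom M N f \<in> extensional (carrier N)" by (simp add: inv_hom_def)
    fix x y a
    assume x: "x \<in> carrier N"
    have "f (a \<odot>\<^bsub>M\<^esub> inv_hom M N f x) = a \<odot>\<^bsub>N\<^esub> x" if "a \<in> carrier A"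
      using x f i that by auto
    then show "inv_hom M N f (a \<odot>\<^bsub>N\<^esub> x) = a \<odot>\<^bsub>M\<^esub> inv_hom M N f x" if "a \<in> carrier A"
      using x i left_moduleD[OF assms(2)] that by metis
    assume y: "y \<in> carrier N"
    have "f (inv_hom M N f x \<oplus>\<^bsub>M\<^esub> inv_hom M N f y) = x \<oplus>\<^bsub>N\<^esub> y"
      using x y f i by auto
    then show "inv_hom M N f (x \<oplus>\<^bsub>N\<^esub> y) = inv_hom M N f x \<oplus>\<^bsub>M\<^esub> inv_hom M N f y"
      using x y i left_moduleD[OF assms(2)] by metis
  qed (use i in auto)
  moreover have "bij_betw (inv_hom M N f) (carrier N) (carrier M)"
    by (rule bij_betwI[of _ _ _ f]) (use i f in auto)
  ultimately show ?thesis by (simp add: mod_iso_def)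
qed

lemma mod_iso_compose:
  assumes "f \<in> mod_iso A L M" "g \<in> mod_iso A M N" "left_module A L"
  shows "compose (carrier L) g f \<in> mod_iso A L N"
  using mod_hom_compose[OF mod_isoD(1) mod_isoD(1), OF assms]
    bij_betw_trans[OF mod_isoD(2)[OF assms(1)] mod_isoD(2)[OF assms(2)]]
  by (auto simp: mod_iso_def compose_def cong: bij_betw_cong)

lemma mod_iso_id: "left_module A M \<Longrightarrow> (\<lambda>x\<in>carrier M. x) \<in> mod_iso A M M"
  using left_moduleD[of A M] by (auto simp: mod_iso_def bij_betw_def inj_on_def intro!: mod_homI)

text \<open>A surjection carries every module axiom to its target. The condition on zero is explicit
  because the zero of \<open>N\<close> is not yet known to be neutral. The lemma serves for
  transported modules, for quotients and for the simple modules.\<close>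

lemma left_module_image:
  assumes M: "left_module A M" and f: "f \<in> mod_hom A M N" "f ` carrier M = carrier N" and z: "f \<zero>\<^bsub>M\<^esub> = \<zero>\<^bsub>N\<^esub>"
  shows "left_module A N"
proof -
  interpret M: left_module A M by (fact M)
  note h = mod_homD[OF f(1)]
  have s: "\<exists>y\<in>carrier M. x = f y" if "x \<in> carrier N" for x
    using f(2) that by blast
  have zN: "\<zero>\<^bsub>N\<^esub> = f \<zero>\<^bsub>M\<^esub>" using z ..
  have "abelian_group N"
  proof (rule abelian_groupI)
    show "\<zero>\<^bsub>N\<^esub> \<in> carrier N" unfolding zN by (simp add: h)
    fix x assume "x \<in> carrier N"
    then obtain x' where x: "x' \<in> carrier M" "x = f x'" using s by blast
    show "\<zero>\<^bsub>N\<^esub> \<oplus>\<^bsub>N\<^esub> x = x" unfolding zN x(2) using x(1) h(3)[of "\<zero>\<^bsub>M\<^esub>" x'] by simp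
    show "\<exists>y\<in>carrier N. y \<oplus>\<^bsub>N\<^esub> x = \<zero>\<^bsub>N\<^esub>"
      using x h(2)[of "\<ominus>\<^bsub>M\<^esub> x'"] h(3)[of "\<ominus>\<^bsub>M\<^esub> x'" x']
      by (intro bexI[of _ "f (\<ominus>\<^bsub>M\<^esub> x')"]) (auto simp: M.M.l_neg z)
    fix y assume "y \<in> carrier N"
    then obtain y' where y: "y' \<in> carrier M" "y = f y'" using s by blast
    show "x \<oplus>\<^bsub>N\<^esub> y \<in> carrier N" using x y h(2)[of "x' \<oplus>\<^bsub>M\<^esub> y'"] h(3)[of x' y'] by simp
    show "x \<oplus>\<^bsub>N\<^esub> y = y \<oplus>\<^bsub>N\<^esub> x"
      using x y h(3)[of x' y'] h(3)[of y' x'] by (simp add: M.M.a_comm)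
    fix w assume "w \<in> carrier N"
    then obtain w' where w: "w' \<in> carrier M" "w = f w'" using s by blast
    have "f (x' \<oplus>\<^bsub>M\<^esub> y' \<oplus>\<^bsub>M\<^esub> w') = f (x' \<oplus>\<^bsub>M\<^esub> (y' \<oplus>\<^bsub>M\<^esub> w'))"
      using x y w by (simp add: M.M.a_assoc)
    then show "x \<oplus>\<^bsub>N\<^esub> y \<oplus>\<^bsub>N\<^esub> w = x \<oplus>\<^bsub>N\<^esub> (y \<oplus>\<^bsub>N\<^esub> w)"
      using x y w by (simp add: h(3))
  qed
  moreover have "left_module_axioms A N"
  proof
    fix a x assume a: "a \<in> carrier A" and "x \<in> carrier N"
    then obtain x' where x: "x' \<in> carrier M" "x = f x'" using s by blast
    show "a \<odot>\<^bsub>N\<^esub> x \<in> carrier N"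
      using a x h(2)[of "a \<odot>\<^bsub>M\<^esub> x'"] h(4)[of a x'] M.smult_closed by simp
    { fix b assume b: "b \<in> carrier A"
      have "f ((a \<oplus>\<^bsub>A\<^esub> b) \<odot>\<^bsub>M\<^esub> x') = f (a \<odot>\<^bsub>M\<^esub> x' \<oplus>\<^bsub>M\<^esub> b \<odot>\<^bsub>M\<^esub> x')"
        using a b x by (simp add: M.smult_l_distr)
      then show "(a \<oplus>\<^bsub>A\<^esub> b) \<odot>\<^bsub>N\<^esub> x = a \<odot>\<^bsub>N\<^esub> x \<oplus>\<^bsub>N\<^esub> b \<odot>\<^bsub>N\<^esub> x"
        using a b x by (simp add: h(3) h(4) M.smult_closed)
      have "f ((a \<otimes>\<^bsub>A\<^esub> b) \<odot>\<^bsub>M\<^esub> x') = f (a \<odot>\<^bsub>M\<^esub> (b \<odot>\<^bsub>M\<^esub> x'))"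
        using a b x by (simp add: M.smult_assoc)
      then show "(a \<otimes>\<^bsub>A\<^esub> b) \<odot>\<^bsub>N\<^esub> x = a \<odot>\<^bsub>N\<^esub> (b \<odot>\<^bsub>N\<^esub> x)"
        using a b x by (simp add: h(4) M.smult_closed) }
    fix y assume "y \<in> carrier N"
    then obtain y' where y: "y' \<in> carrier M" "y = f y'" using s by blast
    have "f (a \<odot>\<^bsub>M\<^esub> (x' \<oplus>\<^bsub>M\<^esub> y')) = f (a \<odot>\<^bsub>M\<^esub> x' \<oplus>\<^bsub>M\<^esub> a \<odot>\<^bsub>M\<^esub> y')"
      using a y x by (simp add: M.smult_r_distr)
    then show "a \<odot>\<^bsub>N\<^esub> (x \<oplus>\<^bsub>N\<^esub> y) = a \<odot>\<^bsub>N\<^esub> x \<oplus>\<^bsub>N\<^esub> a \<odot>\<^bsub>N\<^esub> y"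
      using a x y by (simp add: h(3) h(4) M.smult_closed)
  next
    fix x assume "x \<in> carrier N"
    then obtain x' where x: "x' \<in> carrier M" "x = f x'" using s by blast
    then show "\<one>\<^bsub>A\<^esub> \<odot>\<^bsub>N\<^esub> x = x" using h(4)[of "\<one>\<^bsub>A\<^esub>" x'] by (simp add: M.smult_one)
  qed
  ultimately show ?thesis using M.R.ring_axioms by (simp add: left_module_def)
qed

lemma transport_module:
  fixes M :: "('x, 'm) module" and f :: "'m \<Rightarrow> 'n"
  assumes M: "left_module A M" and f: "inj_on f (carrier M)"
  shows "\<exists>N. left_module A N \<and> restrict f (carrier M) \<in> mod_iso A M N"
proof -
  interpret M: left_module A M by (fact M)
  define g where "g = inv_into (carrier M) f"
  define N :: "('x, 'n) module" where "N = \<lparr>carrier = f ` carrier M, monoid.mult = undefined,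
    one = undefined, ring.zero = f \<zero>\<^bsub>M\<^esub>, add = (\<lambda>x y. f (g x \<oplus>\<^bsub>M\<^esub> g y)),
    smult = (\<lambda>a x. f (a \<odot>\<^bsub>M\<^esub> g x))\<rparr>"
  have g: "g (f x) = x" if "x \<in> carrier M" for x using f that by (simp add: g_def)
  have i: "restrict f (carrier M) \<in> mod_iso A M N"
    using f M.smult_closed
    by (auto simp: mod_iso_def N_def bij_betw_def inj_on_def g intro!: mod_homI)
  moreover have "left_module A N"
    by (rule left_module_image[OF M mod_isoD(1)[OF i] mod_isoD(4)[OF i]]) (simp add: N_def)
  ultimately show ?thesis by blast
qed

text \<open>\<open>projective\<close>, \<open>C_cyc\<close> and \<open>isoclass\<close> refer to
  modules on \<open>nat\<close>; finite modules on other types are brought there.\<close>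

lemma transport_nat:
  assumes "left_module A M" "finite (carrier M)"
  obtains N :: "('x, nat) module" and f where "left_module A N" "f \<in> mod_iso A M N"
  using finite_imp_inj_to_nat_seg[OF assms(2)] transport_module[OF assms(1)] that by metis

lemma finite_iso: "f \<in> mod_iso A M N \<Longrightarrow> finite (carrier M) \<Longrightarrow> finite (carrier N)"
  by (metis finite_imageI mod_isoD(4))

text \<open>The facts about scalars by which finite dimension becomes finiteness of the carrier; the
  homological part of the development works over such a ring.\<close>

locale fin_alg = ring A for A :: "('k::{field,finite}, 'x) module" (structure) +
  assumes scalar_closed: "c \<odot>\<^bsub>A\<^esub> \<one>\<^bsub>A\<^esub> \<in> carrier A" and scalar_one: "1 \<odot>\<^bsub>A\<^esub> \<one>\<^bsub>A\<^esub> = \<one>\<^bsub>A\<^esub>" and scalar_zero: "0 \<odot>\<^bsub>A\<^esub> \<one>\<^bsub>A\<^esub> = \<zero>\<^bsub>A\<^esub>"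
begin

text \<open>A finite spanning set over a finite field admits only finitely many coefficient
  families. Conversely a finite carrier spans itself, with indicator functions as
  coefficients.\<close>

lemma fd_module_iff: "fd_module A M \<longleftrightarrow> left_module A M \<and> finite (carrier M)"
proof (intro iffI conjI)
  assume "fd_module A M"
  then show "left_module A M" by (simp add: fd_module_def)
  then interpret M: left_module A M .
  obtain B where B: "finite B" "B \<subseteq> carrier M"
    and x: "\<And>x. x \<in> carrier M \<Longrightarrow> \<exists>c :: _ \<Rightarrow> 'k. x = (\<Oplus>\<^bsub>M\<^esub>b\<in>B. (c b \<odot>\<^bsub>A\<^esub> \<one>\<^bsub>A\<^esub>) \<odot>\<^bsub>M\<^esub> b)"
    using \<open>fd_module A M\<close> by (auto simp: fd_module_def)
  have "carrier M \<subseteq> (\<lambda>c. \<Oplus>\<^bsub>M\<^esub>b\<in>B. (restrict c B b \<odot>\<^bsub>A\<^esub> \<one>\<^bsub>A\<^esub>) \<odot>\<^bsub>M\<^esub> b) ` (B \<rightarrow>\<^sub>E (UNIV :: 'k set))"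
  proof
    fix x assume "x \<in> carrier M"
    then obtain c :: "_ \<Rightarrow> 'k" where c: "x = (\<Oplus>\<^bsub>M\<^esub>b\<in>B. (c b \<odot>\<^bsub>A\<^esub> \<one>\<^bsub>A\<^esub>) \<odot>\<^bsub>M\<^esub> b)" using x by blast
    show "x \<in> (\<lambda>c. \<Oplus>\<^bsub>M\<^esub>b\<in>B. (restrict c B b \<odot>\<^bsub>A\<^esub> \<one>\<^bsub>A\<^esub>) \<odot>\<^bsub>M\<^esub> b) ` (B \<rightarrow>\<^sub>E (UNIV :: 'k set))"
    proof (rule image_eqI[of _ _ "restrict c B"])
      have "(\<Oplus>\<^bsub>M\<^esub>b\<in>B. (c b \<odot>\<^bsub>A\<^esub> \<one>\<^bsub>A\<^esub>) \<odot>\<^bsub>M\<^esub> b) =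
        (\<Oplus>\<^bsub>M\<^esub>b\<in>B. (restrict (restrict c B) B b \<odot>\<^bsub>A\<^esub> \<one>\<^bsub>A\<^esub>) \<odot>\<^bsub>M\<^esub> b)"
        by (rule M.M.finsum_cong') (use B scalar_closed M.smult_closed in auto)
      then show "x = (\<Oplus>\<^bsub>M\<^esub>b\<in>B. (restrict (restrict c B) B b \<odot>\<^bsub>A\<^esub> \<one>\<^bsub>A\<^esub>) \<odot>\<^bsub>M\<^esub> b)"
        using c by simp
    qed auto
  qed
  then show "finite (carrier M)"
    by (rule finite_subset) (intro finite_imageI finite_PiE B; simp)
next
  assume a: "left_module A M \<and> finite (carrier M)"
  then interpret M: left_module A M by simp
  have "\<exists>c :: _ \<Rightarrow> 'k. x = (\<Oplus>\<^bsub>M\<^esub>b\<in>carrier M. (c b \<odot>\<^bsub>A\<^esub> \<one>\<^bsub>A\<^esub>) \<odot>\<^bsub>M\<^esub> b)"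
    if x: "x \<in> carrier M" for x
  proof
    have "(\<Oplus>\<^bsub>M\<^esub>b\<in>carrier M. ((if b = x then 1 else 0 :: 'k) \<odot>\<^bsub>A\<^esub> \<one>\<^bsub>A\<^esub>) \<odot>\<^bsub>M\<^esub> b) =
      (\<Oplus>\<^bsub>M\<^esub>b\<in>carrier M. if x = b then b else \<zero>\<^bsub>M\<^esub>)"
      by (rule M.M.finsum_cong')
        (auto simp: scalar_one scalar_zero M.smult_one left_module_zero_smult[of A M] a)
    also have "\<dots> = x" using M.M.finsum_singleton[of x "carrier M" "\<lambda>b. b"] x a by simp
    finally show "x = (\<Oplus>\<^bsub>M\<^esub>b\<in>carrier M. ((if b = x then 1 else 0 :: 'k) \<odot>\<^bsub>A\<^esub> \<one>\<^bsub>A\<^esub>) \<odot>\<^bsub>M\<^esub> b)" ..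
  qed
  then show "fd_module A M" using a by (auto simp: fd_module_def)
qed

lemma projectiveD:
  "projective A P \<Longrightarrow> left_module A P" "projective A P \<Longrightarrow> finite (carrier P)"
  by (auto simp: projective_def fd_module_iff)

text \<open>The definition of \<open>projective\<close> tests only against modules on
  \<open>nat\<close>. Here \<open>X\<close> and \<open>Y\<close> are moved there and the lift is
  carried back, so that targets on all types are covered.\<close>

lemma projective_lift:
  assumes P: "projective A P" and X: "left_module A X" "finite (carrier X)"
    and Y: "left_module A Y" "finite (carrier Y)"
    and g: "g \<in> mod_hom A X Y" "g ` carrier X = carrier Y" and h: "h \<in> mod_hom A P Y"
  obtains l where "l \<in> mod_hom A P X" "\<And>x. x \<in> carrier P \<Longrightarrow> g (l x) = h x"
proof -
  obtain X' :: "('x, nat) module" and \<alpha> where X': "left_module A X'" "\<alpha> \<in> mod_iso A X X'"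
    by (rule transport_nat[OF X])
  obtain Y' :: "('x, nat) module" and \<beta> where Y': "left_module A Y'" "\<beta> \<in> mod_iso A Y Y'"
    by (rule transport_nat[OF Y])
  note fin = finite_iso[OF X'(2) X(2)] finite_iso[OF Y'(2) Y(2)]
  let ?i = "inv_hom X X' \<alpha>"
  note i = mod_isoD[OF mod_iso_inv[OF X'(2) X(1)]] and b = mod_isoD[OF Y'(2)]
  define g' where "g' = compose (carrier X') \<beta> (compose (carrier X') g ?i)"
  define h' where "h' = compose (carrier P) \<beta> h"
  have g': "g' \<in> mod_hom A X' Y'" unfolding g'_def
    using i b g X' by (intro mod_hom_compose)
  have h': "h' \<in> mod_hom A P Y'" unfolding h'_def
    using b h projectiveD[OF P] by (intro mod_hom_compose)
  have "g' ` carrier X' = \<beta> ` g ` ?i ` carrier X'"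
    unfolding g'_def by (force simp: compose_def)
  then have "g' ` carrier X' = carrier Y'" using i b g by simp
  then obtain l where l: "l \<in> mod_hom A P X'" "\<And>x. x \<in> carrier P \<Longrightarrow> g' (l x) = h' x"
    using P g' h' X'(1) Y'(1) fin unfolding projective_def fd_module_iff by metis
  have "compose (carrier P) ?i l \<in> mod_hom A P X"
    using l i projectiveD[OF P] by (intro mod_hom_compose)
  moreover have "g (compose (carrier P) ?i l x) = h x" if x: "x \<in> carrier P" for x
  proof -
    have "\<beta> (g (?i (l x))) = \<beta> (h x)"
      using l(2)[OF x] x mod_homD[OF l(1)] by (simp add: g'_def h'_def compose_def)
    then have "g (?i (l x)) = h x"
      by (rule inj_onD[OF b(3)]) (use mod_homD[OF l(1)] mod_homD[OF i(1)] mod_homD[OF g(1)] mod_homD[OF h] x in auto)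
    then show ?thesis using x by (simp add: compose_def)
  qed
  ultimately show ?thesis by (rule that)
qed

lemma projective_iso:
  assumes P: "projective A P" and N: "left_module A N" and f: "f \<in> mod_iso A P N"
  shows "projective A N"
  unfolding projective_def fd_module_iff
proof (intro conjI allI impI ballI N)
  note P' = projectiveD[OF P]
  show "finite (carrier N)" using finite_iso[OF f P'(2)] .
  fix X Y :: "('x, nat) module" and g h
  assume X: "left_module A X \<and> finite (carrier X)" and Y: "left_module A Y \<and> finite (carrier Y)"
    and g: "g \<in> mod_hom A X Y" "g ` carrier X = carrier Y" and h: "h \<in> mod_hom A N Y"
  have "compose (carrier P) h f \<in> mod_hom A P Y"
    using mod_isoD(1)[OF f] h P'(1) by (rule mod_hom_compose)
  then obtain l where l: "l \<in> mod_hom A P X" "\<And>x. x \<in> carrier P \<Longrightarrow> g (l x) = compose (carrier P) h f x"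
    using projective_lift[OF P _ _ _ _ g] X Y by metis
  show "\<exists>l\<in>mod_hom A N X. \<forall>x\<in>carrier N. g (l x) = h x"
  proof
    show "compose (carrier N) l (inv_hom P N f) \<in> mod_hom A N X"
      using mod_isoD(1)[OF mod_iso_inv[OF f P'(1)]] l(1) N by (rule mod_hom_compose)
    show "\<forall>x\<in>carrier N. g (compose (carrier N) l (inv_hom P N f) x) = h x"
      using l(2) inv_hom[OF f] by (simp add: compose_def)
  qed
qed

end

section \<open>Direct sums, quotients and complexes\<close>

lemma dsum_simps [simp]:
  "carrier (M \<oplus>\<^sub>m N) = carrier M \<times> carrier N" "\<zero>\<^bsub>M \<oplus>\<^sub>m N\<^esub> = (\<zero>\<^bsub>M\<^esub>, \<zero>\<^bsub>N\<^esub>)"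
  "(x, y) \<oplus>\<^bsub>M \<oplus>\<^sub>m N\<^esub> (x', y') = (x \<oplus>\<^bsub>M\<^esub> x', y \<oplus>\<^bsub>N\<^esub> y')"
  "a \<odot>\<^bsub>M \<oplus>\<^sub>m N\<^esub> (x, y) = (a \<odot>\<^bsub>M\<^esub> x, a \<odot>\<^bsub>N\<^esub> y)"
  by (simp_all add: dsum_def)

lemma left_module_dsum:
  assumes "left_module A M" "left_module A N"
  shows "left_module A (M \<oplus>\<^sub>m N)"
proof -
  interpret M: left_module A M by (fact assms)
  interpret N: left_module A N by (fact assms)
  have "abelian_group (M \<oplus>\<^sub>m N)"
  proof (rule abelian_groupI)
    fix x assume "x \<in> carrier (M \<oplus>\<^sub>m N)"
    then show "\<exists>y\<in>carrier (M \<oplus>\<^sub>m N). y \<oplus>\<^bsub>M \<oplus>\<^sub>m N\<^esub> x = \<zero>\<^bsub>M \<oplus>\<^sub>m N\<^esub>"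
      by (intro bexI[of _ "(\<ominus>\<^bsub>M\<^esub> fst x, \<ominus>\<^bsub>N\<^esub> snd x)"]) (auto simp: M.M.l_neg N.M.l_neg)
  qed (auto simp: M.M.a_ac N.M.a_ac)
  moreover have "left_module_axioms A (M \<oplus>\<^sub>m N)"
    by standard (auto simp: M.smult_closed N.smult_closed M.smult_l_distr N.smult_l_distr
        M.smult_r_distr N.smult_r_distr M.smult_assoc N.smult_assoc M.smult_one N.smult_one)
  ultimately show ?thesis using M.R.ring_axioms by (simp add: left_module_def)
qed

definition pair_hom :: "('x, 'm) module \<Rightarrow> ('x, 'n) module \<Rightarrow> ('m \<Rightarrow> 'a) \<Rightarrow> ('n \<Rightarrow> 'b) \<Rightarrow>
    'm \<times> 'n \<Rightarrow> 'a \<times> 'b" where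
  "pair_hom M N f g = (\<lambda>(x, y)\<in>carrier M \<times> carrier N. (f x, g y))"

lemma pair_hom_iso:
  assumes f: "f \<in> mod_iso A M M'" and g: "g \<in> mod_iso A N N'"
    and MN: "left_module A M" "left_module A N"
  shows "pair_hom M N f g \<in> mod_iso A (M \<oplus>\<^sub>m N) (M' \<oplus>\<^sub>m N')"
proof -
  note F = mod_homD[OF mod_isoD(1)[OF f]] mod_homD[OF mod_isoD(1)[OF g]]
    left_moduleD[OF MN(1)] left_moduleD[OF MN(2)]
  have "pair_hom M N f g \<in> mod_hom A (M \<oplus>\<^sub>m N) (M' \<oplus>\<^sub>m N')"
    by (rule mod_homI) (auto simp: pair_hom_def F)
  moreover have "bij_betw (pair_hom M N f g) (carrier (M \<oplus>\<^sub>m N)) (carrier (M' \<oplus>\<^sub>m N'))"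
    by (rule bij_betwI[of _ _ _ "pair_hom M' N' (inv_hom M M' f) (inv_hom N N' g)"])
      (auto simp: pair_hom_def inv_hom[OF f] inv_hom[OF g] F)
  ultimately show ?thesis by (simp add: mod_iso_def)
qed

section \<open>The zero module, submodules and quotients\<close>

lemma left_module_zero: "ring A \<Longrightarrow> left_module A zero_module"
  unfolding left_module_def
  by (auto simp: zero_module_def left_module_axioms_def intro!: abelian_groupI)

lemma zero_hom: "ring A \<Longrightarrow> left_module A M \<Longrightarrow> (\<lambda>x\<in>carrier zero_module. \<zero>\<^bsub>M\<^esub>) \<in> mod_hom A zero_module M"
proof -
  assume "left_module A M"
  then interpret left_module A M .
  have "a \<odot>\<^bsub>M\<^esub> \<zero>\<^bsub>M\<^esub> = \<zero>\<^bsub>M\<^esub>" if "a \<in> carrier A" for a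
  proof -
    have "a \<odot>\<^bsub>M\<^esub> \<zero>\<^bsub>M\<^esub> \<oplus>\<^bsub>M\<^esub> a \<odot>\<^bsub>M\<^esub> \<zero>\<^bsub>M\<^esub> = a \<odot>\<^bsub>M\<^esub> \<zero>\<^bsub>M\<^esub>"
      using smult_r_distr[of a "\<zero>\<^bsub>M\<^esub>" "\<zero>\<^bsub>M\<^esub>"] that by simp
    then show ?thesis using smult_closed[OF that] by (metis M.add.r_cancel_one' M.zero_closed)
  qed
  then show ?thesis by (intro mod_homI) (auto simp: zero_module_def)
qed

lemma submodule_image:
  assumes "left_module A M" "left_module A N" "f \<in> mod_hom A M N" "submodule U A M"
  shows "submodule (f ` U) A N"
proof -
  interpret M: left_module A M by (fact assms)
  interpret N: left_module A N by (fact assms)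
  interpret U: submodule U A M by (fact assms)
  note f = mod_homD[OF assms(3)]
  have sub: "x \<in> carrier M" if "x \<in> U" for x using U.subset that by auto
  have neg: "\<ominus>\<^bsub>N\<^esub> f x = f (\<ominus>\<^bsub>M\<^esub> x)" if "x \<in> carrier M" for x
    using mod_hom_diff[OF assms(3,1,2), of "\<zero>\<^bsub>M\<^esub>" x] mod_hom_zero[OF assms(1-3)] that f
    by (simp add: a_minus_def)
  show ?thesis
  proof (intro submodule.intro subgroup.intro submodule_axioms.intro)
    show "f ` U \<subseteq> carrier (add_monoid N)" using f sub by auto
    show "\<one>\<^bsub>add_monoid N\<^esub> \<in> f ` U"
      using mod_hom_zero[OF assms(1-3)] U.one_closed by (auto intro!: image_eqI[of _ _ "\<zero>\<^bsub>M\<^esub>"])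
    fix x assume "x \<in> f ` U"
    then obtain x' where x: "x' \<in> U" "x = f x'" by blast
    show "inv\<^bsub>add_monoid N\<^esub> x \<in> f ` U"
      using neg[OF sub[OF x(1)]] x U.m_inv_closed[OF x(1)]
      by (auto simp: a_inv_def intro!: image_eqI[of _ _ "\<ominus>\<^bsub>M\<^esub> x'"])
    { fix y assume "y \<in> f ` U"
      then obtain y' where y: "y' \<in> U" "y = f y'" by blast
      show "x \<otimes>\<^bsub>add_monoid N\<^esub> y \<in> f ` U"
        using x y f sub U.m_closed[OF x(1) y(1)] by (auto intro!: image_eqI[of _ _ "x' \<oplus>\<^bsub>M\<^esub> y'"]) }
    fix a assume "a \<in> carrier A"
    then show "a \<odot>\<^bsub>N\<^esub> x \<in> f ` U"
      using x f sub by (auto intro!: image_eqI[of _ _ "a \<odot>\<^bsub>M\<^esub> x'"])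
  qed
qed

lemma submodule_carrier:
  assumes "left_module A M"
  shows "submodule (carrier M) A M"
proof -
  interpret M: left_module A M by (fact assms)
  show ?thesis
    using group.subgroup_self[OF M.M.a_group] M.smult_closed
    by (auto intro!: submodule.intro submodule_axioms.intro)
qed

lemma quot_module:
  assumes M: "left_module A M" and N: "submodule N A M"
  defines "p \<equiv> \<lambda>x\<in>carrier M. N +>\<^bsub>M\<^esub> x"
  shows "left_module A (quot_module M N)" "p \<in> mod_hom A M (quot_module M N)"
    "p ` carrier M = carrier (quot_module M N)" "a_kernel M (quot_module M N) p = N"
proof -
  interpret M: left_module A M by (fact M)
  interpret N: submodule N A M by (fact N)
  have sub: "N \<subseteq> carrier M" using N.subset by simp
  have subg: "subgroup N (add_monoid M)" by (rule N.subgroup_axioms)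
  interpret S: abelian_subgroup N M
    by (rule abelian_subgroupI3[OF additive_subgroup.intro[OF subg] M.M.abelian_group_axioms])
  \<comment> \<open>The action on a quotient is defined through all representatives at once; since
    \<open>N\<close> is a submodule the cosets in this union coincide.\<close>
  have sm: "(\<Union>y\<in>N +>\<^bsub>M\<^esub> x. N +>\<^bsub>M\<^esub> (a \<odot>\<^bsub>M\<^esub> y)) = N +>\<^bsub>M\<^esub> (a \<odot>\<^bsub>M\<^esub> x)"
    if a: "a \<in> carrier A" and x: "x \<in> carrier M" for a x
  proof -
    have "N +>\<^bsub>M\<^esub> (a \<odot>\<^bsub>M\<^esub> y) = N +>\<^bsub>M\<^esub> (a \<odot>\<^bsub>M\<^esub> x)" if y: "y \<in> N +>\<^bsub>M\<^esub> x" for y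
    proof -
      obtain h where h: "h \<in> N" "y = h \<oplus>\<^bsub>M\<^esub> x" using y by (auto simp: a_r_coset_def')
      have "a \<odot>\<^bsub>M\<^esub> y = a \<odot>\<^bsub>M\<^esub> h \<oplus>\<^bsub>M\<^esub> a \<odot>\<^bsub>M\<^esub> x"
        using h a x sub by (auto simp: M.smult_r_distr)
      then have "a \<odot>\<^bsub>M\<^esub> y \<in> N +>\<^bsub>M\<^esub> (a \<odot>\<^bsub>M\<^esub> x)"
        using a h unfolding a_r_coset_def' by (auto intro!: bexI[of _ "a \<odot>\<^bsub>M\<^esub> h"])
      then show ?thesis using S.a_repr_independence' M.smult_closed[OF a x] by metis
    qed
    moreover have "x \<in> N +>\<^bsub>M\<^esub> x" using x by (rule S.a_rcos_self)
    ultimately show ?thesis by blast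
  qed
  show h: "p \<in> mod_hom A M (quot_module M N)"
    by (rule mod_homI)
      (auto simp: p_def quot_module_def S.a_rcos_sum sm M.smult_closed M.M.a_rcosetsI[OF sub])
  show s: "p ` carrier M = carrier (quot_module M N)"
    by (auto simp: p_def quot_module_def A_RCOSETS_def')
  have z: "p \<zero>\<^bsub>M\<^esub> = \<zero>\<^bsub>quot_module M N\<^esub>"
    using M.M.a_coset_join2[OF M.M.zero_closed subg] N.one_closed by (simp add: p_def quot_module_def)
  show "left_module A (quot_module M N)" by (rule left_module_image[OF M h s z])
  have "N +>\<^bsub>M\<^esub> x = N \<longleftrightarrow> x \<in> N" if "x \<in> carrier M" for x
    using M.M.a_coset_join2[OF that subg] S.a_rcos_self[OF that] by blast
  then show "a_kernel M (quot_module M N) p = N"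
    using sub by (auto simp: a_kernel_def' p_def quot_module_def)
qed

text \<open>Neither square zero nor projectivity is demanded, because extensions along an arbitrary
  \<open>h\<close> have to be handled before it is known whether they are complexes.\<close>

definition pre_cyc :: "('k, 'x) module \<Rightarrow> ('x, 'm) cyc \<Rightarrow> bool" where
  "pre_cyc A X \<longleftrightarrow> left_module A (fst X) \<and> finite (carrier (fst X)) \<and> snd X \<in> mod_hom A (fst X) (fst X)"

definition cyc_equiv :: "('k, 'x) module \<Rightarrow> ('x, 'm) cyc \<Rightarrow> ('x, 'n) cyc \<Rightarrow> bool" where
  "cyc_equiv A X Y \<longleftrightarrow> cyc_iso A X Y \<noteq> {}"

lemma cyc_homD:
  assumes "f \<in> cyc_hom A X Y"
  shows "f \<in> mod_hom A (fst X) (fst Y)" "\<And>x. x \<in> carrier (fst X) \<Longrightarrow> f (snd X x) = snd Y (f x)"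
  using assms by (auto simp: cyc_hom_def)

lemma cyc_isoD:
  assumes "f \<in> cyc_iso A X Y"
  shows "f \<in> mod_iso A (fst X) (fst Y)" "f \<in> cyc_hom A X Y"
    "\<And>x. x \<in> carrier (fst X) \<Longrightarrow> f (snd X x) = snd Y (f x)"
  using assms by (auto simp: cyc_iso_def cyc_hom_def mod_iso_def)

lemma cyc_isoI:
  assumes "f \<in> mod_iso A (fst X) (fst Y)" "\<And>x. x \<in> carrier (fst X) \<Longrightarrow> f (snd X x) = snd Y (f x)"
  shows "f \<in> cyc_iso A X Y"
  using assms by (auto simp: cyc_iso_def cyc_hom_def mod_iso_def)

lemma cyc_equivI:
  "f \<in> mod_iso A (fst X) (fst Y) \<Longrightarrow> (\<And>x. x \<in> carrier (fst X) \<Longrightarrow> f (snd X x) = snd Y (f x)) \<Longrightarrow>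
   cyc_equiv A X Y"
  unfolding cyc_equiv_def using cyc_isoI by blast

lemma cyc_hom_compose:
  assumes "f \<in> cyc_hom A X Y" "g \<in> cyc_hom A Y Z" "pre_cyc A X"
  shows "compose (carrier (fst X)) g f \<in> cyc_hom A X Z"
proof -
  have "compose (carrier (fst X)) g f \<in> mod_hom A (fst X) (fst Z)"
    using assms by (intro mod_hom_compose) (auto simp: cyc_hom_def pre_cyc_def)
  then show ?thesis
    using assms mod_homD(2)[of f A "fst X" "fst Y"] mod_homD(2)[of "snd X" A "fst X" "fst X"]
    by (auto simp: cyc_hom_def compose_def pre_cyc_def)
qed

lemma cyc_iso_compose:
  assumes "f \<in> cyc_iso A X Y" "g \<in> cyc_iso A Y Z" "pre_cyc A X"
  shows "compose (carrier (fst X)) g f \<in> cyc_iso A X Z"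
  using cyc_hom_compose[of f A X Y g Z] mod_iso_compose[of f A "fst X" "fst Y" g "fst Z"] assms
  by (auto simp: cyc_iso_def mod_iso_def pre_cyc_def cyc_hom_def)

lemma cyc_iso_inv:
  assumes f: "f \<in> cyc_iso A X Y" and X: "pre_cyc A X"
  shows "inv_hom (fst X) (fst Y) f \<in> cyc_iso A Y X"
proof (rule cyc_isoI)
  note i = cyc_isoD[OF f]
  note X' = X[unfolded pre_cyc_def]
  show "inv_hom (fst X) (fst Y) f \<in> mod_iso A (fst Y) (fst X)"
    using mod_iso_inv[OF i(1)] X' by simp
  fix y assume y: "y \<in> carrier (fst Y)"
  let ?x = "inv_hom (fst X) (fst Y) f y"
  have "f (snd X ?x) = snd Y y" using i(3)[of ?x] inv_hom[OF i(1)] y by simp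
  then show "inv_hom (fst X) (fst Y) f (snd Y y) = snd X ?x"
    using inv_hom(1)[OF i(1), of "snd X ?x"] inv_hom(3)[OF i(1) y] X' mod_homD(2) by metis
qed

lemma cyc_equiv_refl: "pre_cyc A X \<Longrightarrow> cyc_equiv A X X"
  by (rule cyc_equivI[of "\<lambda>x\<in>carrier (fst X). x"])
    (auto simp: pre_cyc_def mod_iso_id mod_homD)

lemma cyc_equiv_sym: "cyc_equiv A X Y \<Longrightarrow> pre_cyc A X \<Longrightarrow> cyc_equiv A Y X"
  unfolding cyc_equiv_def using cyc_iso_inv by blast

lemma cyc_equiv_trans: "cyc_equiv A X Y \<Longrightarrow> cyc_equiv A Y Z \<Longrightarrow> pre_cyc A X \<Longrightarrow> cyc_equiv A X Z"
  unfolding cyc_equiv_def using cyc_iso_compose by blast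

lemma finite_cyc_iso: "finite (carrier (fst X)) \<Longrightarrow> finite (carrier (fst Y)) \<Longrightarrow> finite (cyc_iso A X Y)"
  by (rule finite_subset[OF _ finite_mod_hom[of "fst X" "fst Y" A]])
    (auto simp: cyc_iso_def cyc_hom_def)

text \<open>Composition with isomorphisms on both sides is injective. The opposite inequality
  follows by applying this to the inverse isomorphisms.\<close>

lemma card_cyc_iso_le:
  assumes f: "f \<in> cyc_iso A X' X" and g: "g \<in> cyc_iso A Y Y'"
    and X: "pre_cyc A X" and X': "pre_cyc A X'" and Y: "pre_cyc A Y" and Y': "pre_cyc A Y'"
  shows "card (cyc_iso A X Y) \<le> card (cyc_iso A X' Y')"
proof (rule card_inj_on_le)
  let ?F = "\<lambda>h. compose (carrier (fst X')) g (compose (carrier (fst X')) h f)"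
  show "?F ` cyc_iso A X Y \<subseteq> cyc_iso A X' Y'"
    using f g X' by (auto intro: cyc_iso_compose)
  show "finite (cyc_iso A X' Y')" using X' Y' by (intro finite_cyc_iso) (auto simp: pre_cyc_def)
  note i = cyc_isoD[OF f] and j = cyc_isoD[OF g]
  show "inj_on ?F (cyc_iso A X Y)"
  proof (rule inj_onI)
    fix h h' assume h: "h \<in> cyc_iso A X Y" "h' \<in> cyc_iso A X Y" and eq: "?F h = ?F h'"
    note hh = mod_isoD(1)[OF cyc_isoD(1)[OF h(1)]] mod_isoD(1)[OF cyc_isoD(1)[OF h(2)]]
    show "h = h'"
    proof (rule mod_hom_eqI[OF hh])
      fix x assume x: "x \<in> carrier (fst X)"
      let ?y = "inv_hom (fst X') (fst X) f x"
      have "g (h (f ?y)) = g (h' (f ?y))"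
        using fun_cong[OF eq, of ?y] inv_hom(3)[OF i(1) x] by (simp add: compose_def)
      then have "g (h x) = g (h' x)" using inv_hom(2)[OF i(1) x] by simp
      then show "h x = h' x"
        using inj_onD[OF mod_isoD(3)[OF j(1)]] mod_homD(2)[OF hh(1) x] mod_homD(2)[OF hh(2) x] by simp
    qed
  qed
qed

lemma card_cyc_iso_cong:
  assumes "cyc_equiv A X X'" "cyc_equiv A Y Y'" "pre_cyc A X" "pre_cyc A X'" "pre_cyc A Y" "pre_cyc A Y'"
  shows "card (cyc_iso A X Y) = card (cyc_iso A X' Y')"
proof -
  obtain f g f' g' where fg: "f \<in> cyc_iso A X X'" "g \<in> cyc_iso A Y Y'" "f' \<in> cyc_iso A X' X" "g' \<in> cyc_iso A Y' Y"
    using assms cyc_equiv_sym[OF assms(1,3)] cyc_equiv_sym[OF assms(2,5)] by (auto simp: cyc_equiv_def)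
  show ?thesis
    using card_cyc_iso_le[OF fg(3,2)] card_cyc_iso_le[OF fg(1,4)] assms by (meson le_antisym)
qed

text \<open>The middle term of an extension of \<open>X\<close> by \<open>Y\<close> that splits as a sequence of modules.\<close>

definition ext_cyc :: "('x, 'm) cyc \<Rightarrow> ('x, 'n) cyc \<Rightarrow> ('n \<Rightarrow> 'm) \<Rightarrow> ('x, 'm \<times> 'n) cyc" where
  "ext_cyc Y X h = (fst Y \<oplus>\<^sub>m fst X,
     \<lambda>(y, x)\<in>carrier (fst Y) \<times> carrier (fst X). (snd Y y \<oplus>\<^bsub>fst Y\<^esub> h x, snd X x))"

definition zero_map :: "('x, 'm) module \<Rightarrow> ('x, 'n) module \<Rightarrow> 'm \<Rightarrow> 'n" where
  "zero_map M N = (\<lambda>x\<in>carrier M. \<zero>\<^bsub>N\<^esub>)"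

lemma zero_map:
  assumes "left_module A M" "left_module A N"
  shows "zero_map M N \<in> mod_hom A M N"
proof -
  interpret M: left_module A M by (fact assms)
  interpret N: left_module A N by (fact assms)
  have "(\<lambda>x\<in>carrier zero_module. \<zero>\<^bsub>N\<^esub>) \<in> mod_hom A zero_module N"
    by (rule zero_hom[OF M.R.ring_axioms assms(2)])
  then have "a \<odot>\<^bsub>N\<^esub> \<zero>\<^bsub>N\<^esub> = \<zero>\<^bsub>N\<^esub>" if "a \<in> carrier A" for a
    using mod_homD(4)[of "\<lambda>x\<in>carrier zero_module. \<zero>\<^bsub>N\<^esub>" A zero_module N a "()"] that
    by (simp add: zero_module_def)
  then show ?thesis by (intro mod_homI) (auto simp: zero_map_def M.smult_closed)
qed

text \<open>Direct sums of complexes and the complexes \<open>upper_cyc\<close> are both viewed as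
  extensions, so that a single passage to block matrices, \<open>ext_std\<close>, serves for all of
  them.\<close>

lemma cyc_dsum_eq_ext:
  assumes "pre_cyc A X" "pre_cyc A Y"
  shows "X \<oplus>\<^sub>c Y = ext_cyc X Y (zero_map (fst Y) (fst X))"
proof -
  interpret left_module A "fst X" using assms by (simp add: pre_cyc_def)
  show ?thesis using assms mod_homD(2)[of "snd X" A "fst X" "fst X"]
    by (auto simp: cyc_dsum_def ext_cyc_def zero_map_def pre_cyc_def intro!: restrict_ext)
qed

lemma upper_cyc_eq_ext:
  assumes "left_module A P" "left_module A \<Omega>" "\<delta> \<in> mod_hom A \<Omega> P"
  shows "upper_cyc P \<Omega> \<delta> = ext_cyc (P, zero_map P P) (\<Omega>, zero_map \<Omega> \<Omega>) \<delta>"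
proof -
  interpret left_module A P by (fact assms)
  show ?thesis using mod_homD(2)[OF assms(3)]
    by (auto simp: upper_cyc_def ext_cyc_def zero_map_def intro!: restrict_ext)
qed

lemma pre_cyc_ext:
  assumes X: "pre_cyc A X" and Y: "pre_cyc A Y" and h: "h \<in> mod_hom A (fst X) (fst Y)"
  shows "pre_cyc A (ext_cyc Y X h)"
proof -
  interpret Y: left_module A "fst Y" using Y by (simp add: pre_cyc_def)
  interpret X: left_module A "fst X" using X by (simp add: pre_cyc_def)
  note d = mod_homD[of "snd X" A "fst X" "fst X"] mod_homD[of "snd Y" A "fst Y" "fst Y"] mod_homD[OF h]
  show ?thesis using X Y
    by (auto simp: pre_cyc_def ext_cyc_def left_module_dsum d Y.smult_closed X.smult_closed
        Y.smult_r_distr Y.M.a_ac intro!: mod_homI)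
qed

text \<open>The isomorphism is block diagonal. It respects the diagonal entries of the differential
  because \<open>\<alpha>\<close> and \<open>\<beta>\<close> are morphisms of complexes, and the
  off-diagonal entry by \<open>eq\<close>.\<close>

lemma ext_cyc_equiv:
  assumes a: "\<alpha> \<in> cyc_iso A Y Y'" and b: "\<beta> \<in> cyc_iso A X X'"
    and X: "pre_cyc A X" and Y: "pre_cyc A Y" and h: "h \<in> mod_hom A (fst X) (fst Y)"
    and eq: "\<And>x. x \<in> carrier (fst X) \<Longrightarrow> \<alpha> (h x) = h' (\<beta> x)"
  shows "cyc_equiv A (ext_cyc Y X h) (ext_cyc Y' X' h')"
proof (rule cyc_equivI)
  show "pair_hom (fst Y) (fst X) \<alpha> \<beta> \<in> mod_iso A (fst (ext_cyc Y X h)) (fst (ext_cyc Y' X' h'))"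
    using pair_hom_iso[OF cyc_isoD(1)[OF a] cyc_isoD(1)[OF b]] X Y
    by (simp add: ext_cyc_def pre_cyc_def)
  fix z assume z: "z \<in> carrier (fst (ext_cyc Y X h))"
  have Y': "left_module A (fst Y)" using Y by (simp add: pre_cyc_def)
  note d = mod_homD[of "snd X" A "fst X" "fst X"] mod_homD[of "snd Y" A "fst Y" "fst Y"] mod_homD[OF h]
    mod_homD[OF mod_isoD(1)[OF cyc_isoD(1)[OF a]]] mod_homD[OF mod_isoD(1)[OF cyc_isoD(1)[OF b]]]
    cyc_isoD(3)[OF a] cyc_isoD(3)[OF b]
  show "pair_hom (fst Y) (fst X) \<alpha> \<beta> (snd (ext_cyc Y X h) z) =
    snd (ext_cyc Y' X' h') (pair_hom (fst Y) (fst X) \<alpha> \<beta> z)"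
    using z X Y by (auto simp: ext_cyc_def pair_hom_def pre_cyc_def d eq left_moduleD(4)[OF Y'])
qed

lemma smult_zero:
  fixes A :: "('k, 'x) module" and M :: "('x, 'm) module"
  assumes "left_module A M" "a \<in> carrier A"
  shows "a \<odot>\<^bsub>M\<^esub> \<zero>\<^bsub>M\<^esub> = \<zero>\<^bsub>M\<^esub>"
  using mod_homD(4)[OF zero_map[OF assms(1,1)] assms(2) left_moduleD(5)[OF assms(1)]]
    left_moduleD(3)[OF assms(1,2) left_moduleD(5)[OF assms(1)]] left_moduleD(5)[OF assms(1)]
  by (simp add: zero_map_def)

lemma inclusion_hom:
  assumes M: "left_module A M" and N: "left_module A N"
  shows "(\<lambda>x\<in>carrier M. (x, \<zero>\<^bsub>N\<^esub>)) \<in> mod_hom A M (M \<oplus>\<^sub>m N)"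
    "(\<lambda>y\<in>carrier N. (\<zero>\<^bsub>M\<^esub>, y)) \<in> mod_hom A N (M \<oplus>\<^sub>m N)"
proof -
  interpret M: left_module A M by (fact M)
  interpret N: left_module A N by (fact N)
  show "(\<lambda>x\<in>carrier M. (x, \<zero>\<^bsub>N\<^esub>)) \<in> mod_hom A M (M \<oplus>\<^sub>m N)"
    "(\<lambda>y\<in>carrier N. (\<zero>\<^bsub>M\<^esub>, y)) \<in> mod_hom A N (M \<oplus>\<^sub>m N)"
    by (auto intro!: mod_homI simp: smult_zero[OF M] smult_zero[OF N] M.smult_closed N.smult_closed)
qed

section \<open>Complexes of projectives, projective covers and minimal resolutions\<close>

context fin_alg
begin

lemma projective_dsum:
  assumes P: "projective A P" and P': "projective A P'"
  shows "projective A (P \<oplus>\<^sub>m P')"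
  unfolding projective_def fd_module_iff
proof (intro conjI allI impI ballI)
  note M = projectiveD[OF P] and M' = projectiveD[OF P']
  show "left_module A (P \<oplus>\<^sub>m P')" "finite (carrier (P \<oplus>\<^sub>m P'))"
    using M M' by (auto simp: left_module_dsum)
  interpret P: left_module A P by (fact M)
  interpret P': left_module A P' by (fact M')
  fix X Y :: "('x, nat) module" and g h
  assume X: "left_module A X \<and> finite (carrier X)" and Y: "left_module A Y \<and> finite (carrier Y)"
    and g: "g \<in> mod_hom A X Y" "g ` carrier X = carrier Y" and h: "h \<in> mod_hom A (P \<oplus>\<^sub>m P') Y"
  interpret X: left_module A X using X by simp
  interpret Y: left_module A Y using Y by simp
  note inc = inclusion_hom[OF M(1) M'(1)]
  obtain l where l: "l \<in> mod_hom A P X" "\<And>x. x \<in> carrier P \<Longrightarrow> g (l x) = h (x, \<zero>\<^bsub>P'\<^esub>)"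
    using projective_lift[OF P _ _ _ _ g mod_hom_compose[OF inc(1) h M(1)]] X Y by (auto simp: compose_def)
  obtain l' where l': "l' \<in> mod_hom A P' X" "\<And>x. x \<in> carrier P' \<Longrightarrow> g (l' x) = h (\<zero>\<^bsub>P\<^esub>, x)"
    using projective_lift[OF P' _ _ _ _ g mod_hom_compose[OF inc(2) h M'(1)]] X Y by (auto simp: compose_def)
  note L = mod_homD[OF l(1)] mod_homD[OF l'(1)]
  show "\<exists>k\<in>mod_hom A (P \<oplus>\<^sub>m P') X. \<forall>x\<in>carrier (P \<oplus>\<^sub>m P'). g (k x) = h x"
  proof
    show "(\<lambda>(x, y)\<in>carrier P \<times> carrier P'. l x \<oplus>\<^bsub>X\<^esub> l' y) \<in> mod_hom A (P \<oplus>\<^sub>m P') X"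
      by (intro mod_homI) (auto simp: L P.smult_closed P'.smult_closed X.smult_r_distr X.M.a_ac)
    have "h (x, \<zero>\<^bsub>P'\<^esub>) \<oplus>\<^bsub>Y\<^esub> h (\<zero>\<^bsub>P\<^esub>, y) = h (x, y)" if "x \<in> carrier P" "y \<in> carrier P'" for x y
      using mod_homD(3)[OF h, of "(x, \<zero>\<^bsub>P'\<^esub>)" "(\<zero>\<^bsub>P\<^esub>, y)"] that by simp
    then show "\<forall>x\<in>carrier (P \<oplus>\<^sub>m P'). g ((\<lambda>(x, y)\<in>carrier P \<times> carrier P'. l x \<oplus>\<^bsub>X\<^esub> l' y) x) = h x"
      by (auto simp: L mod_homD(3)[OF g(1)] l(2) l'(2))
  qed
qed

lemma projective_zero: "projective A zero_module"
  unfolding projective_def fd_module_iff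
proof (intro conjI allI impI ballI)
  show Z: "left_module A zero_module" by (rule left_module_zero) (rule ring_axioms)
  show "finite (carrier zero_module)" by (simp add: zero_module_def)
  fix X Y :: "('x, nat) module" and g and h :: "unit \<Rightarrow> nat"
  assume X: "left_module A X \<and> finite (carrier X)" and Y: "left_module A Y \<and> finite (carrier Y)"
    and g: "g \<in> mod_hom A X Y" "g ` carrier X = carrier Y" and h: "h \<in> mod_hom A zero_module Y"
  have "h () = \<zero>\<^bsub>Y\<^esub>" using mod_hom_zero[OF Z _ h] Y by (simp add: zero_module_def)
  then show "\<exists>l\<in>mod_hom A zero_module X. \<forall>x\<in>carrier zero_module. g (l x) = h x"
    using mod_hom_zero[OF _ _ g(1)] X Y zero_hom[OF ring_axioms, of X]
    by (intro bexI[of _ "\<lambda>x\<in>carrier zero_module. \<zero>\<^bsub>X\<^esub>"]) (auto simp: zero_module_def)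
qed

lemma C1_projD:
  assumes "X \<in> C1_proj A"
  shows "pre_cyc A X" "projective A (fst X)" "\<And>x. x \<in> carrier (fst X) \<Longrightarrow> snd X (snd X x) = \<zero>\<^bsub>fst X\<^esub>"
  using assms projectiveD by (auto simp: C1_proj_def pre_cyc_def)

lemma C1_proj_equiv:
  assumes X: "X \<in> C1_proj A" and e: "cyc_equiv A X Y" and Y: "pre_cyc A Y"
  shows "Y \<in> C1_proj A"
proof -
  note X' = C1_projD[OF X]
  obtain f where f: "f \<in> cyc_iso A X Y" using e by (auto simp: cyc_equiv_def)
  note i = cyc_isoD[OF f]
  have "snd Y (snd Y y) = \<zero>\<^bsub>fst Y\<^esub>" if y: "y \<in> carrier (fst Y)" for y
  proof -
    obtain x where x: "x \<in> carrier (fst X)" "y = f x" using mod_isoD(4)[OF i(1)] y by blast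
    have c: "snd X x \<in> carrier (fst X)" using X'(1) x by (auto simp: pre_cyc_def mod_homD)
    have "snd Y (snd Y y) = f (snd X (snd X x))" using x c by (simp add: i(3))
    also have "\<dots> = \<zero>\<^bsub>fst Y\<^esub>"
      using X'(3)[OF x(1)] mod_hom_zero[OF _ _ mod_isoD(1)[OF i(1)]] X'(1) Y by (simp add: pre_cyc_def)
    finally show ?thesis .
  qed
  moreover have "projective A (fst Y)"
    using projective_iso[OF X'(2) _ i(1)] Y by (simp add: pre_cyc_def)
  ultimately show ?thesis using Y by (cases Y) (auto simp: C1_proj_def pre_cyc_def)
qed

text \<open>Isoclasses contain complexes on \<open>nat\<close> only. Without such a member,
  complexes on other types that are not isomorphic might share the empty class.\<close>

lemma nat_representative:
  assumes X: "X \<in> C1_proj A"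
  obtains Z :: "('x, nat) cyc" where "Z \<in> C1_proj A" "cyc_equiv A Z X"
proof -
  note X' = C1_projD(1)[OF X]
  have m: "left_module A (fst X)" "finite (carrier (fst X))" using X' by (auto simp: pre_cyc_def)
  obtain N :: "('x, nat) module" and f where N: "left_module A N" "f \<in> mod_iso A (fst X) N"
    by (rule transport_nat[OF m])
  let ?i = "inv_hom (fst X) N f"
  define d where "d = compose (carrier N) f (compose (carrier N) (snd X) ?i)"
  have "d \<in> mod_hom A N N" unfolding d_def
    using mod_isoD(1)[OF mod_iso_inv[OF N(2) m(1)]] X' mod_isoD(1)[OF N(2)] N(1)
    by (intro mod_hom_compose) (auto simp: pre_cyc_def)
  then have p: "pre_cyc A (N, d)" using N finite_iso[OF N(2) m(2)] by (simp add: pre_cyc_def)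
  have "f (snd X x) = d (f x)" if "x \<in> carrier (fst X)" for x
    using that mod_homD(2)[OF mod_isoD(1)[OF N(2)] that] inv_hom[OF N(2)] by (simp add: d_def compose_def)
  then have e: "cyc_equiv A X (N, d)" using N(2) by (intro cyc_equivI[of f]) auto
  show ?thesis
    by (rule that[of "(N, d)"]) (use C1_proj_equiv[OF X e p] cyc_equiv_sym[OF e X'] in auto)
qed

lemma cover_surj:
  assumes P: "projective A P" and c: "projective_cover A P' \<pi>' M'"
    and h: "h \<in> mod_hom A P M'" "h ` carrier P = carrier M'"
  obtains l where "l \<in> mod_hom A P P'" "l ` carrier P = carrier P'" "\<And>x. x \<in> carrier P \<Longrightarrow> \<pi>' (l x) = h x"
proof -
  have P': "left_module A P'" "finite (carrier P')" and M': "left_module A M'" "finite (carrier M')"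
    and pi: "\<pi>' \<in> mod_hom A P' M'" "\<pi>' ` carrier P' = carrier M'"
    and min: "\<And>U. submodule U A P' \<Longrightarrow> U <+>\<^bsub>P'\<^esub> a_kernel P' M' \<pi>' = carrier P' \<Longrightarrow> U = carrier P'"
    using c projectiveD by (auto simp: projective_cover_def fd_module_iff)
  obtain l where l: "l \<in> mod_hom A P P'" "\<And>x. x \<in> carrier P \<Longrightarrow> \<pi>' (l x) = h x"
    by (rule projective_lift[OF P P' M' pi h(1)]) blast
  interpret P': left_module A P' by (fact P')
  interpret M': left_module A M' by (fact M')
  have "carrier P' \<subseteq> l ` carrier P <+>\<^bsub>P'\<^esub> a_kernel P' M' \<pi>'"
  proof
    fix y assume y: "y \<in> carrier P'"
    then have "\<pi>' y \<in> h ` carrier P" using mod_homD(2)[OF pi(1)] h(2) by simp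
    then obtain x where x: "x \<in> carrier P" "\<pi>' y = h x" by blast
    have lx: "l x \<in> carrier P'" using mod_homD(2)[OF l(1) x(1)] .
    have "\<pi>' (y \<ominus>\<^bsub>P'\<^esub> l x) = \<zero>\<^bsub>M'\<^esub>"
      using mod_hom_diff[OF pi(1) P'(1) M'(1) y lx] x l(2) mod_homD(2)[OF pi(1) y]
      by (simp add: a_minus_def M'.M.r_neg)
    then have "y \<ominus>\<^bsub>P'\<^esub> l x \<in> a_kernel P' M' \<pi>'" using y lx by (simp add: a_kernel_def')
    moreover have "y = l x \<oplus>\<^bsub>P'\<^esub> (y \<ominus>\<^bsub>P'\<^esub> l x)"
      using y lx by (simp add: a_minus_def P'.M.a_lcomm[of "l x"] P'.M.r_neg)
    ultimately show "y \<in> l ` carrier P <+>\<^bsub>P'\<^esub> a_kernel P' M' \<pi>'"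
      using x(1) unfolding set_add_def' by blast
  qed
  moreover have "l ` carrier P <+>\<^bsub>P'\<^esub> a_kernel P' M' \<pi>' \<subseteq> carrier P'"
    using mod_homD(2)[OF l(1)] by (auto simp: set_add_def' a_kernel_def')
  ultimately have "l ` carrier P = carrier P'"
    using min[OF submodule_image[OF projectiveD(1)[OF P] P'(1) l(1) submodule_carrier[OF projectiveD(1)[OF P]]]] by blast
  then show ?thesis using that l by blast
qed

text \<open>Finiteness replaces the usual splitting argument: surjections in both directions force
  equal cardinalities, and a surjection between finite sets of equal size is injective.\<close>

lemma cover_unique:
  assumes c: "projective_cover A P \<pi> M" and c': "projective_cover A P' \<pi>' M'" and k: "\<kappa> \<in> mod_iso A M M'"
  obtains l where "l \<in> mod_iso A P P'" "\<And>x. x \<in> carrier P \<Longrightarrow> \<pi>' (l x) = \<kappa> (\<pi> x)"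
proof -
  have P: "projective A P" "left_module A M" "\<pi> \<in> mod_hom A P M" "\<pi> ` carrier P = carrier M"
    and P': "projective A P'" "\<pi>' \<in> mod_hom A P' M'" "\<pi>' ` carrier P' = carrier M'"
    using c c' by (auto simp: projective_cover_def fd_module_iff)
  note k' = mod_isoD[OF k] and i = mod_isoD[OF mod_iso_inv[OF k P(2)]]
  have "compose (carrier P) \<kappa> \<pi> ` carrier P = \<kappa> ` \<pi> ` carrier P" by (force simp: compose_def)
  then obtain l where l: "l \<in> mod_hom A P P'" "l ` carrier P = carrier P'"
    "\<And>x. x \<in> carrier P \<Longrightarrow> \<pi>' (l x) = compose (carrier P) \<kappa> \<pi> x"
    using cover_surj[OF P(1) c' mod_hom_compose[OF P(3) k'(1) projectiveD(1)[OF P(1)]]] P(4) k'(4) by metis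
  have "compose (carrier P') (inv_hom M M' \<kappa>) \<pi>' ` carrier P' = inv_hom M M' \<kappa> ` \<pi>' ` carrier P'"
    by (force simp: compose_def)
  then obtain l' where l': "l' ` carrier P' = carrier P"
    using cover_surj[OF P'(1) c mod_hom_compose[OF P'(2) i(1) projectiveD(1)[OF P'(1)]]] P'(3) i(4) by metis
  have "card (carrier P) = card (carrier P')"
    using card_image_le[of "carrier P" l] card_image_le[of "carrier P'" l'] l(2) l'
      projectiveD(2)[OF P(1)] projectiveD(2)[OF P'(1)] by simp
  then have "inj_on l (carrier P)"
    using l(2) projectiveD(2)[OF P(1)] by (metis eq_card_imp_inj_on)
  then have "l \<in> mod_iso A P P'" using l by (simp add: mod_iso_def bij_betw_def)
  then show ?thesis using that l(3) by (simp add: compose_def)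
qed

text \<open>An isomorphism of covers identifies the kernels of \<open>\<epsilon>\<close> and
  \<open>\<epsilon>'\<close>; \<open>\<omega>\<close> is its restriction to these kernels, read
  through the injections \<open>\<delta>\<close> and \<open>\<delta>'\<close>. The pair of
  isomorphisms then commutes with the differentials.\<close>

lemma resolution_unique:
  assumes r: "minimal_projective_resolution A \<Omega> \<delta> P \<epsilon> M"
    and r': "minimal_projective_resolution A \<Omega>' \<delta>' P' \<epsilon>' M'" and k: "\<kappa> \<in> mod_iso A M M'"
  shows "cyc_equiv A (upper_cyc P \<Omega> \<delta>) (upper_cyc P' \<Omega>' \<delta>')"
proof -
  have c: "projective_cover A P \<epsilon> M" "projective_cover A P' \<epsilon>' M'" and P: "projective A P" "projective A P'"
    and M: "left_module A M" "left_module A M'"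
    and O: "left_module A \<Omega>" "left_module A \<Omega>'"  and d: "\<delta> \<in> mod_hom A \<Omega> P" "\<delta>' \<in> mod_hom A \<Omega>' P'"
    and e: "inj_on \<delta> (carrier \<Omega>)" "\<delta> ` carrier \<Omega> = a_kernel P M \<epsilon>"
      "inj_on \<delta>' (carrier \<Omega>')" "\<delta>' ` carrier \<Omega>' = a_kernel P' M' \<epsilon>'"
    and ep: "\<epsilon> \<in> mod_hom A P M"
    using r r' projectiveD
    by (auto simp: minimal_projective_resolution_def projective_cover_def short_exact_def fd_module_iff)
  note PM = projectiveD(1)[OF P(1)] projectiveD(1)[OF P(2)]
  obtain l where l: "l \<in> mod_iso A P P'" "\<And>x. x \<in> carrier P \<Longrightarrow> \<epsilon>' (l x) = \<kappa> (\<epsilon> x)"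
    by (rule cover_unique[OF c k]) blast
  note L = mod_isoD[OF l(1)]
  have "\<kappa> m = \<zero>\<^bsub>M'\<^esub> \<longleftrightarrow> m = \<zero>\<^bsub>M\<^esub>" if "m \<in> carrier M" for m
    using mod_hom_zero[OF M mod_isoD(1)[OF k]] inj_onD[OF mod_isoD(3)[OF k], of m "\<zero>\<^bsub>M\<^esub>"] that
      left_moduleD(5)[OF M(1)] by auto
  then have ker: "l x \<in> a_kernel P' M' \<epsilon>' \<longleftrightarrow> x \<in> a_kernel P M \<epsilon>" if "x \<in> carrier P" for x
    using that l(2)[OF that] mod_homD(2)[OF L(1) that] mod_homD(2)[OF ep that] by (simp add: a_kernel_def')
  define \<omega> where "\<omega> = (\<lambda>y\<in>carrier \<Omega>. inv_into (carrier \<Omega>') \<delta>' (l (\<delta> y)))"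
  have w: "\<omega> y \<in> carrier \<Omega>'" "\<delta>' (\<omega> y) = l (\<delta> y)" if y: "y \<in> carrier \<Omega>" for y
  proof -
    have "l (\<delta> y) \<in> \<delta>' ` carrier \<Omega>'"
      using ker[OF mod_homD(2)[OF d(1) y]] e y by blast
    then show "\<omega> y \<in> carrier \<Omega>'" "\<delta>' (\<omega> y) = l (\<delta> y)"
      using y by (auto simp: \<omega>_def inv_into_into f_inv_into_f)
  qed
  have w_eq: "y' = \<omega> y" if "y \<in> carrier \<Omega>" "y' \<in> carrier \<Omega>'" "\<delta>' y' = l (\<delta> y)" for y y'
    using inj_onD[OF e(3), of y' "\<omega> y"] w that by simp
  have "\<omega> \<in> mod_iso A \<Omega> \<Omega>'"
  proof -
    note D = mod_homD[OF d(1)] mod_homD[OF d(2)] mod_homD[OF L(1)]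
      left_moduleD[OF O(1)] left_moduleD[OF O(2)]
    have "\<omega> \<in> mod_hom A \<Omega> \<Omega>'"
    proof (rule mod_homI)
      show "\<omega> \<in> extensional (carrier \<Omega>)" by (simp add: \<omega>_def)
      fix x y a assume x: "x \<in> carrier \<Omega>"
      show "\<omega> x \<in> carrier \<Omega>'" using w(1)[OF x] .
      show "\<omega> (a \<odot>\<^bsub>\<Omega>\<^esub> x) = a \<odot>\<^bsub>\<Omega>'\<^esub> \<omega> x" if "a \<in> carrier A"
        using x that w[OF x] by (intro w_eq[symmetric]) (auto simp: D)
      assume y: "y \<in> carrier \<Omega>"
      show "\<omega> (x \<oplus>\<^bsub>\<Omega>\<^esub> y) = \<omega> x \<oplus>\<^bsub>\<Omega>'\<^esub> \<omega> y"
        using x y w[OF x] w[OF y] by (intro w_eq[symmetric]) (auto simp: D)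
    qed
    moreover have "inj_on \<omega> (carrier \<Omega>)"
    proof (rule inj_onI)
      fix x y assume xy: "x \<in> carrier \<Omega>" "y \<in> carrier \<Omega>" "\<omega> x = \<omega> y"
      then have "l (\<delta> x) = l (\<delta> y)" using w by metis
      then have "\<delta> x = \<delta> y" using inj_onD[OF L(3)] D xy by simp
      then show "x = y" using inj_onD[OF e(1)] xy by simp
    qed
    moreover have "carrier \<Omega>' \<subseteq> \<omega> ` carrier \<Omega>"
    proof
      fix y assume y: "y \<in> carrier \<Omega>'"
      then have "\<delta>' y \<in> a_kernel P' M' \<epsilon>'" using e by blast
      moreover obtain x where x: "x \<in> carrier P" "\<delta>' y = l x" using D(6)[OF y] L(4) by blast
      ultimately have "x \<in> \<delta> ` carrier \<Omega>" using ker e by simp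
      then obtain z where z: "z \<in> carrier \<Omega>" "x = \<delta> z" by blast
      then have "y = \<omega> z" using w_eq[OF z(1) y] x by simp
      then show "y \<in> \<omega> ` carrier \<Omega>" using z by blast
    qed
    ultimately show ?thesis using w(1) by (auto simp: mod_iso_def bij_betw_def)
  qed
  moreover have "l (zero_map P P x) = zero_map P' P' (l x)" if "x \<in> carrier P" for x
    using that mod_homD(2)[OF L(1) that] mod_hom_zero[OF PM L(1)] by (simp add: zero_map_def)
  moreover have "\<omega> (zero_map \<Omega> \<Omega> x) = zero_map \<Omega>' \<Omega>' (\<omega> x)" if "x \<in> carrier \<Omega>" for x
    using that w(1)[OF that] mod_hom_zero[OF O mod_isoD(1)[OF calculation(1)]] by (simp add: zero_map_def)
  ultimately show ?thesis
    unfolding upper_cyc_eq_ext[OF PM(1) O(1) d(1)] upper_cyc_eq_ext[OF PM(2) O(2) d(2)]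
    using l(1) w(2) r zero_map[OF PM(1) PM(1)] zero_map[OF O(1) O(1)] PM(1) O(1) d(1)
      projectiveD(2)[OF P(1)] projectiveD(2)[of \<Omega>]
    by (intro ext_cyc_equiv[where \<alpha> = l and \<beta> = \<omega>] cyc_isoI)
      (auto simp: pre_cyc_def minimal_projective_resolution_def)
qed

text \<open>Moves the source of a cover. It supplies the covers on \<open>nat\<close> without which
  the choices behind \<open>P_at\<close> and \<open>C_cyc\<close> would be arbitrary.\<close>

lemma cover_transport:
  assumes c: "projective_cover A P \<pi> M" and f: "f \<in> mod_iso A P P'" and P': "left_module A P'"
  shows "projective_cover A P' (compose (carrier P') \<pi> (inv_hom P P' f)) M"
proof -
  have P: "projective A P" and M: "left_module A M" "finite (carrier M)"
    and pi: "\<pi> \<in> mod_hom A P M" "\<pi> ` carrier P = carrier M"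
    and min: "\<And>U. submodule U A P \<Longrightarrow> U <+>\<^bsub>P\<^esub> a_kernel P M \<pi> = carrier P \<Longrightarrow> U = carrier P"
    using c by (auto simp: projective_cover_def fd_module_iff)
  let ?i = "inv_hom P P' f" and ?\<pi> = "compose (carrier P') \<pi> (inv_hom P P' f)"
  note PM = projectiveD(1)[OF P]
  note F = mod_isoD[OF f] and I = mod_isoD[OF mod_iso_inv[OF f PM]] and i = inv_hom[OF f]
  have "?\<pi> ` carrier P' = \<pi> ` ?i ` carrier P'" by (force simp: compose_def)
  then have "?\<pi> ` carrier P' = carrier M" using I(4) pi(2) by simp
  moreover have "U = carrier P'"
    if U: "submodule U A P'" and eq: "U <+>\<^bsub>P'\<^esub> a_kernel P' M ?\<pi> = carrier P'" for U
  proof -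
    interpret U: submodule U A P' by (fact U)
    have sub: "U \<subseteq> carrier P'" using U.subset by simp
    have "submodule (?i ` U) A P" by (rule submodule_image[OF P' PM I(1) U])
    moreover have "?i ` U <+>\<^bsub>P\<^esub> a_kernel P M \<pi> = carrier P"
    proof (intro equalityI subsetI)
      fix x assume x: "x \<in> carrier P"
      then have "f x \<in> U <+>\<^bsub>P'\<^esub> a_kernel P' M ?\<pi>" using eq mod_homD(2)[OF F(1)] by simp
      then obtain u k where uk: "u \<in> U" "k \<in> carrier P'" "\<pi> (?i k) = \<zero>\<^bsub>M\<^esub>" "f x = u \<oplus>\<^bsub>P'\<^esub> k"
        by (auto simp: set_add_def' a_kernel_def' compose_def)
      then have "x = ?i u \<oplus>\<^bsub>P\<^esub> ?i k"
        using i(1)[OF x] mod_homD(3)[OF I(1), of u k] sub by auto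
      then show "x \<in> ?i ` U <+>\<^bsub>P\<^esub> a_kernel P M \<pi>"
        using uk i(3) by (auto simp: set_add_def' a_kernel_def')
    next
      fix x assume "x \<in> ?i ` U <+>\<^bsub>P\<^esub> a_kernel P M \<pi>"
      then show "x \<in> carrier P"
        using sub i(3) left_moduleD(4)[OF PM] by (auto simp: set_add_def' a_kernel_def' subset_iff)
    qed
    ultimately have "?i ` U = carrier P" by (rule min)
    then have "f ` ?i ` U = carrier P'" using F(4) by simp
    moreover have "f ` ?i ` U = U" using i(2) sub by (force simp: image_image)
    ultimately show ?thesis by simp
  qed
  ultimately show ?thesis
    using projective_iso[OF P P' f] M mod_hom_compose[OF I(1) pi(1) P']
    by (auto simp: projective_cover_def fd_module_iff)
qed

end

context fin_alg
begin

lemma cover_target: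
  assumes c: "projective_cover A P \<pi> M" and k: "\<kappa> \<in> mod_iso A M N" and N: "left_module A N"
  shows "projective_cover A P (compose (carrier P) \<kappa> \<pi>) N"
    "a_kernel P N (compose (carrier P) \<kappa> \<pi>) = a_kernel P M \<pi>"
proof -
  have P: "projective A P" and M: "left_module A M" "finite (carrier M)"
    and pi: "\<pi> \<in> mod_hom A P M" "\<pi> ` carrier P = carrier M"
    and min: "\<And>U. submodule U A P \<Longrightarrow> U <+>\<^bsub>P\<^esub> a_kernel P M \<pi> = carrier P \<Longrightarrow> U = carrier P"
    using c by (auto simp: projective_cover_def fd_module_iff)
  note K = mod_isoD[OF k]
  have "\<kappa> m = \<zero>\<^bsub>N\<^esub> \<longleftrightarrow> m = \<zero>\<^bsub>M\<^esub>" if "m \<in> carrier M" for m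
    using mod_hom_zero[OF M(1) N K(1)] inj_onD[OF K(3), of m "\<zero>\<^bsub>M\<^esub>"] that
      left_moduleD(5)[OF M(1)] by auto
  then show ker: "a_kernel P N (compose (carrier P) \<kappa> \<pi>) = a_kernel P M \<pi>"
    using mod_homD(2)[OF pi(1)] by (auto simp: a_kernel_def' compose_def)
  have "compose (carrier P) \<kappa> \<pi> ` carrier P = \<kappa> ` \<pi> ` carrier P" by (force simp: compose_def)
  then show "projective_cover A P (compose (carrier P) \<kappa> \<pi>) N"
    unfolding projective_cover_def ker fd_module_iff
    using P N finite_iso[OF k M(2)] mod_hom_compose[OF pi(1) K(1) projectiveD(1)[OF P]] min pi(2) K(4)
    by simp
qed

lemma resolution_pre_cyc:
  assumes "minimal_projective_resolution A \<Omega> \<delta> P \<epsilon> M"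
  shows "pre_cyc A (upper_cyc P \<Omega> \<delta>)"
proof -
  have P: "left_module A P" "finite (carrier P)" and O: "left_module A \<Omega>" "finite (carrier \<Omega>)"
    and d: "\<delta> \<in> mod_hom A \<Omega> P"
    using assms projectiveD by (auto simp: minimal_projective_resolution_def projective_cover_def)
  show ?thesis unfolding upper_cyc_eq_ext[OF P(1) O(1) d]
    using P O d by (intro pre_cyc_ext) (auto simp: pre_cyc_def zero_map)
qed

text \<open>Transport to \<open>nat\<close> shows that the choice in \<open>C_cyc\<close> is made
  from a nonempty set; uniqueness of minimal resolutions then compares the chosen one with the given
  one, whatever its types are.\<close>

lemma C_cyc_equiv:
  assumes r: "minimal_projective_resolution A \<Omega> \<delta> P \<epsilon> M" and N: "left_module A N"
    and k: "\<kappa> \<in> mod_iso A M N"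
  shows "cyc_equiv A (C_cyc A N) (upper_cyc P \<Omega> \<delta>)" "pre_cyc A (C_cyc A N)"
proof -
  have c: "projective_cover A P \<epsilon> M" and P: "left_module A P" "finite (carrier P)"
    and M: "left_module A M" and O: "left_module A \<Omega>" "finite (carrier \<Omega>)" "projective A \<Omega>"
    and d: "\<delta> \<in> mod_hom A \<Omega> P" and e: "inj_on \<delta> (carrier \<Omega>)" "\<delta> ` carrier \<Omega> = a_kernel P M \<epsilon>"
    and ep: "\<epsilon> \<in> mod_hom A P M" "\<epsilon> ` carrier P = carrier M"
    using r projectiveD
    by (auto simp: minimal_projective_resolution_def projective_cover_def short_exact_def fd_module_iff)
  obtain P' :: "('x, nat) module" and g where P': "left_module A P'" "g \<in> mod_iso A P P'"
    by (rule transport_nat[OF P])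
  obtain \<Omega>' :: "('x, nat) module" and f where O': "left_module A \<Omega>'" "f \<in> mod_iso A \<Omega> \<Omega>'"
    by (rule transport_nat[OF O(1,2)])
  note F = mod_isoD[OF mod_iso_inv[OF O'(2) O(1)]] and G = mod_isoD[OF P'(2)]
  define \<delta>' where "\<delta>' = compose (carrier \<Omega>') g (compose (carrier \<Omega>') \<delta> (inv_hom \<Omega> \<Omega>' f))"
  define \<epsilon>' where "\<epsilon>' = compose (carrier P') \<epsilon> (inv_hom P P' g)"
  have d': "\<delta>' \<in> mod_hom A \<Omega>' P'"
    unfolding \<delta>'_def using F(1) d G(1) O'(1) by (intro mod_hom_compose)
  note c' = cover_transport[OF c P'(2,1), folded \<epsilon>'_def]
  have "a_kernel P' M \<epsilon>' = g ` a_kernel P M \<epsilon>"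
  proof (intro equalityI subsetI)
    fix y assume "y \<in> a_kernel P' M \<epsilon>'"
    then have y: "y \<in> carrier P'" "\<epsilon> (inv_hom P P' g y) = \<zero>\<^bsub>M\<^esub>"
      by (auto simp: a_kernel_def' \<epsilon>'_def compose_def)
    then show "y \<in> g ` a_kernel P M \<epsilon>"
      using inv_hom[OF P'(2)] by (intro image_eqI[of _ _ "inv_hom P P' g y"]) (auto simp: a_kernel_def')
  next
    fix y assume "y \<in> g ` a_kernel P M \<epsilon>"
    then show "y \<in> a_kernel P' M \<epsilon>'"
      using inv_hom(1)[OF P'(2)] mod_homD(2)[OF G(1)] by (auto simp: a_kernel_def' \<epsilon>'_def compose_def)
  qed
  moreover have "\<delta>' ` carrier \<Omega>' = g ` \<delta> ` inv_hom \<Omega> \<Omega>' f ` carrier \<Omega>'"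
    unfolding \<delta>'_def by (force simp: compose_def)
  ultimately have im: "\<delta>' ` carrier \<Omega>' = a_kernel P' M \<epsilon>'"
    using F(4) e(2) by simp
  have "inj_on \<delta>' (carrier \<Omega>')"
  proof (rule inj_onI)
    fix x y assume x: "x \<in> carrier \<Omega>'" "y \<in> carrier \<Omega>'" "\<delta>' x = \<delta>' y"
    note i = mod_homD(2)[OF F(1)]
    have "\<delta> (inv_hom \<Omega> \<Omega>' f x) = \<delta> (inv_hom \<Omega> \<Omega>' f y)"
      by (rule inj_onD[OF G(3)]) (use x i mod_homD(2)[OF d] in \<open>auto simp: \<delta>'_def compose_def\<close>)
    then have "inv_hom \<Omega> \<Omega>' f x = inv_hom \<Omega> \<Omega>' f y"
      by (rule inj_onD[OF e(1)]) (use x i in auto)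
    then show "x = y" by (rule inj_onD[OF F(3)]) (use x in auto)
  qed
  then have "minimal_projective_resolution A \<Omega>' \<delta>' P' (compose (carrier P') \<kappa> \<epsilon>') N"
    using cover_target[OF c' k N] projective_iso[OF O(3) O'(1,2)] d' im
    by (auto simp: minimal_projective_resolution_def short_exact_def projective_cover_def)
  then have "\<exists>X \<Omega> \<delta> P \<epsilon>. minimal_projective_resolution A \<Omega> \<delta> P \<epsilon> N \<and> X = upper_cyc (P :: ('x, nat) module) (\<Omega> :: ('x, nat) module) \<delta>"
    by blast
  from someI_ex[OF this] obtain \<Omega>1 \<delta>1 P1 \<epsilon>1
    where 1: "minimal_projective_resolution A (\<Omega>1 :: ('x, nat) module) \<delta>1 (P1 :: ('x, nat) module) \<epsilon>1 N"
      "C_cyc A N = upper_cyc P1 \<Omega>1 \<delta>1"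
    unfolding C_cyc_def by blast
  show "cyc_equiv A (C_cyc A N) (upper_cyc P \<Omega> \<delta>)"
    unfolding 1(2) by (rule resolution_unique[OF 1(1) r mod_iso_inv[OF k M]])
  show "pre_cyc A (C_cyc A N)" unfolding 1(2) by (rule resolution_pre_cyc[OF 1(1)])
qed

lemma C_cyc_projective:
  assumes N: "projective A N"
  shows "cyc_equiv A (C_cyc A N) (N, zero_map N N)" "pre_cyc A (C_cyc A N)"
proof -
  note N' = projectiveD[OF N]
  note Z = left_module_zero[OF ring_axioms]
  interpret N: left_module A N by (fact N')
  let ?\<epsilon> = "\<lambda>x\<in>carrier N. x" and ?\<delta> = "zero_map zero_module N"
  have ker: "a_kernel N N ?\<epsilon> = {\<zero>\<^bsub>N\<^esub>}" by (auto simp: a_kernel_def')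
  have "U = carrier N" if U: "submodule U A N" "U <+>\<^bsub>N\<^esub> {\<zero>\<^bsub>N\<^esub>} = carrier N" for U
  proof -
    interpret U: submodule U A N by (fact U)
    have "U <+>\<^bsub>N\<^esub> {\<zero>\<^bsub>N\<^esub>} = U" using U.subset by (force simp: set_add_def' subset_iff)
    then show ?thesis using U by simp
  qed
  then have "projective_cover A N ?\<epsilon> N"
    unfolding projective_cover_def ker fd_module_iff
    using N N' mod_isoD[OF mod_iso_id[OF N'(1)]] by auto
  then have r: "minimal_projective_resolution A zero_module ?\<delta> N ?\<epsilon> N"
    using projective_zero zero_map[OF Z N'(1)]
    by (auto simp: minimal_projective_resolution_def short_exact_def ker) (auto simp: zero_module_def zero_map_def)
  have "\<zero>\<^bsub>N\<^esub> \<in> carrier N" by simp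
  then have f: "(\<lambda>(x, y)\<in>carrier N \<times> carrier zero_module. x) \<in> mod_iso A (N \<oplus>\<^sub>m zero_module) N"
    by (auto simp: mod_iso_def bij_betw_def inj_on_def zero_module_def N.smult_closed intro!: mod_homI)
  have "cyc_equiv A (upper_cyc N zero_module ?\<delta>) (N, zero_map N N)"
    by (rule cyc_equivI[of "\<lambda>(x, y)\<in>carrier N \<times> carrier zero_module. x"])
      (use f in \<open>auto simp: upper_cyc_def zero_map_def zero_module_def\<close>)
  then show "cyc_equiv A (C_cyc A N) (N, zero_map N N)" "pre_cyc A (C_cyc A N)"
    using C_cyc_equiv[OF r N'(1) mod_iso_id[OF N'(1)]] cyc_equiv_trans by blast+
qed

end

section \<open>Riedtmann's formula\<close>

text \<open>The set \<open>W\<close> whose size is the numerator of a Hall number.\<close>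

definition extensions ::
    "('k, 'x) module \<Rightarrow> ('x, 'l) cyc \<Rightarrow> ('x, 'm) cyc \<Rightarrow> ('x, 'n) cyc \<Rightarrow> (('m \<Rightarrow> 'n) \<times> ('n \<Rightarrow> 'l)) set" where
  "extensions A X Y Z = {(\<phi>, \<psi>). \<phi> \<in> cyc_hom A Y Z \<and> \<psi> \<in> cyc_hom A Z X \<and>
     short_exact (fst Y) (fst Z) (fst X) \<phi> \<psi>}"

lemma hall_number_eq: "hall_number A X Y Z =
    of_nat (card (extensions A X Y Z)) / (of_nat (card (cyc_iso A X X)) * of_nat (card (cyc_iso A Y Y)))"
  by (simp add: hall_number_def extensions_def)

lemma finite_extensions:
  assumes "finite (carrier (fst X))" "finite (carrier (fst Y))" "finite (carrier (fst Z))"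
  shows "finite (extensions A X Y Z)"
proof (rule finite_subset)
  show "extensions A X Y Z \<subseteq> mod_hom A (fst Y) (fst Z) \<times> mod_hom A (fst Z) (fst X)"
    by (auto simp: extensions_def cyc_hom_def)
qed (auto intro!: finite_mod_hom assms)

text \<open>An extension is composed with isomorphisms at its two ends while its middle term stays
  fixed; this suffices to pass to chosen representatives of the factors.\<close>

lemma card_extensions_le:
  assumes a: "a \<in> cyc_iso A X X'" and b: "b \<in> cyc_iso A Y' Y"
    and X: "pre_cyc A X" and X': "pre_cyc A X'" and Y': "pre_cyc A Y'" and Z: "pre_cyc A Z"
  shows "card (extensions A X Y Z) \<le> card (extensions A X' Y' Z)"
proof (rule card_inj_on_le)
  let ?F = "\<lambda>(\<phi>, \<psi>). (compose (carrier (fst Y')) \<phi> b, compose (carrier (fst Z)) a \<psi>)"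
  note A' = cyc_isoD[OF a] and B' = cyc_isoD[OF b]
  note AI = mod_isoD[OF A'(1)] and BI = mod_isoD[OF B'(1)]
  show "finite (extensions A X' Y' Z)" using X' Y' Z by (intro finite_extensions) (auto simp: pre_cyc_def)
  have az: "a x = \<zero>\<^bsub>fst X'\<^esub> \<longleftrightarrow> x = \<zero>\<^bsub>fst X\<^esub>" if "x \<in> carrier (fst X)" for x
    using mod_hom_zero[OF _ _ AI(1)] X X' inj_onD[OF AI(3), of x "\<zero>\<^bsub>fst X\<^esub>"] that
      left_moduleD(5)[of A "fst X"] by (auto simp: pre_cyc_def)
  show "?F ` extensions A X Y Z \<subseteq> extensions A X' Y' Z"
  proof clarify
    fix \<phi> \<psi> assume "(\<phi>, \<psi>) \<in> extensions A X Y Z"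
    then have h: "\<phi> \<in> cyc_hom A Y Z" "\<psi> \<in> cyc_hom A Z X" and e: "inj_on \<phi> (carrier (fst Y))"
      "\<phi> ` carrier (fst Y) = a_kernel (fst Z) (fst X) \<psi>" "\<psi> ` carrier (fst Z) = carrier (fst X)"
      by (auto simp: extensions_def short_exact_def)
    have "inj_on (compose (carrier (fst Y')) \<phi> b) (carrier (fst Y'))"
      using comp_inj_on[OF BI(3), of \<phi>] e(1) BI(4)
      by (auto simp: compose_def comp_def inj_on_def)
    moreover have "compose (carrier (fst Y')) \<phi> b ` carrier (fst Y') = \<phi> ` b ` carrier (fst Y')"
      by (force simp: compose_def)
    moreover have "compose (carrier (fst Z)) a \<psi> ` carrier (fst Z) = a ` \<psi> ` carrier (fst Z)"
      by (force simp: compose_def)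
    moreover have "a_kernel (fst Z) (fst X') (compose (carrier (fst Z)) a \<psi>) = a_kernel (fst Z) (fst X) \<psi>"
      using az mod_homD(2)[OF cyc_homD(1)[OF h(2)]] by (auto simp: a_kernel_def' compose_def)
    ultimately show "(compose (carrier (fst Y')) \<phi> b, compose (carrier (fst Z)) a \<psi>) \<in> extensions A X' Y' Z"
      using cyc_hom_compose[OF B'(2) h(1) Y'] cyc_hom_compose[OF h(2) A'(2) Z] e AI(4) BI(4)
      by (auto simp: extensions_def short_exact_def)
  qed
  show "inj_on ?F (extensions A X Y Z)"
  proof (rule inj_onI, clarify)
    fix \<phi> \<psi> \<phi>' \<psi>'
    assume w: "(\<phi>, \<psi>) \<in> extensions A X Y Z" "(\<phi>', \<psi>') \<in> extensions A X Y Z"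
      and eq: "compose (carrier (fst Y')) \<phi> b = compose (carrier (fst Y')) \<phi>' b"
        "compose (carrier (fst Z)) a \<psi> = compose (carrier (fst Z)) a \<psi>'"
    have h: "\<phi> \<in> mod_hom A (fst Y) (fst Z)" "\<psi> \<in> mod_hom A (fst Z) (fst X)"
      "\<phi>' \<in> mod_hom A (fst Y) (fst Z)" "\<psi>' \<in> mod_hom A (fst Z) (fst X)"
      using w by (auto simp: extensions_def cyc_hom_def)
    have "\<phi> = \<phi>'"
    proof (rule mod_hom_eqI[OF h(1,3)])
      fix y assume "y \<in> carrier (fst Y)"
      then obtain y' where "y' \<in> carrier (fst Y')" "y = b y'" using BI(4) by blast
      then show "\<phi> y = \<phi>' y" using fun_cong[OF eq(1), of y'] by (simp add: compose_def)
    qed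
    moreover have "\<psi> = \<psi>'"
    proof (rule mod_hom_eqI[OF h(2,4)])
      fix z assume "z \<in> carrier (fst Z)"
      then show "\<psi> z = \<psi>' z"
        using fun_cong[OF eq(2), of z] inj_onD[OF AI(3)] mod_homD(2)[OF h(2)] mod_homD(2)[OF h(4)]
        by (simp add: compose_def)
    qed
    ultimately show "\<phi> = \<phi>' \<and> \<psi> = \<psi>'" ..
  qed
qed

lemma hall_number_cong:
  assumes "cyc_equiv A X X'" "cyc_equiv A Y Y'" "pre_cyc A X" "pre_cyc A X'" "pre_cyc A Y" "pre_cyc A Y'"
    "pre_cyc A Z"
  shows "hall_number A X Y Z = hall_number A X' Y' Z"
proof -
  obtain f g f' g' where fg: "f \<in> cyc_iso A X X'" "g \<in> cyc_iso A Y Y'" "f' \<in> cyc_iso A X' X" "g' \<in> cyc_iso A Y' Y"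
    using assms cyc_equiv_sym[OF assms(1,3)] cyc_equiv_sym[OF assms(2,5)] by (auto simp: cyc_equiv_def)
  have "card (extensions A X Y Z) = card (extensions A X' Y' Z)"
    using card_extensions_le[OF fg(1,4)] card_extensions_le[OF fg(3,2)] assms by (meson le_antisym)
  then show ?thesis
    using card_cyc_iso_cong[OF assms(1,1)] card_cyc_iso_cong[OF assms(2,2)] assms by (simp add: hall_number_eq)
qed

context fin_alg
begin

context
  fixes X :: "('x, 'l) cyc" and Y :: "('x, 'm) cyc" and Z :: "('x, 'n) cyc"
  assumes X: "pre_cyc A X" and Y: "pre_cyc A Y" and Z: "pre_cyc A Z" and PX: "projective A (fst X)"
begin

text \<open>The set behind a double count. Grouped by the off-diagonal entry of the differential
  pulled back from \<open>Z\<close>, it gives the right-hand side of Riedtmann's formula; grouped by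
  the extension that is being split, the left-hand side.\<close>

private definition split :: "('m \<times> 'l \<Rightarrow> 'n) set" where
  "split = {\<theta> \<in> mod_iso A (fst Y \<oplus>\<^sub>m fst X) (fst Z).
     (\<forall>y\<in>carrier (fst Y). \<theta> (snd Y y, \<zero>\<^bsub>fst X\<^esub>) = snd Z (\<theta> (y, \<zero>\<^bsub>fst X\<^esub>))) \<and>
     (\<forall>y\<in>carrier (fst Y). \<forall>x\<in>carrier (fst X).
        snd (inv_hom (fst Y \<oplus>\<^sub>m fst X) (fst Z) \<theta> (snd Z (\<theta> (y, x)))) = snd X x)}"

private lemma modules:
  "left_module A (fst X)" "left_module A (fst Y)" "left_module A (fst Z)" "finite (carrier (fst X))"
  "finite (carrier (fst Y))" "finite (carrier (fst Z))" "snd X \<in> mod_hom A (fst X) (fst X)"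
  "snd Y \<in> mod_hom A (fst Y) (fst Y)" "snd Z \<in> mod_hom A (fst Z) (fst Z)"
  "left_module A (fst Y \<oplus>\<^sub>m fst X)"
  using X Y Z by (auto simp: pre_cyc_def left_module_dsum)

text \<open>The two conditions in \<open>split\<close> say that the differential pulled back along
  \<open>\<theta>\<close> is upper triangular with diagonal entries \<open>snd Y\<close> and
  \<open>snd X\<close>. The one entry left free is \<open>h\<close>.\<close>

private lemma split_eq: "split = (\<Union>h\<in>mod_hom A (fst X) (fst Y). cyc_iso A (ext_cyc Y X h) Z)"
proof (intro equalityI subsetI)
  interpret MX: left_module A "fst X" by (rule modules)
  interpret MY: left_module A "fst Y" by (rule modules)
  fix \<theta> assume "\<theta> \<in> split"
  then have t: "\<theta> \<in> mod_iso A (fst Y \<oplus>\<^sub>m fst X) (fst Z)"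
    and ty: "\<And>y. y \<in> carrier (fst Y) \<Longrightarrow> \<theta> (snd Y y, \<zero>\<^bsub>fst X\<^esub>) = snd Z (\<theta> (y, \<zero>\<^bsub>fst X\<^esub>))"
    and tx: "\<And>y x. y \<in> carrier (fst Y) \<Longrightarrow> x \<in> carrier (fst X) \<Longrightarrow>
        snd (inv_hom (fst Y \<oplus>\<^sub>m fst X) (fst Z) \<theta> (snd Z (\<theta> (y, x)))) = snd X x"
    by (auto simp: split_def)
  let ?M = "fst Y \<oplus>\<^sub>m fst X" and ?i = "inv_hom (fst Y \<oplus>\<^sub>m fst X) (fst Z) \<theta>"
  note T = mod_isoD[OF t] and I = mod_isoD[OF mod_iso_inv[OF t modules(10)]] and i = inv_hom[OF t]
  define D where "D = compose (carrier ?M) ?i (compose (carrier ?M) (snd Z) \<theta>)"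
  have D: "D \<in> mod_hom A ?M ?M"
    unfolding D_def using T(1) I(1) modules by (intro mod_hom_compose)
  have TD: "\<theta> (D (y, x)) = snd Z (\<theta> (y, x))" if "y \<in> carrier (fst Y)" "x \<in> carrier (fst X)" for x y
    using that i(2) mod_homD(2)[OF modules(9)] mod_homD(2)[OF T(1)] by (simp add: D_def compose_def)
  have Dx: "snd (D (y, x)) = snd X x" if "y \<in> carrier (fst Y)" "x \<in> carrier (fst X)" for x y
    using that tx by (simp add: D_def compose_def)
  have Dy: "D (y, \<zero>\<^bsub>fst X\<^esub>) = (snd Y y, \<zero>\<^bsub>fst X\<^esub>)" if y: "y \<in> carrier (fst Y)" for y
    using ty[OF y] y i(1)[of "(snd Y y, \<zero>\<^bsub>fst X\<^esub>)"] mod_homD(2)[OF modules(8) y]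
    by (simp add: D_def compose_def)
  define h where "h = (\<lambda>x\<in>carrier (fst X). fst (D (\<zero>\<^bsub>fst Y\<^esub>, x)))"
  have cD: "fst (D z) \<in> carrier (fst Y)" if "z \<in> carrier ?M" for z
    using mod_homD(2)[OF D that] by (auto simp: mem_Times_iff)
  have h: "h \<in> mod_hom A (fst X) (fst Y)"
  proof (rule mod_homI)
    fix x a y assume x: "x \<in> carrier (fst X)"
    show "h x \<in> carrier (fst Y)" using x cD by (simp add: h_def)
    show "h (a \<odot>\<^bsub>fst X\<^esub> x) = a \<odot>\<^bsub>fst Y\<^esub> h x" if a: "a \<in> carrier A"
      using mod_homD(4)[OF D a, of "(\<zero>\<^bsub>fst Y\<^esub>, x)"] a x smult_zero[OF modules(2) a]
      by (cases "D (\<zero>\<^bsub>fst Y\<^esub>, x)") (simp add: h_def MX.smult_closed)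
    assume y: "y \<in> carrier (fst X)"
    show "h (x \<oplus>\<^bsub>fst X\<^esub> y) = h x \<oplus>\<^bsub>fst Y\<^esub> h y"
      using mod_homD(3)[OF D, of "(\<zero>\<^bsub>fst Y\<^esub>, x)" "(\<zero>\<^bsub>fst Y\<^esub>, y)"] x y
      by (cases "D (\<zero>\<^bsub>fst Y\<^esub>, x)"; cases "D (\<zero>\<^bsub>fst Y\<^esub>, y)") (simp add: h_def)
  qed (simp add: h_def)
  have "D (y, x) = (snd Y y \<oplus>\<^bsub>fst Y\<^esub> h x, snd X x)" if yx: "y \<in> carrier (fst Y)" "x \<in> carrier (fst X)" for x y
  proof -
    have "D (\<zero>\<^bsub>fst Y\<^esub>, x) = (h x, snd X x)" using yx Dx[of "\<zero>\<^bsub>fst Y\<^esub>" x] by (simp add: h_def prod_eq_iff)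
    then show ?thesis
      using mod_homD(3)[OF D, of "(y, \<zero>\<^bsub>fst X\<^esub>)" "(\<zero>\<^bsub>fst Y\<^esub>, x)"] yx Dy
        mod_homD(2)[OF modules(7)] by simp
  qed
  then have "\<theta> \<in> cyc_iso A (ext_cyc Y X h) Z"
    using t TD by (intro cyc_isoI) (auto simp: ext_cyc_def)
  then show "\<theta> \<in> (\<Union>h\<in>mod_hom A (fst X) (fst Y). cyc_iso A (ext_cyc Y X h) Z)" using h by blast
next
  interpret MX: left_module A "fst X" by (rule modules)
  interpret MY: left_module A "fst Y" by (rule modules)
  fix \<theta> assume "\<theta> \<in> (\<Union>h\<in>mod_hom A (fst X) (fst Y). cyc_iso A (ext_cyc Y X h) Z)"
  then obtain h where h: "h \<in> mod_hom A (fst X) (fst Y)" and t: "\<theta> \<in> cyc_iso A (ext_cyc Y X h) Z" by blast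
  have ti: "\<theta> \<in> mod_iso A (fst Y \<oplus>\<^sub>m fst X) (fst Z)" using cyc_isoD(1)[OF t] by (simp add: ext_cyc_def)
  have td: "\<theta> (snd Y y \<oplus>\<^bsub>fst Y\<^esub> h x, snd X x) = snd Z (\<theta> (y, x))"
    if "y \<in> carrier (fst Y)" "x \<in> carrier (fst X)" for x y
    using cyc_isoD(3)[OF t, of "(y, x)"] that by (simp add: ext_cyc_def)
  have "\<theta> (snd Y y, \<zero>\<^bsub>fst X\<^esub>) = snd Z (\<theta> (y, \<zero>\<^bsub>fst X\<^esub>))" if "y \<in> carrier (fst Y)" for y
    using td[OF that MX.M.zero_closed] that mod_hom_zero[OF modules(1,2) h] mod_hom_zero[OF modules(1,1,7)]
      mod_homD(2)[OF modules(8) that] by simp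
  moreover have "snd (inv_hom (fst Y \<oplus>\<^sub>m fst X) (fst Z) \<theta> (snd Z (\<theta> (y, x)))) = snd X x"
    if "y \<in> carrier (fst Y)" "x \<in> carrier (fst X)" for x y
    using td[OF that, symmetric] inv_hom(1)[OF ti, of "(snd Y y \<oplus>\<^bsub>fst Y\<^esub> h x, snd X x)"] that
      mod_homD(2)[OF modules(8)] mod_homD(2)[OF modules(7)] mod_homD(2)[OF h] by simp
  ultimately show "\<theta> \<in> split" using ti by (simp add: split_def)
qed

text \<open>The union is disjoint because \<open>\<theta>\<close> determines the pulled back
  differential and with it \<open>h\<close>. A nonempty set of isomorphisms to \<open>Z\<close> has
  as many elements as the automorphism group of \<open>Z\<close>.\<close>

private lemma card_split: "card split =
    card {h \<in> mod_hom A (fst X) (fst Y). cyc_equiv A (ext_cyc Y X h) Z} * card (cyc_iso A Z Z)"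
proof -
  let ?H = "mod_hom A (fst X) (fst Y)" and ?I = "\<lambda>h. cyc_iso A (ext_cyc Y X h) Z"
  interpret MX: left_module A "fst X" by (rule modules)
  interpret MY: left_module A "fst Y" by (rule modules)
  have fin: "finite ?H" using modules by (intro finite_mod_hom)
  have p: "pre_cyc A (ext_cyc Y X h)" if "h \<in> ?H" for h using pre_cyc_ext[OF X Y that] .
  have "?I h \<inter> ?I h' = {}" if h: "h \<in> ?H" "h' \<in> ?H" and ne: "h \<noteq> h'" for h h'
  proof (rule ccontr)
    assume "?I h \<inter> ?I h' \<noteq> {}"
    then obtain \<theta> where t: "\<theta> \<in> ?I h" "\<theta> \<in> ?I h'" by blast
    have "h x = h' x" if x: "x \<in> carrier (fst X)" for x
    proof -
      have "\<theta> (h x, snd X x) = \<theta> (h' x, snd X x)"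
        using cyc_isoD(3)[OF t(1), of "(\<zero>\<^bsub>fst Y\<^esub>, x)"] cyc_isoD(3)[OF t(2), of "(\<zero>\<^bsub>fst Y\<^esub>, x)"] x
          mod_hom_zero[OF modules(2,2,8)] mod_homD(2)[OF h(1)] mod_homD(2)[OF h(2)]
        by (simp add: ext_cyc_def)
      then show ?thesis
        using inj_onD[OF mod_isoD(3)[OF cyc_isoD(1)[OF t(1)]], of "(h x, snd X x)" "(h' x, snd X x)"] x
          mod_homD(2)[OF h(1)] mod_homD(2)[OF h(2)] mod_homD(2)[OF modules(7)]
        by (simp add: ext_cyc_def)
    qed
    then show False using mod_hom_eqI[OF h] ne by blast
  qed
  then have "card split = (\<Sum>h\<in>?H. card (?I h))"
    unfolding split_eq using fin p modules
    by (intro card_UN_disjoint) (auto intro!: finite_cyc_iso simp: pre_cyc_def)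
  also have "\<dots> = (\<Sum>h\<in>?H. if cyc_equiv A (ext_cyc Y X h) Z then card (cyc_iso A Z Z) else 0)"
    by (rule sum.cong) (use card_cyc_iso_cong[OF _ cyc_equiv_refl[OF Z] p Z Z Z] in \<open>auto simp: cyc_equiv_def\<close>)
  also have "\<dots> = card {h \<in> ?H. cyc_equiv A (ext_cyc Y X h) Z} * card (cyc_iso A Z Z)"
    using fin by (simp add: sum.If_cases Int_def)
  finally show ?thesis .
qed

text \<open>Given a section of \<open>\<psi>\<close>, the splittings of an extension \<open>(\<phi>, \<psi>)\<close> form a torsor under the
  group of homomorphisms from \<open>X\<close> to \<open>Y\<close>.\<close>

lemma riedtmann: "card (extensions A X Y Z) * card (mod_hom A (fst X) (fst Y)) =
    card {h \<in> mod_hom A (fst X) (fst Y). cyc_equiv A (ext_cyc Y X h) Z} * card (cyc_iso A Z Z)"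
proof -
  let ?H = "mod_hom A (fst X) (fst Y)" and ?W = "extensions A X Y Z" and ?M = "fst Y \<oplus>\<^sub>m fst X"
  interpret MX: left_module A "fst X" by (rule modules)
  interpret MY: left_module A "fst Y" by (rule modules)
  interpret MZ: left_module A "fst Z" by (rule modules)
  \<comment> \<open>A section of modules exists because \<open>X\<close> is projective as a module;
    it is not asked to commute with the differentials.\<close>
  define \<sigma> where "\<sigma> \<psi> = (SOME s. s \<in> mod_hom A (fst X) (fst Z) \<and> (\<forall>x\<in>carrier (fst X). \<psi> (s x) = x))" for \<psi>
  \<comment> \<open>With this sign the isomorphism maps \<open>(h x, x)\<close> to
    \<open>\<sigma> \<psi> x\<close>, so \<open>h\<close> can be read off from the preimage of the
    section.\<close>
  define B where "B = (\<lambda>((\<phi>, \<psi>), h). \<lambda>(y, x)\<in>carrier (fst Y) \<times> carrier (fst X).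
     \<phi> (y \<ominus>\<^bsub>fst Y\<^esub> h x) \<oplus>\<^bsub>fst Z\<^esub> \<sigma> \<psi> x)"
  have W: "\<phi> \<in> mod_hom A (fst Y) (fst Z)" "\<psi> \<in> mod_hom A (fst Z) (fst X)"
    "\<And>y. y \<in> carrier (fst Y) \<Longrightarrow> \<phi> (snd Y y) = snd Z (\<phi> y)"
    "\<And>z. z \<in> carrier (fst Z) \<Longrightarrow> \<psi> (snd Z z) = snd X (\<psi> z)"
    "inj_on \<phi> (carrier (fst Y))" "\<phi> ` carrier (fst Y) = a_kernel (fst Z) (fst X) \<psi>"
    "\<psi> ` carrier (fst Z) = carrier (fst X)"
    "\<sigma> \<psi> \<in> mod_hom A (fst X) (fst Z)" "\<And>x. x \<in> carrier (fst X) \<Longrightarrow> \<psi> (\<sigma> \<psi> x) = x"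
    "\<And>y. y \<in> carrier (fst Y) \<Longrightarrow> \<psi> (\<phi> y) = \<zero>\<^bsub>fst X\<^esub>"
    if "(\<phi>, \<psi>) \<in> ?W" for \<phi> \<psi>
  proof -
    show w: "\<phi> \<in> mod_hom A (fst Y) (fst Z)" "\<psi> \<in> mod_hom A (fst Z) (fst X)"
      "\<And>y. y \<in> carrier (fst Y) \<Longrightarrow> \<phi> (snd Y y) = snd Z (\<phi> y)"
      "\<And>z. z \<in> carrier (fst Z) \<Longrightarrow> \<psi> (snd Z z) = snd X (\<psi> z)"
      "inj_on \<phi> (carrier (fst Y))" "\<phi> ` carrier (fst Y) = a_kernel (fst Z) (fst X) \<psi>"
      "\<psi> ` carrier (fst Z) = carrier (fst X)"
      using that by (auto simp: extensions_def short_exact_def cyc_hom_def)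
    have "\<exists>s. s \<in> mod_hom A (fst X) (fst Z) \<and> (\<forall>x\<in>carrier (fst X). \<psi> (s x) = x)"
      by (rule projective_lift[OF PX modules(3,6,1,4) w(2,7) mod_isoD(1)[OF mod_iso_id[OF modules(1)]]])
        (auto intro!: exI)
    then have "\<sigma> \<psi> \<in> mod_hom A (fst X) (fst Z) \<and> (\<forall>x\<in>carrier (fst X). \<psi> (\<sigma> \<psi> x) = x)"
      unfolding \<sigma>_def by (rule someI_ex)
    then show "\<sigma> \<psi> \<in> mod_hom A (fst X) (fst Z)" "\<And>x. x \<in> carrier (fst X) \<Longrightarrow> \<psi> (\<sigma> \<psi> x) = x" by auto
    fix y assume "y \<in> carrier (fst Y)"
    then have "\<phi> y \<in> a_kernel (fst Z) (fst X) \<psi>" using w(6) by blast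
    then show "\<psi> (\<phi> y) = \<zero>\<^bsub>fst X\<^esub>" by (simp add: a_kernel_def')
  qed
  have Bval: "B ((\<phi>, \<psi>), h) (y, x) = \<phi> (y \<ominus>\<^bsub>fst Y\<^esub> h x) \<oplus>\<^bsub>fst Z\<^esub> \<sigma> \<psi> x"
    if "y \<in> carrier (fst Y)" "x \<in> carrier (fst X)" for \<phi> \<psi> h x y
    using that by (simp add: B_def)
  have Bpsi: "\<psi> (B ((\<phi>, \<psi>), h) (y, x)) = x"
    if w: "(\<phi>, \<psi>) \<in> ?W" and h: "h \<in> ?H" and yx: "y \<in> carrier (fst Y)" "x \<in> carrier (fst X)" for \<phi> \<psi> h x y
    using Bval[OF yx] yx mod_homD(2)[OF h yx(2)] mod_homD(2)[OF W(1)[OF w]] mod_homD(2)[OF W(8)[OF w]]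
      mod_homD(3)[OF W(2)[OF w]] W(9,10)[OF w] by (simp add: MY.M.minus_closed)
  have neg0: "\<ominus>\<^bsub>fst Y\<^esub> \<zero>\<^bsub>fst Y\<^esub> = \<zero>\<^bsub>fst Y\<^esub>"
    by (metis MY.M.l_zero MY.M.a_inv_closed MY.M.r_neg MY.M.zero_closed)
  have Bphi: "B ((\<phi>, \<psi>), h) (y, \<zero>\<^bsub>fst X\<^esub>) = \<phi> y"
    if w: "(\<phi>, \<psi>) \<in> ?W" and h: "h \<in> ?H" and y: "y \<in> carrier (fst Y)" for \<phi> \<psi> h y
    using y mod_hom_zero[OF modules(1,2) h] mod_hom_zero[OF modules(1,3) W(8)[OF w]]
      mod_homD(2)[OF W(1)[OF w] y] by (simp add: Bval a_minus_def neg0)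
  have Biso: "B ((\<phi>, \<psi>), h) \<in> mod_iso A ?M (fst Z)"
    if w: "(\<phi>, \<psi>) \<in> ?W" and h: "h \<in> ?H" for \<phi> \<psi> h
  proof -
    let ?B = "B ((\<phi>, \<psi>), h)"
    note f = mod_homD[OF W(1)[OF w]] and s = mod_homD[OF W(8)[OF w]] and hh = mod_homD[OF h]
    have neg: "\<ominus>\<^bsub>fst Y\<^esub> (a \<odot>\<^bsub>fst Y\<^esub> v) = a \<odot>\<^bsub>fst Y\<^esub> (\<ominus>\<^bsub>fst Y\<^esub> v)" if "a \<in> carrier A" "v \<in> carrier (fst Y)" for a v
    proof (rule MY.M.minus_equality)
      show "a \<odot>\<^bsub>fst Y\<^esub> (\<ominus>\<^bsub>fst Y\<^esub> v) \<oplus>\<^bsub>fst Y\<^esub> a \<odot>\<^bsub>fst Y\<^esub> v = \<zero>\<^bsub>fst Y\<^esub>"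
        using that MY.smult_r_distr[of a "\<ominus>\<^bsub>fst Y\<^esub> v" v] smult_zero[OF modules(2)] by (simp add: MY.M.l_neg)
    qed (use that MY.smult_closed in auto)
    have "?B \<in> mod_hom A ?M (fst Z)"
    proof (rule mod_homI)
      show "?B \<in> extensional (carrier ?M)" by (auto simp: B_def)
      fix u v a assume "u \<in> carrier ?M"
      then obtain y x where u: "u = (y, x)" "y \<in> carrier (fst Y)" "x \<in> carrier (fst X)" by auto
      show "?B u \<in> carrier (fst Z)" using u f s hh by (simp add: Bval MY.M.minus_closed)
      show "?B (a \<odot>\<^bsub>?M\<^esub> u) = a \<odot>\<^bsub>fst Z\<^esub> ?B u" if a: "a \<in> carrier A"
        using u a by (simp add: Bval MY.smult_closed MX.smult_closed a_minus_def neg hh f s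
            MZ.smult_r_distr flip: MY.smult_r_distr)
      assume "v \<in> carrier ?M"
      then obtain y' x' where v: "v = (y', x')" "y' \<in> carrier (fst Y)" "x' \<in> carrier (fst X)" by auto
      have "y \<oplus>\<^bsub>fst Y\<^esub> y' \<ominus>\<^bsub>fst Y\<^esub> h (x \<oplus>\<^bsub>fst X\<^esub> x') = (y \<ominus>\<^bsub>fst Y\<^esub> h x) \<oplus>\<^bsub>fst Y\<^esub> (y' \<ominus>\<^bsub>fst Y\<^esub> h x')"
        using u v hh by (simp add: a_minus_def MY.M.a_ac MY.M.minus_add)
      then show "?B (u \<oplus>\<^bsub>?M\<^esub> v) = ?B u \<oplus>\<^bsub>fst Z\<^esub> ?B v"
        using u v f s hh by (simp add: Bval MY.M.minus_closed MZ.M.a_ac)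
    qed
    moreover have "inj_on ?B (carrier ?M)"
    proof (rule inj_onI, clarsimp)
      fix y x y' x'
      assume yx: "y \<in> carrier (fst Y)" "x \<in> carrier (fst X)" "y' \<in> carrier (fst Y)" "x' \<in> carrier (fst X)"
        and eq: "?B (y, x) = ?B (y', x')"
      have x: "x = x'" using Bpsi[OF w h yx(1,2)] Bpsi[OF w h yx(3,4)] eq by simp
      have "\<phi> (y \<ominus>\<^bsub>fst Y\<^esub> h x) = \<phi> (y' \<ominus>\<^bsub>fst Y\<^esub> h x)"
        using eq yx f s hh unfolding x by (simp add: Bval MY.M.minus_closed)
      then have "y \<ominus>\<^bsub>fst Y\<^esub> h x = y' \<ominus>\<^bsub>fst Y\<^esub> h x"
        using inj_onD[OF W(5)[OF w]] yx hh by (simp add: MY.M.minus_closed)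
      then show "y = y' \<and> x = x'" using x yx hh by (simp add: a_minus_def)
    qed
    moreover have "carrier (fst Z) \<subseteq> ?B ` carrier ?M"
    proof
      fix z assume z: "z \<in> carrier (fst Z)"
      define x where "x = \<psi> z"
      have x: "x \<in> carrier (fst X)" using mod_homD(2)[OF W(2)[OF w] z] by (simp add: x_def)
      have "\<psi> (z \<ominus>\<^bsub>fst Z\<^esub> \<sigma> \<psi> x) = \<zero>\<^bsub>fst X\<^esub>"
        using mod_hom_diff[OF W(2)[OF w] modules(3,1) z s(2)[OF x]] W(9)[OF w x] x x_def
        by (simp add: a_minus_def MX.M.r_neg)
      then have "z \<ominus>\<^bsub>fst Z\<^esub> \<sigma> \<psi> x \<in> \<phi> ` carrier (fst Y)"
        using W(6)[OF w] z s(2)[OF x] by (simp add: a_kernel_def' MZ.M.minus_closed)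
      then obtain u where u: "u \<in> carrier (fst Y)" "z \<ominus>\<^bsub>fst Z\<^esub> \<sigma> \<psi> x = \<phi> u" by blast
      have "?B (u \<oplus>\<^bsub>fst Y\<^esub> h x, x) = \<phi> u \<oplus>\<^bsub>fst Z\<^esub> \<sigma> \<psi> x"
        using u x hh by (simp add: Bval a_minus_def MY.M.a_assoc MY.M.r_neg)
      also have "\<dots> = z" unfolding u(2)[symmetric] using z s(2)[OF x]
        by (simp add: a_minus_def MZ.M.a_assoc MZ.M.l_neg)
      finally show "z \<in> ?B ` carrier ?M" using u x hh by (intro image_eqI[of _ _ "(u \<oplus>\<^bsub>fst Y\<^esub> h x, x)"]) auto
    qed
    ultimately show ?thesis by (auto simp: mod_iso_def bij_betw_def mod_homD)
  qed
  have Binv: "snd (inv_hom ?M (fst Z) (B ((\<phi>, \<psi>), h)) z) = \<psi> z"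
    if w: "(\<phi>, \<psi>) \<in> ?W" and h: "h \<in> ?H" and z: "z \<in> carrier (fst Z)" for \<phi> \<psi> h z
    using inv_hom(2,3)[OF Biso[OF w h] z] Bpsi[OF w h]
    by (cases "inv_hom ?M (fst Z) (B ((\<phi>, \<psi>), h)) z") auto
  have "bij_betw B (?W \<times> ?H) split"
  proof (rule bij_betw_imageI)
    show "inj_on B (?W \<times> ?H)"
    proof (rule inj_onI)
      fix u v assume uv: "u \<in> ?W \<times> ?H" "v \<in> ?W \<times> ?H" "B u = B v"
      obtain \<phi> \<psi> h \<phi>' \<psi>' h' where u: "u = ((\<phi>, \<psi>), h)" and v: "v = ((\<phi>', \<psi>'), h')"
        by (metis prod.collapse)
      then have w: "(\<phi>, \<psi>) \<in> ?W" "(\<phi>', \<psi>') \<in> ?W" and h: "h \<in> ?H" "h' \<in> ?H"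
        and eq: "B ((\<phi>, \<psi>), h) = B ((\<phi>', \<psi>'), h')"
        using uv by auto
      have f: "\<phi> = \<phi>'" using Bphi[OF w(1) h(1)] Bphi[OF w(2) h(2)] eq
        by (intro mod_hom_eqI[OF W(1)[OF w(1)] W(1)[OF w(2)]]) simp
      have p: "\<psi> = \<psi>'" using Binv[OF w(1) h(1)] Binv[OF w(2) h(2)] eq
        by (intro mod_hom_eqI[OF W(2)[OF w(1)] W(2)[OF w(2)]]) simp
      have "h x = h' x" if x: "x \<in> carrier (fst X)" for x
      proof -
        have c: "h x \<in> carrier (fst Y)" "h' x \<in> carrier (fst Y)" using mod_homD(2)[OF h(1) x] mod_homD(2)[OF h(2) x] .
        have "\<phi> (\<zero>\<^bsub>fst Y\<^esub> \<ominus>\<^bsub>fst Y\<^esub> h x) = \<phi> (\<zero>\<^bsub>fst Y\<^esub> \<ominus>\<^bsub>fst Y\<^esub> h' x)"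
          using fun_cong[OF eq, of "(\<zero>\<^bsub>fst Y\<^esub>, x)"] x c f p mod_homD(2)[OF W(1)[OF w(1)]]
            mod_homD(2)[OF W(8)[OF w(1)] x] by (simp add: Bval MY.M.minus_closed)
        then have "\<zero>\<^bsub>fst Y\<^esub> \<ominus>\<^bsub>fst Y\<^esub> h x = \<zero>\<^bsub>fst Y\<^esub> \<ominus>\<^bsub>fst Y\<^esub> h' x"
          using inj_onD[OF W(5)[OF w(1)]] c by (simp add: MY.M.minus_closed)
        then have "\<ominus>\<^bsub>fst Y\<^esub> h x = \<ominus>\<^bsub>fst Y\<^esub> h' x" using c by (simp add: a_minus_def)
        then show ?thesis using c by (metis MY.M.minus_minus)
      qed
      then have "h = h'" by (rule mod_hom_eqI[OF h])
      then show "u = v" using f p u v by simp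
    qed
    show "B ` (?W \<times> ?H) = split"
    proof (intro equalityI subsetI)
      fix \<theta> assume "\<theta> \<in> B ` (?W \<times> ?H)"
      then obtain \<phi> \<psi> h where w: "(\<phi>, \<psi>) \<in> ?W" and h: "h \<in> ?H" and t: "\<theta> = B ((\<phi>, \<psi>), h)" by auto
      show "\<theta> \<in> split"
        unfolding split_def t using Biso[OF w h] Bphi[OF w h] Binv[OF w h] Bpsi[OF w h] W(3,4)[OF w]
          mod_homD(2)[OF modules(8)] mod_homD(2)[OF modules(9)] mod_homD(2)[OF mod_isoD(1)[OF Biso[OF w h]]]
        by simp
    next
      fix \<theta> assume "\<theta> \<in> split"
      then have t: "\<theta> \<in> mod_iso A ?M (fst Z)"
        and ty: "\<And>y. y \<in> carrier (fst Y) \<Longrightarrow> \<theta> (snd Y y, \<zero>\<^bsub>fst X\<^esub>) = snd Z (\<theta> (y, \<zero>\<^bsub>fst X\<^esub>))"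
        and tx: "\<And>y x. y \<in> carrier (fst Y) \<Longrightarrow> x \<in> carrier (fst X) \<Longrightarrow>
            snd (inv_hom ?M (fst Z) \<theta> (snd Z (\<theta> (y, x)))) = snd X x"
        by (auto simp: split_def)
      let ?i = "inv_hom ?M (fst Z) \<theta>"
      note T = mod_isoD[OF t] and I = mod_isoD[OF mod_iso_inv[OF t modules(10)]] and i = inv_hom[OF t]
      define \<phi> where "\<phi> = (\<lambda>y\<in>carrier (fst Y). \<theta> (y, \<zero>\<^bsub>fst X\<^esub>))"
      define \<psi> where "\<psi> = (\<lambda>z\<in>carrier (fst Z). snd (?i z))"
      have ic: "\<exists>y x. ?i z = (y, x) \<and> y \<in> carrier (fst Y) \<and> x \<in> carrier (fst X) \<and> \<theta> (y, x) = z"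
        if "z \<in> carrier (fst Z)" for z
        using i(2,3)[OF that] by (cases "?i z") auto
      have f: "\<phi> \<in> mod_hom A (fst Y) (fst Z)"
      proof -
        have "\<phi> = compose (carrier (fst Y)) \<theta> (\<lambda>y\<in>carrier (fst Y). (y, \<zero>\<^bsub>fst X\<^esub>))"
          by (auto simp: \<phi>_def compose_def intro!: restrict_ext)
        then show ?thesis using mod_hom_compose[OF inclusion_hom(1)[OF modules(2,1)] T(1) modules(2)] by simp
      qed
      have p: "\<psi> \<in> mod_hom A (fst Z) (fst X)"
      proof (rule mod_homI)
        fix u v a assume u: "u \<in> carrier (fst Z)"
        obtain y x where yx: "?i u = (y, x)" "y \<in> carrier (fst Y)" "x \<in> carrier (fst X)" using ic[OF u] by blast
        show "\<psi> u \<in> carrier (fst X)" using u yx by (simp add: \<psi>_def)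
        show "\<psi> (a \<odot>\<^bsub>fst Z\<^esub> u) = a \<odot>\<^bsub>fst X\<^esub> \<psi> u" if a: "a \<in> carrier A"
          using mod_homD(4)[OF I(1) a u] u yx MZ.smult_closed[OF a u] by (simp add: \<psi>_def)
        assume v: "v \<in> carrier (fst Z)"
        obtain y' x' where yx': "?i v = (y', x')" "y' \<in> carrier (fst Y)" "x' \<in> carrier (fst X)" using ic[OF v] by blast
        show "\<psi> (u \<oplus>\<^bsub>fst Z\<^esub> v) = \<psi> u \<oplus>\<^bsub>fst X\<^esub> \<psi> v"
          using mod_homD(3)[OF I(1) u v] u v yx yx' by (simp add: \<psi>_def)
      qed (simp add: \<psi>_def)
      have pt: "\<psi> (\<theta> (y, x)) = x" if "y \<in> carrier (fst Y)" "x \<in> carrier (fst X)" for x y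
        using i(1)[of "(y, x)"] mod_homD(2)[OF T(1), of "(y, x)"] that by (simp add: \<psi>_def)
      have w: "(\<phi>, \<psi>) \<in> ?W"
      proof -
        have "\<phi> \<in> cyc_hom A Y Z"
          using f ty mod_homD(2)[OF modules(8)] by (simp add: cyc_hom_def \<phi>_def)
        moreover have "\<psi> \<in> cyc_hom A Z X"
        proof -
          have "\<psi> (snd Z z) = snd X (\<psi> z)" if z: "z \<in> carrier (fst Z)" for z
          proof -
            obtain y x where yx: "y \<in> carrier (fst Y)" "x \<in> carrier (fst X)" "\<theta> (y, x) = z" using ic[OF z] by blast
            show ?thesis
              using tx[OF yx(1,2)] pt[OF yx(1,2)] yx(3) mod_homD(2)[OF modules(9) z] by (simp add: \<psi>_def)
          qed
          then show ?thesis using p by (simp add: cyc_hom_def)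
        qed
        moreover have "inj_on \<phi> (carrier (fst Y))"
          using inj_onD[OF T(3)] by (auto simp: inj_on_def \<phi>_def)
        moreover have "\<phi> ` carrier (fst Y) = a_kernel (fst Z) (fst X) \<psi>"
        proof (intro equalityI subsetI)
          fix z assume "z \<in> \<phi> ` carrier (fst Y)"
          then show "z \<in> a_kernel (fst Z) (fst X) \<psi>"
            using pt[OF _ MX.M.zero_closed] mod_homD(2)[OF T(1)] by (auto simp: a_kernel_def' \<phi>_def)
        next
          fix z assume "z \<in> a_kernel (fst Z) (fst X) \<psi>"
          then have z: "z \<in> carrier (fst Z)" "\<psi> z = \<zero>\<^bsub>fst X\<^esub>" by (auto simp: a_kernel_def')
          obtain y x where yx: "y \<in> carrier (fst Y)" "x \<in> carrier (fst X)" "\<theta> (y, x) = z" using ic[OF z(1)] by blast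
          then show "z \<in> \<phi> ` carrier (fst Y)" using pt[OF yx(1,2)] z(2) by (auto simp: \<phi>_def)
        qed
        moreover have "\<psi> ` carrier (fst Z) = carrier (fst X)"
        proof -
          have "x \<in> \<psi> ` carrier (fst Z)" if "x \<in> carrier (fst X)" for x
            using pt[OF MY.M.zero_closed that] mod_homD(2)[OF T(1), of "(\<zero>\<^bsub>fst Y\<^esub>, x)"] that
            by (intro image_eqI[of _ _ "\<theta> (\<zero>\<^bsub>fst Y\<^esub>, x)"]) auto
          then show ?thesis using mod_homD(2)[OF p] by blast
        qed
        ultimately show ?thesis by (simp add: extensions_def short_exact_def)
      qed
      \<comment> \<open>\<open>h\<close> measures the difference between the splitting
        \<open>\<theta>\<close> and the chosen section.\<close>
      define h where "h = (\<lambda>x\<in>carrier (fst X). fst (?i (\<sigma> \<psi> x)))"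
      have s: "?i (\<sigma> \<psi> x) = (h x, x) \<and> h x \<in> carrier (fst Y) \<and> \<theta> (h x, x) = \<sigma> \<psi> x" if x: "x \<in> carrier (fst X)" for x
      proof -
        note sx = mod_homD(2)[OF W(8)[OF w] x]
        obtain y x' where yx: "?i (\<sigma> \<psi> x) = (y, x')" "y \<in> carrier (fst Y)" "\<theta> (y, x') = \<sigma> \<psi> x"
          using ic[OF sx] by blast
        moreover have "x' = x" using W(9)[OF w x] yx(1) sx by (simp add: \<psi>_def)
        ultimately show ?thesis using x by (simp add: h_def)
      qed
      have h: "h \<in> ?H"
      proof (rule mod_homI)
        note S = mod_homD[OF W(8)[OF w]]
        fix x x' a assume x: "x \<in> carrier (fst X)"
        show "h x \<in> carrier (fst Y)" using s[OF x] by simp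
        show "h (a \<odot>\<^bsub>fst X\<^esub> x) = a \<odot>\<^bsub>fst Y\<^esub> h x" if a: "a \<in> carrier A"
          using s[OF x] s[OF MX.smult_closed[OF a x]] S(4)[OF a x] mod_homD(4)[OF I(1) a S(2)[OF x]] by simp
        assume x': "x' \<in> carrier (fst X)"
        show "h (x \<oplus>\<^bsub>fst X\<^esub> x') = h x \<oplus>\<^bsub>fst Y\<^esub> h x'"
          using s[OF x] s[OF x'] s[OF MX.M.a_closed[OF x x']] S(3)[OF x x'] mod_homD(3)[OF I(1) S(2)[OF x] S(2)[OF x']]
          by simp
      qed (simp add: h_def)
      have "\<theta> = B ((\<phi>, \<psi>), h)"
      proof (rule mod_hom_eqI[OF T(1) mod_isoD(1)[OF Biso[OF w h]]], clarsimp)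
        fix y x assume yx: "y \<in> carrier (fst Y)" "x \<in> carrier (fst X)"
        have c: "h x \<in> carrier (fst Y)" using s[OF yx(2)] by simp
        have "B ((\<phi>, \<psi>), h) (y, x) = \<theta> (y \<ominus>\<^bsub>fst Y\<^esub> h x, \<zero>\<^bsub>fst X\<^esub>) \<oplus>\<^bsub>fst Z\<^esub> \<theta> (h x, x)"
          using yx c s[OF yx(2)] by (simp add: Bval \<phi>_def MY.M.minus_closed)
        also have "\<dots> = \<theta> (y, x)"
          using mod_homD(3)[OF T(1), of "(y \<ominus>\<^bsub>fst Y\<^esub> h x, \<zero>\<^bsub>fst X\<^esub>)" "(h x, x)"] yx c
          by (simp add: MY.M.minus_closed a_minus_def MY.M.a_assoc MY.M.l_neg)
        finally show "\<theta> (y, x) = B ((\<phi>, \<psi>), h) (y, x)" ..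
      qed
      then show "\<theta> \<in> B ` (?W \<times> ?H)" using w h by blast
    qed
  qed
  then have "card (?W \<times> ?H) = card split" by (rule bij_betw_same_card)
  then show ?thesis using card_split by (simp add: card_cartesian_product)
qed

end

end

section \<open>Multiplication in the Hall algebra\<close>

text \<open>The product sums over supports, and a sum over an infinite set is zero by default;
  bilinearity is therefore established for finitely supported functions.\<close>

definition fin_supp :: "('c \<Rightarrow> complex) \<Rightarrow> bool" where
  "fin_supp f \<longleftrightarrow> finite {c. f c \<noteq> 0}"

text \<open>Larger index sets \<open>S\<close> and \<open>T\<close> make products comparable whose
  factors have different supports, as in a sum.\<close>

lemma hall_mult_sum:
  assumes "finite S" "finite T" "{c. f c \<noteq> 0} \<subseteq> S" "{c. g c \<noteq> 0} \<subseteq> T"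
  shows "(f \<otimes>\<^bsub>hall_algebra A\<^esub> g) = (\<lambda>c. if c \<in> isoclasses A
    then \<Sum>a\<in>S. \<Sum>b\<in>T. f a * g b * hall_number A (rep a) (rep b) (rep c) else 0)"
proof -
  have *: "(\<Sum>a | f a \<noteq> 0. \<Sum>b | g b \<noteq> 0. f a * g b * F a b) = (\<Sum>a\<in>S. \<Sum>b\<in>T. f a * g b * F a b)"
    for F :: "_ \<Rightarrow> _ \<Rightarrow> complex"
  proof -
    have "(\<Sum>b | g b \<noteq> 0. f a * g b * F a b) = (\<Sum>b\<in>T. f a * g b * F a b)" for a
      by (rule sum.mono_neutral_left) (use assms in auto)
    then have "(\<Sum>a | f a \<noteq> 0. \<Sum>b | g b \<noteq> 0. f a * g b * F a b) = (\<Sum>a | f a \<noteq> 0. \<Sum>b\<in>T. f a * g b * F a b)"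
      by simp
    also have "\<dots> = (\<Sum>a\<in>S. \<Sum>b\<in>T. f a * g b * F a b)"
      by (rule sum.mono_neutral_left) (use assms in auto)
    finally show ?thesis .
  qed
  show ?thesis
  proof (rule ext)
    fix c
    show "(f \<otimes>\<^bsub>hall_algebra A\<^esub> g) c = (if c \<in> isoclasses A
      then \<Sum>a\<in>S. \<Sum>b\<in>T. f a * g b * hall_number A (rep a) (rep b) (rep c) else 0)"
      using *[of "\<lambda>a b. hall_number A (rep a) (rep b) (rep c)"] by (simp add: hall_algebra_def)
  qed
qed

lemma hall_algebra_simps:
  "(f \<oplus>\<^bsub>hall_algebra A\<^esub> g) = (\<lambda>c. f c + g c)" "(s \<odot>\<^bsub>hall_algebra A\<^esub> f) = (\<lambda>c. s * f c)"
  by (simp_all add: hall_algebra_def)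

lemma fin_supp_basis: "fin_supp (hall_basis A X)"
  by (simp add: fin_supp_def hall_basis_def)

lemma fin_supp_smult: "fin_supp f \<Longrightarrow> fin_supp (\<lambda>c. s * f c)"
  unfolding fin_supp_def by (rule finite_subset[of _ "{c. f c \<noteq> 0}"]) auto

lemma hall_mult_add_left:
  assumes "fin_supp f" "fin_supp g" "fin_supp h"
  shows "(\<lambda>c. f c + g c) \<otimes>\<^bsub>hall_algebra A\<^esub> h = (\<lambda>c. (f \<otimes>\<^bsub>hall_algebra A\<^esub> h) c + (g \<otimes>\<^bsub>hall_algebra A\<^esub> h) c)"
proof -
  let ?S = "{c. f c \<noteq> 0} \<union> {c. g c \<noteq> 0}" and ?T = "{c. h c \<noteq> 0}"
  have f: "finite ?S" "finite ?T" using assms by (auto simp: fin_supp_def)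
  have s: "{c. f c + g c \<noteq> 0} \<subseteq> ?S" "{c. f c \<noteq> 0} \<subseteq> ?S" "{c. g c \<noteq> 0} \<subseteq> ?S" by auto
  show ?thesis
    unfolding hall_mult_sum[OF f s(1) subset_refl] hall_mult_sum[OF f s(2) subset_refl]
      hall_mult_sum[OF f s(3) subset_refl]
    by (auto simp: distrib_right sum.distrib)
qed

lemma hall_mult_add_right:
  assumes "fin_supp f" "fin_supp g" "fin_supp h"
  shows "h \<otimes>\<^bsub>hall_algebra A\<^esub> (\<lambda>c. f c + g c) = (\<lambda>c. (h \<otimes>\<^bsub>hall_algebra A\<^esub> f) c + (h \<otimes>\<^bsub>hall_algebra A\<^esub> g) c)"
proof -
  let ?S = "{c. f c \<noteq> 0} \<union> {c. g c \<noteq> 0}" and ?T = "{c. h c \<noteq> 0}"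
  have f: "finite ?T" "finite ?S" using assms by (auto simp: fin_supp_def)
  have s: "{c. f c + g c \<noteq> 0} \<subseteq> ?S" "{c. f c \<noteq> 0} \<subseteq> ?S" "{c. g c \<noteq> 0} \<subseteq> ?S" by auto
  show ?thesis
    unfolding hall_mult_sum[OF f subset_refl s(1)] hall_mult_sum[OF f subset_refl s(2)]
      hall_mult_sum[OF f subset_refl s(3)]
    by (auto simp: distrib_left distrib_right sum.distrib)
qed

lemma hall_mult_smult:
  assumes "fin_supp f" "fin_supp g"
  shows "(\<lambda>c. s * f c) \<otimes>\<^bsub>hall_algebra A\<^esub> g = (\<lambda>c. s * (f \<otimes>\<^bsub>hall_algebra A\<^esub> g) c)"
    "f \<otimes>\<^bsub>hall_algebra A\<^esub> (\<lambda>c. s * g c) = (\<lambda>c. s * (f \<otimes>\<^bsub>hall_algebra A\<^esub> g) c)"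
proof -
  let ?S = "{c. f c \<noteq> 0}" and ?T = "{c. g c \<noteq> 0}"
  have f: "finite ?S" "finite ?T" using assms by (auto simp: fin_supp_def)
  have s: "{c. s * f c \<noteq> 0} \<subseteq> ?S" "{c. s * g c \<noteq> 0} \<subseteq> ?T" by auto
  show "(\<lambda>c. s * f c) \<otimes>\<^bsub>hall_algebra A\<^esub> g = (\<lambda>c. s * (f \<otimes>\<^bsub>hall_algebra A\<^esub> g) c)"
    unfolding hall_mult_sum[OF f s(1) subset_refl] hall_mult_sum[OF f subset_refl subset_refl]
    by (auto simp: sum_distrib_left mult.assoc)
  show "f \<otimes>\<^bsub>hall_algebra A\<^esub> (\<lambda>c. s * g c) = (\<lambda>c. s * (f \<otimes>\<^bsub>hall_algebra A\<^esub> g) c)"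
    unfolding hall_mult_sum[OF f subset_refl s(2)] hall_mult_sum[OF f subset_refl subset_refl]
    by (auto simp: sum_distrib_left mult_ac)
qed

context fin_alg
begin

lemma isoclass_eq_iff:
  assumes X: "X \<in> C1_proj A" and Y: "pre_cyc A Y"
  shows "isoclass A X = isoclass A Y \<longleftrightarrow> cyc_equiv A X Y"
proof
  assume eq: "isoclass A X = isoclass A Y"
  obtain Z :: "('x, nat) cyc" where Z: "Z \<in> C1_proj A" "cyc_equiv A Z X" by (rule nat_representative[OF X])
  then have "Z \<in> isoclass A X" by (simp add: isoclass_def cyc_equiv_def)
  then have "cyc_equiv A Z Y" unfolding eq by (simp add: isoclass_def cyc_equiv_def)
  then show "cyc_equiv A X Y"
    using cyc_equiv_trans[OF cyc_equiv_sym[OF Z(2)]] C1_projD(1)[OF Z(1)] C1_projD(1)[OF X] by blast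
next
  assume e: "cyc_equiv A X Y"
  note X' = C1_projD(1)[OF X]
  show "isoclass A X = isoclass A Y"
    using cyc_equiv_trans[OF _ e] cyc_equiv_trans[OF _ cyc_equiv_sym[OF e X']] C1_projD(1)
    unfolding isoclass_def cyc_equiv_def[symmetric] by blast
qed

lemma rep_isoclass:
  assumes X: "X \<in> C1_proj A"
  shows "rep (isoclass A X) \<in> C1_proj A" "cyc_equiv A (rep (isoclass A X)) X"
    "isoclass A X \<in> isoclasses A"
proof -
  obtain Z :: "('x, nat) cyc" where Z: "Z \<in> C1_proj A" "cyc_equiv A Z X" by (rule nat_representative[OF X])
  then have "Z \<in> isoclass A X" by (simp add: isoclass_def cyc_equiv_def)
  then have "rep (isoclass A X) \<in> isoclass A X" unfolding rep_def by (rule someI)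
  then show "rep (isoclass A X) \<in> C1_proj A" "cyc_equiv A (rep (isoclass A X)) X"
    by (auto simp: isoclass_def cyc_equiv_def)
  have "isoclass A Z = isoclass A X" using isoclass_eq_iff[OF Z(1) C1_projD(1)[OF X]] Z(2) by simp
  then show "isoclass A X \<in> isoclasses A" using Z(1) unfolding isoclasses_def by blast
qed

lemma hall_basis_cong:
  assumes "X \<in> C1_proj A" "pre_cyc A Y" "cyc_equiv A X Y"
  shows "hall_basis A X = hall_basis A Y"
  using isoclass_eq_iff[OF assms(1,2)] assms(3) by (simp add: hall_basis_def)

lemma hall_mult_basis:
  assumes X: "X \<in> C1_proj A" and Y: "Y \<in> C1_proj A"
  shows "hall_basis A X \<otimes>\<^bsub>hall_algebra A\<^esub> hall_basis A Y =
    (\<lambda>c. if c \<in> isoclasses A then hall_number A X Y (rep c) else 0)"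
proof -
  have s: "{c. hall_basis A X c \<noteq> 0} \<subseteq> {isoclass A X}" "{c. hall_basis A Y c \<noteq> 0} \<subseteq> {isoclass A Y}"
    by (auto simp: hall_basis_def)
  have "hall_number A (rep (isoclass A X)) (rep (isoclass A Y)) (rep c) = hall_number A X Y (rep c)"
    if "c \<in> isoclasses A" for c
  proof (rule hall_number_cong)
    obtain Z :: "('x, nat) cyc" where "Z \<in> C1_proj A" "c = isoclass A Z" using \<open>c \<in> isoclasses A\<close> by (auto simp: isoclasses_def)
    then show "pre_cyc A (rep c)" using rep_isoclass(1)[of Z] C1_projD(1) by simp
  qed (use rep_isoclass[OF X] rep_isoclass[OF Y] C1_projD(1)[OF X] C1_projD(1)[OF Y]
      C1_projD(1)[OF rep_isoclass(1)[OF X]] C1_projD(1)[OF rep_isoclass(1)[OF Y]] in auto)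
  then show ?thesis
    unfolding hall_mult_sum[OF _ _ s, simplified] by (auto simp: hall_basis_def)
qed

text \<open>Expands a product of basis elements, with the coefficients from Riedtmann's formula
  cleared of denominators in \<open>coeff\<close>. The \<open>Z i\<close> must be pairwise
  non-isomorphic and exhaust the middle terms; \<open>cover\<close> restricts this to those
  \<open>h\<close> whose extension is isomorphic to a genuine complex of projectives.\<close>

lemma hall_product:
  fixes X :: "('x, 'l) cyc" and Y :: "('x, 'm) cyc" and Z :: "'i \<Rightarrow> ('x, 'n) cyc"
  assumes X: "X \<in> C1_proj A" and Y: "Y \<in> C1_proj A" and I: "finite I"
    and Z: "\<And>i. i \<in> I \<Longrightarrow> Z i \<in> C1_proj A"
    and disj: "\<And>i j. i \<in> I \<Longrightarrow> j \<in> I \<Longrightarrow> cyc_equiv A (Z i) (Z j) \<Longrightarrow> i = j"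
    and cover: "\<And>h W. h \<in> mod_hom A (fst X) (fst Y) \<Longrightarrow> (W :: ('x, nat) cyc) \<in> C1_proj A \<Longrightarrow>
      cyc_equiv A (ext_cyc Y X h) W \<Longrightarrow> \<exists>i\<in>I. cyc_equiv A (ext_cyc Y X h) (Z i)"
    and coeff: "\<And>i. i \<in> I \<Longrightarrow>
      r i * (of_nat (card (mod_hom A (fst X) (fst Y))) * of_nat (card (cyc_iso A X X)) * of_nat (card (cyc_iso A Y Y))) =
      of_nat (card {h \<in> mod_hom A (fst X) (fst Y). cyc_equiv A (ext_cyc Y X h) (Z i)} * card (cyc_iso A (Z i) (Z i)))"
  shows "hall_basis A X \<otimes>\<^bsub>hall_algebra A\<^esub> hall_basis A Y = (\<lambda>c. \<Sum>i\<in>I. r i * hall_basis A (Z i) c)"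
proof (rule ext)
  fix c
  let ?H = "mod_hom A (fst X) (fst Y)"
  note pX = C1_projD[OF X] and pY = C1_projD[OF Y]
  \<comment> \<open>The zero map and the identities witness that none of the denominators
    vanishes.\<close>
  have pos: "card ?H \<noteq> 0" "card (cyc_iso A X X) \<noteq> 0" "card (cyc_iso A Y Y) \<noteq> 0"
    using pX(1) pY(1) zero_map[of A "fst X" "fst Y"] cyc_equiv_refl[OF pX(1)] cyc_equiv_refl[OF pY(1)]
      finite_mod_hom[of "fst X" "fst Y" A] finite_cyc_iso[of X X A] finite_cyc_iso[of Y Y A]
    by (auto simp: pre_cyc_def cyc_equiv_def)
  show "(hall_basis A X \<otimes>\<^bsub>hall_algebra A\<^esub> hall_basis A Y) c = (\<Sum>i\<in>I. r i * hall_basis A (Z i) c)"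
  proof (cases "c \<in> isoclasses A")
    case False
    then have "hall_basis A (Z i) c = 0" if "i \<in> I" for i
      using rep_isoclass(3)[OF Z[OF that]] by (auto simp: hall_basis_def)
    then show ?thesis using False by (simp add: hall_mult_basis[OF X Y])
  next
    case True
    then obtain W0 :: "('x, nat) cyc" where W0: "W0 \<in> C1_proj A" "c = isoclass A W0" by (auto simp: isoclasses_def)
    define W where "W = rep c"
    have W: "W \<in> C1_proj A" "isoclass A W = c"
      using rep_isoclass[OF W0(1)] isoclass_eq_iff[of W W0] C1_projD(1)[OF W0(1)] W0(2) by (auto simp: W_def)
    note pW = C1_projD(1)[OF W(1)]
    have lhs: "(hall_basis A X \<otimes>\<^bsub>hall_algebra A\<^esub> hall_basis A Y) c = hall_number A X Y W"
      using True by (simp add: hall_mult_basis[OF X Y] W_def)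
    have bas: "hall_basis A (Z i) c = (if cyc_equiv A W (Z i) then 1 else 0)" if "i \<in> I" for i
      using isoclass_eq_iff[OF W(1) C1_projD(1)[OF Z[OF that]]] W(2) by (auto simp: hall_basis_def)
    have pe: "pre_cyc A (ext_cyc Y X h)" if "h \<in> ?H" for h using pre_cyc_ext[OF pX(1) pY(1) that] .
    note R = riedtmann[OF pX(1) pY(1) pW pX(2)]
    show ?thesis
    proof (cases "\<exists>i\<in>I. cyc_equiv A W (Z i)")
      case True
      then obtain i where i: "i \<in> I" "cyc_equiv A W (Z i)" by blast
      note pZ = C1_projD(1)[OF Z[OF i(1)]]
      have u: "cyc_equiv A W (Z j) \<longleftrightarrow> j = i" if "j \<in> I" for j
        using disj[OF i(1) that] i(2) cyc_equiv_trans[OF cyc_equiv_sym[OF i(2) pW] _ pZ] by blast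
      have "(\<Sum>i\<in>I. r i * hall_basis A (Z i) c) = (\<Sum>j\<in>I. if j = i then r i else 0)"
        by (rule sum.cong) (auto simp: bas u)
      also have "\<dots> = r i" using I i(1) by simp
      finally have rhs: "(\<Sum>i\<in>I. r i * hall_basis A (Z i) c) = r i" .
      have "{h \<in> ?H. cyc_equiv A (ext_cyc Y X h) W} = {h \<in> ?H. cyc_equiv A (ext_cyc Y X h) (Z i)}"
        using cyc_equiv_trans[OF _ i(2)] cyc_equiv_trans[OF _ cyc_equiv_sym[OF i(2) pW]] pe by blast
      then have "of_nat (card (extensions A X Y W) * card ?H) = (r i * (of_nat (card ?H) *
         of_nat (card (cyc_iso A X X)) * of_nat (card (cyc_iso A Y Y))) :: complex)"
        unfolding R coeff[OF i(1)] using card_cyc_iso_cong[OF i(2,2) pW pZ pW pZ] by simp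
      then show ?thesis unfolding lhs rhs hall_number_eq using pos by (simp add: field_simps)
    next
      case False
      have none: "{h \<in> ?H. cyc_equiv A (ext_cyc Y X h) W} = {}"
      proof (rule ccontr)
        assume "{h \<in> ?H. cyc_equiv A (ext_cyc Y X h) W} \<noteq> {}"
        then obtain h where h: "h \<in> ?H" "cyc_equiv A (ext_cyc Y X h) W" by blast
        then obtain i where "i \<in> I" "cyc_equiv A (ext_cyc Y X h) (Z i)" using cover W(1) by blast
        then show False
          using False cyc_equiv_trans[OF cyc_equiv_sym[OF h(2) pe[OF h(1)]] _ pW] by blast
      qed
      have "card (extensions A X Y W) = 0" using R[unfolded none] pos by simp
      moreover have "(\<Sum>i\<in>I. r i * hall_basis A (Z i) c) = 0"
        by (rule sum.neutral) (use bas False in auto)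
      ultimately show ?thesis unfolding lhs by (simp add: hall_number_eq)
    qed
  qed
qed

end

section \<open>Sums of indecomposable projectives and matrices\<close>

text \<open>Fixing \<open>A\<close> also fixes the ground field, over which the preceding locale is
  polymorphic.\<close>

locale thin_algebra = thin_quiver Q for Q :: "('v, 'e) pre_digraph" +
  fixes A :: "('k::{field,finite}, ('v, 'e) qpath \<Rightarrow> 'k) module"
  assumes A_eq: "A = path_algebra Q"
begin

sublocale fin_alg A
proof (rule fin_alg.intro)
  show "ring A" unfolding A_eq by (rule PA_ring)
  show "fin_alg_axioms A"
    unfolding A_eq
    by standard (auto intro!: PA_eqI PA_closed simp: coef_smult coef_zero)
qed

lemma coef_simps:
  "coef (a \<oplus>\<^bsub>A\<^esub> b) u v = coef a u v + coef b u v" "coef \<zero>\<^bsub>A\<^esub> u v = 0"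
  "coef \<one>\<^bsub>A\<^esub> u v = (if u = v \<and> u \<in> verts Q then 1 else 0)"
  "coef (a \<otimes>\<^bsub>A\<^esub> b) u v = (\<Sum>m\<in>verts Q. coef a m v * coef b u m)"
  unfolding A_eq by (rule coef_add coef_zero coef_one coef_mult)+

text \<open>The sum of the projectives at the vertices in the list \<open>v\<close>; since paths are unique, the
  \<open>t\<close>-th summand consists of the functions on the vertices reachable from \<open>v ! t\<close>.\<close>

definition proj_sum :: "'v list \<Rightarrow> (('v, 'e) qpath \<Rightarrow> 'k, nat \<Rightarrow> 'v \<Rightarrow> 'k) module" where
  "proj_sum v = \<lparr>carrier = {x. \<forall>t u. x t u \<noteq> 0 \<longrightarrow> t < length v \<and> reach (v ! t) u},
     monoid.mult = undefined, one = undefined, ring.zero = (\<lambda>t u. 0),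
     add = (\<lambda>x y t u. x t u + y t u),
     smult = (\<lambda>a x t u. \<Sum>m\<in>verts Q. coef a m u * x t m)\<rparr>"

lemma proj_sum_simps:
  "x \<in> carrier (proj_sum v) \<longleftrightarrow> (\<forall>t u. x t u \<noteq> 0 \<longrightarrow> t < length v \<and> reach (v ! t) u)"
  "\<zero>\<^bsub>proj_sum v\<^esub> = (\<lambda>t u. 0)" "x \<oplus>\<^bsub>proj_sum v\<^esub> y = (\<lambda>t u. x t u + y t u)"
  "a \<odot>\<^bsub>proj_sum v\<^esub> x = (\<lambda>t u. \<Sum>m\<in>verts Q. coef a m u * x t m)"
  by (simp_all add: proj_sum_def)

lemma left_module_proj_sum: "left_module A (proj_sum v)"
proof -
  have "abelian_group (proj_sum v)"
  proof (rule abelian_groupI)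
    fix x assume "x \<in> carrier (proj_sum v)"
    then show "\<exists>y\<in>carrier (proj_sum v). y \<oplus>\<^bsub>proj_sum v\<^esub> x = \<zero>\<^bsub>proj_sum v\<^esub>"
      by (intro bexI[of _ "\<lambda>t u. - x t u"]) (auto simp: proj_sum_simps)
  next
    fix x y assume "x \<in> carrier (proj_sum v)" "y \<in> carrier (proj_sum v)"
    then show "x \<oplus>\<^bsub>proj_sum v\<^esub> y \<in> carrier (proj_sum v)"
      unfolding proj_sum_simps by (metis add.right_neutral)
  qed (auto simp: proj_sum_simps add_ac)
  moreover have "left_module_axioms A (proj_sum v)"
  proof
    fix a x assume a: "a \<in> carrier A" and x: "x \<in> carrier (proj_sum v)"
    show "a \<odot>\<^bsub>proj_sum v\<^esub> x \<in> carrier (proj_sum v)"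
      unfolding proj_sum_simps
    proof (intro allI impI)
      fix t u assume "(\<Sum>m\<in>verts Q. coef a m u * x t m) \<noteq> 0"
      then obtain m where "coef a m u * x t m \<noteq> 0" using sum.neutral by meson
      then have "coef a m u \<noteq> 0" "x t m \<noteq> 0" by auto
      then show "t < length v \<and> reach (v ! t) u"
        using coef_nz reach_trans x unfolding proj_sum_simps by blast
    qed
    fix b assume "b \<in> carrier A"
    show "(a \<oplus>\<^bsub>A\<^esub> b) \<odot>\<^bsub>proj_sum v\<^esub> x = a \<odot>\<^bsub>proj_sum v\<^esub> x \<oplus>\<^bsub>proj_sum v\<^esub> b \<odot>\<^bsub>proj_sum v\<^esub> x"
      by (simp add: proj_sum_simps coef_simps distrib_right sum.distrib)
    show "(a \<otimes>\<^bsub>A\<^esub> b) \<odot>\<^bsub>proj_sum v\<^esub> x = a \<odot>\<^bsub>proj_sum v\<^esub> (b \<odot>\<^bsub>proj_sum v\<^esub> x)"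
    proof (intro ext)
      fix t u
      have "(\<Sum>m\<in>verts Q. \<Sum>l\<in>verts Q. coef a l u * coef b m l * x t m) =
        (\<Sum>l\<in>verts Q. \<Sum>m\<in>verts Q. coef a l u * coef b m l * x t m)"
        by (rule sum.swap)
      then show "((a \<otimes>\<^bsub>A\<^esub> b) \<odot>\<^bsub>proj_sum v\<^esub> x) t u = (a \<odot>\<^bsub>proj_sum v\<^esub> (b \<odot>\<^bsub>proj_sum v\<^esub> x)) t u"
        by (simp add: proj_sum_simps coef_simps sum_distrib_right sum_distrib_left mult.assoc)
    qed
  next
    fix a x y
    show "a \<odot>\<^bsub>proj_sum v\<^esub> (x \<oplus>\<^bsub>proj_sum v\<^esub> y) = a \<odot>\<^bsub>proj_sum v\<^esub> x \<oplus>\<^bsub>proj_sum v\<^esub> a \<odot>\<^bsub>proj_sum v\<^esub> y"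
      by (simp add: proj_sum_simps distrib_left sum.distrib)
  next
    fix x assume x: "x \<in> carrier (proj_sum v)"
    show "\<one>\<^bsub>A\<^esub> \<odot>\<^bsub>proj_sum v\<^esub> x = x"
    proof (intro ext)
      fix t u
      have "(\<Sum>m\<in>verts Q. coef \<one>\<^bsub>A\<^esub> m u * x t m) = (\<Sum>m\<in>verts Q. if m = u then x t u else 0)"
        by (rule sum.cong) (auto simp: coef_simps)
      then show "(\<one>\<^bsub>A\<^esub> \<odot>\<^bsub>proj_sum v\<^esub> x) t u = x t u"
        using x reach_verts by (auto simp: proj_sum_simps)
    qed
  qed
  ultimately show ?thesis using ring_axioms by (simp add: left_module_def)
qed

lemma finite_proj_sum: "finite (carrier (proj_sum v))"
proof (rule finite_subset)
  let ?B = "{f. \<forall>u. (u \<in> verts Q \<longrightarrow> f u \<in> (UNIV :: 'k set)) \<and> (u \<notin> verts Q \<longrightarrow> f u = 0)}"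
  show "carrier (proj_sum v) \<subseteq> {x. \<forall>t. (t \<in> {..<length v} \<longrightarrow> x t \<in> ?B) \<and> (t \<notin> {..<length v} \<longrightarrow> x t = (\<lambda>u. 0))}"
    using reach_verts by (fastforce simp: proj_sum_simps)
  have "finite ?B" by (rule finite_set_of_finite_funs) auto
  then show "finite {x. \<forall>t. (t \<in> {..<length v} \<longrightarrow> x t \<in> ?B) \<and> (t \<notin> {..<length v} \<longrightarrow> x t = (\<lambda>u. 0))}"
    by (intro finite_set_of_finite_funs) auto
qed

definition gen :: "'v list \<Rightarrow> nat \<Rightarrow> nat \<Rightarrow> 'v \<Rightarrow> 'k" where
  "gen v t = (\<lambda>s u. if s = t \<and> u = v ! t then 1 else 0)"

text \<open>The algebra element that carries the generator at \<open>a\<close> to the element with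
  coordinates \<open>x\<close>. It is how linearity over \<open>A\<close> determines a homomorphism
  from its values at generators.\<close>

definition lift :: "'v \<Rightarrow> ('v \<Rightarrow> 'k) \<Rightarrow> ('v, 'e) qpath \<Rightarrow> 'k" where
  "lift a x = of_coef (\<lambda>m u. if m = a then x u else 0)"

lemma lift_closed: "lift a x \<in> carrier A"
  unfolding lift_def A_eq by (rule of_coef_closed)

lemma coef_lift: "coef (lift a x) m u = (if m = a \<and> reach a u then x u else 0)"
  by (auto simp: lift_def coef_of_coef)

lemma lift_smult:
  assumes "a \<in> verts Q" "\<And>u. x u \<noteq> 0 \<Longrightarrow> reach a u"
  shows "lift a x \<odot>\<^bsub>proj_sum w\<^esub> y = (\<lambda>s u. x u * y s a)"
proof (intro ext)
  fix s u
  have "(\<Sum>m\<in>verts Q. coef (lift a x) m u * y s m) = (\<Sum>m\<in>verts Q. if m = a then x u * y s a else 0)"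
    by (rule sum.cong) (use assms(2)[of u] in \<open>auto simp: coef_lift\<close>)
  then show "(lift a x \<odot>\<^bsub>proj_sum w\<^esub> y) s u = x u * y s a" using assms(1) by (simp add: proj_sum_simps)
qed

text \<open>The homomorphisms from the sum over \<open>v\<close> to the sum over \<open>w\<close>:
  columns belong to the source, rows to the target. The entry \<open>g s t\<close> is the
  coefficient of the unique path from \<open>w ! s\<close> to \<open>v ! t\<close>, right
  multiplication by which maps the projective at \<open>v ! t\<close> to that at
  \<open>w ! s\<close>.\<close>

definition mats :: "'v list \<Rightarrow> 'v list \<Rightarrow> (nat \<Rightarrow> nat \<Rightarrow> 'k) set" where
  "mats v w = {g. \<forall>s t. g s t \<noteq> 0 \<longrightarrow> s < length w \<and> t < length v \<and> reach (w ! s) (v ! t)}"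

definition mat_hom :: "'v list \<Rightarrow> (nat \<Rightarrow> nat \<Rightarrow> 'k) \<Rightarrow> (nat \<Rightarrow> 'v \<Rightarrow> 'k) \<Rightarrow> nat \<Rightarrow> 'v \<Rightarrow> 'k" where
  "mat_hom v g = (\<lambda>x\<in>carrier (proj_sum v). \<lambda>s u. \<Sum>t<length v. g s t * x t u)"

definition mat_mult :: "nat \<Rightarrow> (nat \<Rightarrow> nat \<Rightarrow> 'k) \<Rightarrow> (nat \<Rightarrow> nat \<Rightarrow> 'k) \<Rightarrow> nat \<Rightarrow> nat \<Rightarrow> 'k" where
  "mat_mult n g h = (\<lambda>s t. \<Sum>r<n. g s r * h r t)"

definition id_mat :: "nat \<Rightarrow> nat \<Rightarrow> nat \<Rightarrow> 'k" where
  "id_mat n = (\<lambda>s t. if s = t \<and> s < n then 1 else 0)"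

definition zero_mat :: "nat \<Rightarrow> nat \<Rightarrow> 'k" where
  "zero_mat = (\<lambda>s t. 0)"

lemma mat_hom_hom:
  assumes g: "g \<in> mats v w"
  shows "mat_hom v g \<in> mod_hom A (proj_sum v) (proj_sum w)"
proof (rule mod_homI)
  note M = left_moduleD[OF left_module_proj_sum[of v]]
  fix x y a assume x: "x \<in> carrier (proj_sum v)"
  have "s < length w \<and> reach (w ! s) u" if nz: "(\<Sum>t<length v. g s t * x t u) \<noteq> 0" for s u
  proof -
    obtain t where "g s t * x t u \<noteq> 0" using nz sum.neutral by meson
    then have "g s t \<noteq> 0" "x t u \<noteq> 0" by auto
    then show ?thesis using g x reach_trans unfolding proj_sum_simps mats_def by blast
  qed
  then show "mat_hom v g x \<in> carrier (proj_sum w)" using x by (simp add: mat_hom_def proj_sum_simps(1)[of _ w])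
  show "mat_hom v g (x \<oplus>\<^bsub>proj_sum v\<^esub> y) = mat_hom v g x \<oplus>\<^bsub>proj_sum w\<^esub> mat_hom v g y" if "y \<in> carrier (proj_sum v)"
    using x that M(4)[OF x that] by (simp add: mat_hom_def proj_sum_simps(3) distrib_left sum.distrib)
  assume a: "a \<in> carrier A"
  show "mat_hom v g (a \<odot>\<^bsub>proj_sum v\<^esub> x) = a \<odot>\<^bsub>proj_sum w\<^esub> mat_hom v g x"
  proof (intro ext)
    fix s u
    have "(\<Sum>t<length v. \<Sum>m\<in>verts Q. g s t * (coef a m u * x t m)) =
       (\<Sum>m\<in>verts Q. \<Sum>t<length v. g s t * (coef a m u * x t m))" by (rule sum.swap)
    then show "mat_hom v g (a \<odot>\<^bsub>proj_sum v\<^esub> x) s u = (a \<odot>\<^bsub>proj_sum w\<^esub> mat_hom v g x) s u"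
      using x M(3)[OF a x] by (simp add: mat_hom_def proj_sum_simps(4) sum_distrib_left mult_ac)
  qed
qed (simp add: mat_hom_def)

lemma gen_closed: "t < length v \<Longrightarrow> set v \<subseteq> verts Q \<Longrightarrow> gen v t \<in> carrier (proj_sum v)"
  by (auto simp: proj_sum_simps gen_def intro!: reach_refl)

lemma mat_hom_gen:
  assumes "t < length v" "set v \<subseteq> verts Q"
  shows "mat_hom v g (gen v t) s (v ! t) = g s t"
proof -
  have "(\<Sum>r<length v. g s r * gen v t r (v ! t)) = (\<Sum>r<length v. if r = t then g s t else 0)"
    by (rule sum.cong) (auto simp: gen_def)
  then show ?thesis using assms gen_closed[OF assms] by (simp add: mat_hom_def)
qed

lemma mat_hom_inj:
  assumes "g \<in> mats v w" "h \<in> mats v w'" "set v \<subseteq> verts Q" "\<And>x. x \<in> carrier (proj_sum v) \<Longrightarrow> mat_hom v g x = mat_hom v h x"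
  shows "g = h"
proof (intro ext)
  fix s t
  show "g s t = h s t"
  proof (cases "t < length v")
    case True
    then show ?thesis
      using mat_hom_gen[OF True assms(3)] assms(4)[OF gen_closed[OF True assms(3)]] by metis
  next
    case False
    then have "g s t = 0" "h s t = 0" using assms(1,2) by (auto simp: mats_def)
    then show ?thesis by simp
  qed
qed

text \<open>A homomorphism is determined by the images of the generators, and of the image of the
  \<open>t\<close>-th generator only the coordinates at \<open>v ! t\<close> matter, since
  \<open>lift\<close> reads no others.\<close>

lemma mat_hom_surj:
  assumes f: "f \<in> mod_hom A (proj_sum v) (proj_sum w)" and v: "set v \<subseteq> verts Q"
  obtains g where "g \<in> mats v w" "f = mat_hom v g"
proof
  define g where "g = (\<lambda>s t. if t < length v then f (gen v t) s (v ! t) else 0)"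
  note F = mod_homD[OF f]
  show "g \<in> mats v w"
    using F(2)[OF gen_closed[OF _ v]] by (auto simp: mats_def g_def proj_sum_simps)
  then show "f = mat_hom v g"
  proof (rule mod_hom_eqI[OF f mat_hom_hom])
    fix x assume x: "x \<in> carrier (proj_sum v)"
    \<comment> \<open>The argument is truncated to its first \<open>n\<close> summands, so that each
      step of the induction adds a multiple of one generator.\<close>
    have *: "f (\<lambda>t u. if t < n then x t u else 0) = (\<lambda>s u. \<Sum>t<n. g s t * x t u)" if "n \<le> length v" for n
      using that
    proof (induction n)
      case 0
      then show ?case using mod_hom_zero[OF left_module_proj_sum left_module_proj_sum f] by (simp add: proj_sum_simps)
    next
      case (Suc n)
      let ?x = "\<lambda>t u. if t < n then x t u else 0"
      have n: "n < length v" "v ! n \<in> verts Q" using Suc.prems v by auto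
      have c: "?x \<in> carrier (proj_sum v)" using x by (auto simp: proj_sum_simps)
      have nz: "x n u \<noteq> 0 \<Longrightarrow> reach (v ! n) u" for u using x by (auto simp: proj_sum_simps)
      have e: "lift (v ! n) (x n) \<odot>\<^bsub>proj_sum v\<^esub> gen v n = (\<lambda>t u. if t = n then x n u else 0)"
        using lift_smult[of _ "x n", OF n(2) nz, of v "gen v n"] by (auto simp: gen_def fun_eq_iff)
      have e': "lift (v ! n) (x n) \<odot>\<^bsub>proj_sum w\<^esub> f (gen v n) = (\<lambda>s u. x n u * f (gen v n) s (v ! n))"
        by (rule lift_smult[of _ "x n", OF n(2) nz])
      have split: "(\<lambda>t u. if t < Suc n then x t u else 0) = ?x \<oplus>\<^bsub>proj_sum v\<^esub> (lift (v ! n) (x n) \<odot>\<^bsub>proj_sum v\<^esub> gen v n)"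
        unfolding e by (auto simp: proj_sum_simps fun_eq_iff less_Suc_eq)
      have "f (\<lambda>t u. if t < Suc n then x t u else 0) =
          f ?x \<oplus>\<^bsub>proj_sum w\<^esub> (lift (v ! n) (x n) \<odot>\<^bsub>proj_sum w\<^esub> f (gen v n))"
        unfolding split using F(3)[OF c left_moduleD(3)[OF left_module_proj_sum lift_closed gen_closed[OF n(1) v]]]
          F(4)[OF lift_closed gen_closed[OF n(1) v]] by simp
      also have "\<dots> = (\<lambda>s u. \<Sum>t<Suc n. g s t * x t u)"
      proof (intro ext)
        fix s u
        have ih: "f ?x = (\<lambda>s u. \<Sum>t<n. g s t * x t u)" using Suc.prems by (intro Suc.IH) simp
        have "g s n = f (gen v n) s (v ! n)" using n by (simp add: g_def)
        then show "(f ?x \<oplus>\<^bsub>proj_sum w\<^esub> (lift (v ! n) (x n) \<odot>\<^bsub>proj_sum w\<^esub> f (gen v n))) s u = (\<Sum>t<Suc n. g s t * x t u)"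
          unfolding e' ih proj_sum_simps(3) by (simp only: sum.lessThan_Suc mult.commute)
      qed
      finally show ?case .
    qed
    have "(\<lambda>t u. if t < length v then x t u else 0) = x" using x by (auto simp: proj_sum_simps fun_eq_iff)
    then show "f x = mat_hom v g x" using *[OF order_refl] x by (simp add: mat_hom_def)
  qed
qed

lemma mats_mat_mult:
  assumes "h \<in> mats u v" "g \<in> mats v w"
  shows "mat_mult n g h \<in> mats u w"
  unfolding mats_def mat_mult_def
proof (intro CollectI allI impI)
  fix s t assume "(\<Sum>r<n. g s r * h r t) \<noteq> 0"
  then obtain r where "g s r * h r t \<noteq> 0" using sum.neutral by meson
  then have "g s r \<noteq> 0" "h r t \<noteq> 0" by auto
  then show "s < length w \<and> t < length u \<and> reach (w ! s) (u ! t)"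
    using assms reach_trans unfolding mats_def by blast
qed

lemma mat_hom_mat_mult:
  assumes h: "h \<in> mats u v" and x: "x \<in> carrier (proj_sum u)"
  shows "mat_hom v g (mat_hom u h x) = mat_hom u (mat_mult (length v) g h) x"
proof (intro ext)
  fix s c
  have "mat_hom u h x \<in> carrier (proj_sum v)" using mod_homD(2)[OF mat_hom_hom[OF h] x] .
  then have "mat_hom v g (mat_hom u h x) s c = (\<Sum>r<length v. g s r * mat_hom u h x r c)"
    by (simp add: mat_hom_def[of v])
  also have "\<dots> = (\<Sum>r<length v. \<Sum>t<length u. g s r * (h r t * x t c))"
    using x by (simp add: mat_hom_def sum_distrib_left)
  also have "\<dots> = (\<Sum>t<length u. \<Sum>r<length v. g s r * (h r t * x t c))" by (rule sum.swap)
  also have "\<dots> = mat_hom u (mat_mult (length v) g h) x s c"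
    using x by (simp add: mat_hom_def mat_mult_def sum_distrib_right mult.assoc)
  finally show "mat_hom v g (mat_hom u h x) s c = mat_hom u (mat_mult (length v) g h) x s c" .
qed

lemma mats_id_mat: "set v \<subseteq> verts Q \<Longrightarrow> id_mat (length v) \<in> mats v v"
  by (auto simp: mats_def id_mat_def intro!: reach_refl)

lemma mat_hom_id_mat:
  assumes "x \<in> carrier (proj_sum v)"
  shows "mat_hom v (id_mat (length v)) x = x"
proof (intro ext)
  fix s u
  have "(\<Sum>t<length v. id_mat (length v) s t * x t u) = (\<Sum>t<length v. if t = s then x s u else 0)"
    by (rule sum.cong) (auto simp: id_mat_def)
  then show "mat_hom v (id_mat (length v)) x s u = x s u" using assms by (auto simp: mat_hom_def proj_sum_simps)
qed

lemma mats_zero_mat: "zero_mat \<in> mats v w"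
  by (simp add: mats_def zero_mat_def)

lemma mat_hom_zero_mat: "mat_hom v zero_mat = zero_map (proj_sum v) (proj_sum w)"
  by (simp add: mat_hom_def zero_mat_def zero_map_def proj_sum_simps(2))

definition invertible :: "'v list \<Rightarrow> 'v list \<Rightarrow> (nat \<Rightarrow> nat \<Rightarrow> 'k) \<Rightarrow> bool" where
  "invertible v w g \<longleftrightarrow> (\<exists>g'\<in>mats w v. mat_mult (length w) g' g = id_mat (length v) \<and> mat_mult (length v) g g' = id_mat (length w))"

lemma mat_hom_iso_iff:
  assumes g: "g \<in> mats v w" and v: "set v \<subseteq> verts Q" and w: "set w \<subseteq> verts Q"
  shows "mat_hom v g \<in> mod_iso A (proj_sum v) (proj_sum w) \<longleftrightarrow> invertible v w g"
proof
  assume i: "mat_hom v g \<in> mod_iso A (proj_sum v) (proj_sum w)"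
  note I = mod_iso_inv[OF i left_module_proj_sum]
  obtain g' where g': "g' \<in> mats w v" "inv_hom (proj_sum v) (proj_sum w) (mat_hom v g) = mat_hom w g'"
    using mat_hom_surj[OF mod_isoD(1)[OF I] w] by blast
  have "mat_mult (length w) g' g = id_mat (length v)"
  proof (rule mat_hom_inj[OF mats_mat_mult[OF g g'(1)] mats_id_mat[OF v] v])
    fix x assume x: "x \<in> carrier (proj_sum v)"
    show "mat_hom v (mat_mult (length w) g' g) x = mat_hom v (id_mat (length v)) x"
      using mat_hom_mat_mult[OF g x, of g'] mat_hom_id_mat[OF x] inv_hom(1)[OF i x] g'(2) by simp
  qed
  moreover have "mat_mult (length v) g g' = id_mat (length w)"
  proof (rule mat_hom_inj[OF mats_mat_mult[OF g'(1) g] mats_id_mat[OF w] w])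
    fix x assume x: "x \<in> carrier (proj_sum w)"
    show "mat_hom w (mat_mult (length v) g g') x = mat_hom w (id_mat (length w)) x"
      using mat_hom_mat_mult[OF g'(1) x, of g] mat_hom_id_mat[OF x] inv_hom(2)[OF i x] g'(2) by simp
  qed
  ultimately show "invertible v w g" using g'(1) by (auto simp: invertible_def)
next
  assume "invertible v w g"
  then obtain g' where g': "g' \<in> mats w v" "mat_mult (length w) g' g = id_mat (length v)" "mat_mult (length v) g g' = id_mat (length w)"
    by (auto simp: invertible_def)
  have "bij_betw (mat_hom v g) (carrier (proj_sum v)) (carrier (proj_sum w))"
  proof (rule bij_betwI[of _ _ _ "mat_hom w g'"])
    show "mat_hom v g \<in> carrier (proj_sum v) \<rightarrow> carrier (proj_sum w)" using mod_homD(2)[OF mat_hom_hom[OF g]] by blast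
    show "mat_hom w g' \<in> carrier (proj_sum w) \<rightarrow> carrier (proj_sum v)" using mod_homD(2)[OF mat_hom_hom[OF g'(1)]] by blast
  next
    fix x assume x: "x \<in> carrier (proj_sum v)"
    show "mat_hom w g' (mat_hom v g x) = x" unfolding mat_hom_mat_mult[OF g x] g'(2) by (rule mat_hom_id_mat[OF x])
  next
    fix x assume x: "x \<in> carrier (proj_sum w)"
    show "mat_hom v g (mat_hom w g' x) = x" unfolding mat_hom_mat_mult[OF g'(1) x] g'(3) by (rule mat_hom_id_mat[OF x])
  qed
  then show "mat_hom v g \<in> mod_iso A (proj_sum v) (proj_sum w)" using mat_hom_hom[OF g] by (simp add: mod_iso_def)
qed

definition std :: "'v list \<Rightarrow> (nat \<Rightarrow> nat \<Rightarrow> 'k) \<Rightarrow> (('v, 'e) qpath \<Rightarrow> 'k, nat \<Rightarrow> 'v \<Rightarrow> 'k) cyc" where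
  "std v D = (proj_sum v, mat_hom v D)"

definition mat_isos :: "'v list \<Rightarrow> (nat \<Rightarrow> nat \<Rightarrow> 'k) \<Rightarrow> 'v list \<Rightarrow> (nat \<Rightarrow> nat \<Rightarrow> 'k) \<Rightarrow> (nat \<Rightarrow> nat \<Rightarrow> 'k) set" where
  "mat_isos v D w E = {g \<in> mats v w. invertible v w g \<and> mat_mult (length v) g D = mat_mult (length w) E g}"

lemma pre_cyc_std: "D \<in> mats v v \<Longrightarrow> pre_cyc A (std v D)"
  by (simp add: pre_cyc_def std_def left_module_proj_sum finite_proj_sum mat_hom_hom)

lemma cyc_iso_std:
  assumes D: "D \<in> mats v v" and E: "E \<in> mats w w" and v: "set v \<subseteq> verts Q" and w: "set w \<subseteq> verts Q"
  shows "cyc_iso A (std v D) (std w E) = mat_hom v ` mat_isos v D w E"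
proof -
  have comm: "(\<forall>x\<in>carrier (proj_sum v). mat_hom v g (mat_hom v D x) = mat_hom w E (mat_hom v g x)) \<longleftrightarrow>
      mat_mult (length v) g D = mat_mult (length w) E g" if g: "g \<in> mats v w" for g
  proof -
    have "(\<forall>x\<in>carrier (proj_sum v). mat_hom v g (mat_hom v D x) = mat_hom w E (mat_hom v g x)) \<longleftrightarrow>
      (\<forall>x\<in>carrier (proj_sum v). mat_hom v (mat_mult (length v) g D) x = mat_hom v (mat_mult (length w) E g) x)"
      by (rule ball_cong) (simp_all only: mat_hom_mat_mult[OF D] mat_hom_mat_mult[OF g])
    also have "\<dots> \<longleftrightarrow> mat_mult (length v) g D = mat_mult (length w) E g"
      using mat_hom_inj[OF mats_mat_mult[OF D g] mats_mat_mult[OF g E] v] by metis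
    finally show ?thesis .
  qed
  show ?thesis
  proof (intro equalityI subsetI)
    fix f assume f: "f \<in> cyc_iso A (std v D) (std w E)"
    have i: "f \<in> mod_iso A (proj_sum v) (proj_sum w)" using cyc_isoD(1)[OF f] by (simp add: std_def)
    obtain g where g: "g \<in> mats v w" "f = mat_hom v g" by (rule mat_hom_surj[OF mod_isoD(1)[OF i] v])
    then show "f \<in> mat_hom v ` mat_isos v D w E"
      using mat_hom_iso_iff[OF g(1) v w] i comm[OF g(1)] cyc_isoD(3)[OF f] by (auto simp: mat_isos_def std_def)
  next
    fix f assume "f \<in> mat_hom v ` mat_isos v D w E"
    then obtain g where g: "g \<in> mats v w" "invertible v w g" "mat_mult (length v) g D = mat_mult (length w) E g" "f = mat_hom v g"
      by (auto simp: mat_isos_def)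
    show "f \<in> cyc_iso A (std v D) (std w E)"
      by (rule cyc_isoI) (use g comm[OF g(1)] mat_hom_iso_iff[OF g(1) v w] in \<open>auto simp: std_def\<close>)
  qed
qed

lemma inj_mat_hom:
  assumes "set v \<subseteq> verts Q"
  shows "inj_on (mat_hom v) (mats v w)"
proof (rule inj_onI)
  fix g h assume "g \<in> mats v w" "h \<in> mats v w" "mat_hom v g = mat_hom v h"
  then show "g = h" by (intro mat_hom_inj[OF _ _ assms]) auto
qed

lemma card_cyc_iso_std:
  assumes "D \<in> mats v v" "E \<in> mats w w" and v: "set v \<subseteq> verts Q" and "set w \<subseteq> verts Q"
  shows "card (cyc_iso A (std v D) (std w E)) = card (mat_isos v D w E)"
  unfolding cyc_iso_std[OF assms]
  by (rule card_image, rule inj_on_subset[OF inj_mat_hom[OF v, of w]]) (auto simp: mat_isos_def)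

lemma cyc_equiv_std:
  assumes "D \<in> mats v v" "E \<in> mats w w" "set v \<subseteq> verts Q" "set w \<subseteq> verts Q"
  shows "cyc_equiv A (std v D) (std w E) \<longleftrightarrow> mat_isos v D w E \<noteq> {}"
  unfolding cyc_equiv_def cyc_iso_std[OF assms] by simp

lemma mod_hom_proj_sum:
  assumes "set v \<subseteq> verts Q"
  shows "mod_hom A (proj_sum v) (proj_sum w) = mat_hom v ` mats v w"
  using mat_hom_surj[OF _ assms] mat_hom_hom by blast

section \<open>Direct sums as concatenation, extensions as block matrices\<close>

definition join :: "'v list \<Rightarrow> 'v list \<Rightarrow> (nat \<Rightarrow> 'v \<Rightarrow> 'k) \<times> (nat \<Rightarrow> 'v \<Rightarrow> 'k) \<Rightarrow> nat \<Rightarrow> 'v \<Rightarrow> 'k" where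
  "join v w = (\<lambda>(x, y)\<in>carrier (proj_sum v) \<times> carrier (proj_sum w).
     \<lambda>t u. if t < length v then x t u else y (t - length v) u)"

lemma join_iso: "join v w \<in> mod_iso A (proj_sum v \<oplus>\<^sub>m proj_sum w) (proj_sum (v @ w))"
proof -
  note V = left_moduleD[OF left_module_proj_sum[of v]] and W = left_moduleD[OF left_module_proj_sum[of w]]
  have h: "join v w \<in> mod_hom A (proj_sum v \<oplus>\<^sub>m proj_sum w) (proj_sum (v @ w))"
  proof (rule mod_homI)
    show "join v w \<in> extensional (carrier (proj_sum v \<oplus>\<^sub>m proj_sum w))" by (simp add: join_def)
    fix p q a assume "p \<in> carrier (proj_sum v \<oplus>\<^sub>m proj_sum w)"
    then obtain x y where p: "p = (x, y)" "x \<in> carrier (proj_sum v)" "y \<in> carrier (proj_sum w)" by auto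
    show "join v w p \<in> carrier (proj_sum (v @ w))"
      unfolding proj_sum_simps
    proof (intro allI impI)
      fix t u assume nz: "join v w p t u \<noteq> 0"
      show "t < length (v @ w) \<and> reach ((v @ w) ! t) u"
      proof (cases "t < length v")
        case True
        then have "x t u \<noteq> 0" using nz p by (simp add: join_def)
        then have "reach (v ! t) u" using p(2) unfolding proj_sum_simps by blast
        then show ?thesis using True by (simp add: nth_append)
      next
        case False
        then have "y (t - length v) u \<noteq> 0" using nz p by (simp add: join_def)
        then have "t - length v < length w" "reach (w ! (t - length v)) u" using p(3) unfolding proj_sum_simps by blast+
        then show ?thesis using False by (auto simp: nth_append)
      qed
    qed
    show "join v w (a \<odot>\<^bsub>proj_sum v \<oplus>\<^sub>m proj_sum w\<^esub> p) = a \<odot>\<^bsub>proj_sum (v @ w)\<^esub> join v w p" if a: "a \<in> carrier A"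
      using p V(3)[OF a p(2)] W(3)[OF a p(3)] by (auto simp: join_def proj_sum_simps(4) fun_eq_iff)
    assume "q \<in> carrier (proj_sum v \<oplus>\<^sub>m proj_sum w)"
    then obtain x' y' where q: "q = (x', y')" "x' \<in> carrier (proj_sum v)" "y' \<in> carrier (proj_sum w)" by auto
    show "join v w (p \<oplus>\<^bsub>proj_sum v \<oplus>\<^sub>m proj_sum w\<^esub> q) = join v w p \<oplus>\<^bsub>proj_sum (v @ w)\<^esub> join v w q"
      using p q V(4)[OF p(2) q(2)] W(4)[OF p(3) q(3)] by (auto simp: join_def proj_sum_simps(3) fun_eq_iff)
  qed
  moreover have "bij_betw (join v w) (carrier (proj_sum v \<oplus>\<^sub>m proj_sum w)) (carrier (proj_sum (v @ w)))"
  proof (rule bij_betwI[of _ _ _ "\<lambda>z. (\<lambda>t u. if t < length v then z t u else 0, \<lambda>t u. z (t + length v) u)"])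
    show "join v w \<in> carrier (proj_sum v \<oplus>\<^sub>m proj_sum w) \<rightarrow> carrier (proj_sum (v @ w))" using mod_homD(2)[OF h] by blast
    have c: "(\<lambda>t u. if t < length v then z t u else 0) \<in> carrier (proj_sum v)"
      "(\<lambda>t u. z (t + length v) u) \<in> carrier (proj_sum w)" if z: "z \<in> carrier (proj_sum (v @ w))" for z
    proof -
      have z': "z t u \<noteq> 0 \<Longrightarrow> t < length v + length w \<and> reach ((v @ w) ! t) u" for t u
        using z by (auto simp: proj_sum_simps)
      show "(\<lambda>t u. if t < length v then z t u else 0) \<in> carrier (proj_sum v)"
        using z' by (fastforce simp: proj_sum_simps nth_append)
      show "(\<lambda>t u. z (t + length v) u) \<in> carrier (proj_sum w)"
        using z' by (fastforce simp: proj_sum_simps nth_append)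
    qed
    then show "(\<lambda>z. (\<lambda>t u. if t < length v then z t u else 0, \<lambda>t u. z (t + length v) u))
      \<in> carrier (proj_sum (v @ w)) \<rightarrow> carrier (proj_sum v \<oplus>\<^sub>m proj_sum w)" by simp
    fix z assume "z \<in> carrier (proj_sum (v @ w))"
    then show "join v w (\<lambda>t u. if t < length v then z t u else 0, \<lambda>t u. z (t + length v) u) = z"
      using c[of z] by (auto simp: join_def fun_eq_iff)
  next
    fix p assume "p \<in> carrier (proj_sum v \<oplus>\<^sub>m proj_sum w)"
    then obtain x y where p: "p = (x, y)" "x \<in> carrier (proj_sum v)" "y \<in> carrier (proj_sum w)" by auto
    then show "(\<lambda>t u. if t < length v then join v w p t u else 0, \<lambda>t u. join v w p (t + length v) u) = p"
      by (auto simp: join_def proj_sum_simps fun_eq_iff)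
  qed
  ultimately show ?thesis by (simp add: mod_iso_def)
qed

definition block :: "nat \<Rightarrow> (nat \<Rightarrow> nat \<Rightarrow> 'k) \<Rightarrow> (nat \<Rightarrow> nat \<Rightarrow> 'k) \<Rightarrow> (nat \<Rightarrow> nat \<Rightarrow> 'k) \<Rightarrow> nat \<Rightarrow> nat \<Rightarrow> 'k" where
  "block n D h E = (\<lambda>s t. if s < n then (if t < n then D s t else h s (t - n))
     else if t < n then 0 else E (s - n) (t - n))"

lemma block_mats:
  assumes "D \<in> mats v v" "E \<in> mats w w" "h \<in> mats w v"
  shows "block (length v) D h E \<in> mats (v @ w) (v @ w)"
  unfolding mats_def
proof (intro CollectI allI impI)
  fix s t assume nz: "block (length v) D h E s t \<noteq> 0"
  have a: "D s t \<noteq> 0 \<Longrightarrow> s < length v \<and> t < length v \<and> reach (v ! s) (v ! t)"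
    "E s' t' \<noteq> 0 \<Longrightarrow> s' < length w \<and> t' < length w \<and> reach (w ! s') (w ! t')"
    "h s t' \<noteq> 0 \<Longrightarrow> s < length v \<and> t' < length w \<and> reach (v ! s) (w ! t')" for s' t'
    using assms by (auto simp: mats_def)
  show "s < length (v @ w) \<and> t < length (v @ w) \<and> reach ((v @ w) ! s) ((v @ w) ! t)"
    using nz a(1) a(2)[of "s - length v" "t - length v"] a(3)[of "t - length v"]
    by (auto simp: block_def nth_append split: if_splits)
qed

lemma sum_lessThan_add:
  "(\<Sum>t<n + (m :: nat). F t) = (\<Sum>t<n. F t) + (\<Sum>t<m. F (t + n) :: 'k)"
  by (induction m) (auto simp: algebra_simps)

text \<open>The subobject is the first summand of an extension, so in the concatenated list the
  connecting homomorphism \<open>h\<close> lies above the diagonal.\<close>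

lemma ext_std:
  assumes D: "D \<in> mats v v" and E: "E \<in> mats w w" and h: "h \<in> mats w v"
  shows "cyc_equiv A (ext_cyc (std v D) (std w E) (mat_hom w h)) (std (v @ w) (block (length v) D h E))"
proof (rule cyc_equivI[of "join v w"])
  show "join v w \<in> mod_iso A (fst (ext_cyc (std v D) (std w E) (mat_hom w h))) (fst (std (v @ w) (block (length v) D h E)))"
    using join_iso by (simp add: ext_cyc_def std_def)
  fix p assume "p \<in> carrier (fst (ext_cyc (std v D) (std w E) (mat_hom w h)))"
  then obtain x y where p: "p = (x, y)" "x \<in> carrier (proj_sum v)" "y \<in> carrier (proj_sum w)"
    by (auto simp: ext_cyc_def std_def)
  let ?z = "join v w p"
  have z: "?z \<in> carrier (proj_sum (v @ w))" using mod_homD(2)[OF mod_isoD(1)[OF join_iso], of p] p by simp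
  have zt: "?z t u = (if t < length v then x t u else y (t - length v) u)" for t u using p by (simp add: join_def)
  have c: "mat_hom v D x \<oplus>\<^bsub>proj_sum v\<^esub> mat_hom w h y \<in> carrier (proj_sum v)" "mat_hom w E y \<in> carrier (proj_sum w)"
    using mod_homD(2)[OF mat_hom_hom[OF D] p(2)] mod_homD(2)[OF mat_hom_hom[OF h] p(3)]
      mod_homD(2)[OF mat_hom_hom[OF E] p(3)] left_moduleD(4)[OF left_module_proj_sum] by auto
  have "join v w (mat_hom v D x \<oplus>\<^bsub>proj_sum v\<^esub> mat_hom w h y, mat_hom w E y) = mat_hom (v @ w) (block (length v) D h E) ?z"
  proof (intro ext)
    fix s u
    have "mat_hom (v @ w) (block (length v) D h E) ?z s u =
      (\<Sum>t<length v + length w. block (length v) D h E s t * ?z t u)" using z by (simp add: mat_hom_def)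
    also have "\<dots> = (\<Sum>t<length v. block (length v) D h E s t * x t u) +
      (\<Sum>t<length w. block (length v) D h E s (t + length v) * y t u)"
      unfolding sum_lessThan_add by (simp add: zt)
    also have "\<dots> = (if s < length v then mat_hom v D x s u + mat_hom w h y s u else mat_hom w E y (s - length v) u)"
      using p by (auto simp: block_def mat_hom_def)
    finally show "join v w (mat_hom v D x \<oplus>\<^bsub>proj_sum v\<^esub> mat_hom w h y, mat_hom w E y) s u =
      mat_hom (v @ w) (block (length v) D h E) ?z s u"
      using c p by (simp add: join_def proj_sum_simps(3))
  qed
  then show "join v w (snd (ext_cyc (std v D) (std w E) (mat_hom w h)) p) =
     snd (std (v @ w) (block (length v) D h E)) (join v w p)"
    using p by (simp add: ext_cyc_def std_def)
qed

text \<open>\<open>proj_sum [a]\<close> is the left ideal generated by the trivial path at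
  \<open>a\<close>. Choose a preimage \<open>x0\<close> of the image of the generator and let the
  coefficients of \<open>x\<close>, viewed as an algebra element by \<open>lift\<close>, act on
  \<open>x0\<close>.\<close>

lemma projective_single:
  assumes a: "a \<in> verts Q"
  shows "projective A (proj_sum [a])"
  unfolding projective_def fd_module_iff
proof (intro conjI allI impI ballI left_module_proj_sum finite_proj_sum)
  fix X Y :: "(('v, 'e) qpath \<Rightarrow> 'k, nat) module" and g h
  assume X: "left_module A X \<and> finite (carrier X)" and Y: "left_module A Y \<and> finite (carrier Y)"
    and g: "g \<in> mod_hom A X Y" "g ` carrier X = carrier Y" and h: "h \<in> mod_hom A (proj_sum [a]) Y"
  interpret X: left_module A X using X by simp
  have gc: "gen [a] 0 \<in> carrier (proj_sum [a])" using gen_closed[of 0 "[a]"] a by simp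
  then have "h (gen [a] 0) \<in> g ` carrier X" using mod_homD(2)[OF h gc] g(2) by simp
  then obtain x0 where x0: "x0 \<in> carrier X" "h (gen [a] 0) = g x0" by blast
  define l where "l = (\<lambda>x\<in>carrier (proj_sum [a]). lift a (x 0) \<odot>\<^bsub>X\<^esub> x0)"
  have nz: "reach a u" if "x \<in> carrier (proj_sum [a])" "x 0 u \<noteq> 0" for x u
    using that unfolding proj_sum_simps by fastforce
  have z: "x t u = 0" if "x \<in> carrier (proj_sum [a])" "t \<noteq> 0" for x t u
    using that unfolding proj_sum_simps by fastforce
  have e: "lift a (x 0) \<odot>\<^bsub>proj_sum [a]\<^esub> gen [a] 0 = x" if x: "x \<in> carrier (proj_sum [a])" for x
  proof -
    have "lift a (x 0) \<odot>\<^bsub>proj_sum [a]\<^esub> gen [a] 0 = (\<lambda>s u. x 0 u * gen [a] 0 s a)"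
      using nz[OF x] by (intro lift_smult[OF a])
    also have "\<dots> = x" using z[OF x] by (auto simp: gen_def fun_eq_iff)
    finally show ?thesis .
  qed
  note M = left_moduleD[OF left_module_proj_sum[of "[a]"]]
  have lA: "lift a ((x \<oplus>\<^bsub>proj_sum [a]\<^esub> y) 0) = lift a (x 0) \<oplus>\<^bsub>A\<^esub> lift a (y 0)" for x y
    using lift_closed unfolding A_eq
    by (intro PA_eqI PA_closed) (auto simp: coef_lift coef_add proj_sum_simps(3))
  have lS: "lift a ((b \<odot>\<^bsub>proj_sum [a]\<^esub> x) 0) = b \<otimes>\<^bsub>A\<^esub> lift a (x 0)"
    if b: "b \<in> carrier A" and x: "x \<in> carrier (proj_sum [a])" for b x
  proof -
    have "coef (lift a ((b \<odot>\<^bsub>proj_sum [a]\<^esub> x) 0)) u v = coef (b \<otimes>\<^bsub>A\<^esub> lift a (x 0)) u v" for u v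
    proof (cases "u = a \<and> reach a v")
      case True
      have "(\<Sum>m\<in>verts Q. coef b m v * x 0 m) = (\<Sum>m\<in>verts Q. coef b m v * (if reach a m then x 0 m else 0))"
        using nz[OF x] by (intro sum.cong) auto
      then show ?thesis using True by (simp add: coef_lift coef_simps proj_sum_simps(4))
    next
      case False
      have "coef b m v = 0" if "u = a" "reach a m" for m
        using False coef_nz[of b m v] reach_trans[of a m v] that by blast
      then have s0: "(\<Sum>m\<in>verts Q. coef b m v * (if u = a \<and> reach a m then x 0 m else 0)) = 0"
        by (intro sum.neutral) simp
      have l0: "coef (lift a ((b \<odot>\<^bsub>proj_sum [a]\<^esub> x) 0)) u v = 0" using False by (auto simp: coef_lift)
      show ?thesis unfolding l0 unfolding coef_simps coef_lift s0 ..
    qed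
    then show ?thesis using lift_closed b unfolding A_eq by (intro PA_eqI PA_closed)
  qed
  have "l \<in> mod_hom A (proj_sum [a]) X"
    by (rule mod_homI)
      (auto simp: l_def lA lS M X.smult_closed X.smult_l_distr X.smult_assoc x0 lift_closed)
  moreover have "g (l x) = h x" if x: "x \<in> carrier (proj_sum [a])" for x
  proof -
    have "g (l x) = lift a (x 0) \<odot>\<^bsub>Y\<^esub> h (gen [a] 0)"
      using x mod_homD(4)[OF g(1) lift_closed x0(1)] x0(2) by (simp add: l_def)
    also have "\<dots> = h x" using mod_homD(4)[OF h lift_closed gc] e[OF x] by metis
    finally show ?thesis .
  qed
  ultimately show "\<exists>l\<in>mod_hom A (proj_sum [a]) X. \<forall>x\<in>carrier (proj_sum [a]). g (l x) = h x" by blast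
qed

lemma projective_proj_sum: "set v \<subseteq> verts Q \<Longrightarrow> projective A (proj_sum v)"
proof (induction v)
  case Nil
  have "(\<lambda>x\<in>carrier zero_module. \<zero>\<^bsub>proj_sum []\<^esub>) \<in> mod_iso A zero_module (proj_sum [])"
    using zero_hom[OF ring_axioms left_module_proj_sum]
    by (auto simp: mod_iso_def bij_betw_def zero_module_def proj_sum_simps fun_eq_iff)
  then show ?case using projective_iso[OF projective_zero left_module_proj_sum] by blast
next
  case (Cons a v)
  then show ?case
    using projective_iso[OF projective_dsum[OF projective_single] left_module_proj_sum join_iso[of "[a]" v]] by auto
qed

end

context thin_algebra
begin

section \<open>The complexes of the theorem as matrices\<close>

lemma std_C1_iff:
  assumes D: "D \<in> mats v v" and v: "set v \<subseteq> verts Q"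
  shows "std v D \<in> C1_proj A \<longleftrightarrow> mat_mult (length v) D D = zero_mat"
proof -
  have "(\<forall>x\<in>carrier (proj_sum v). mat_hom v D (mat_hom v D x) = \<zero>\<^bsub>proj_sum v\<^esub>) \<longleftrightarrow>
    (\<forall>x\<in>carrier (proj_sum v). mat_hom v (mat_mult (length v) D D) x = mat_hom v zero_mat x)"
    by (rule ball_cong) (simp_all only: mat_hom_mat_mult[OF D] mat_hom_zero_mat[of v v] zero_map_def restrict_apply')
  also have "\<dots> \<longleftrightarrow> mat_mult (length v) D D = zero_mat"
    using mat_hom_inj[OF mats_mat_mult[OF D D] mats_zero_mat v] by metis
  finally show ?thesis
    using projective_proj_sum[OF v] mat_hom_hom[OF D] by (simp add: C1_proj_def std_def)
qed

text \<open>A matrix model of a complex on any carrier type; through it the chosen modules of the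
  theorem are replaced by matrices.\<close>

definition is_std :: "(('v, 'e) qpath \<Rightarrow> 'k, 'm) cyc \<Rightarrow> 'v list \<Rightarrow> (nat \<Rightarrow> nat \<Rightarrow> 'k) \<Rightarrow> bool" where
  "is_std X v D \<longleftrightarrow> pre_cyc A X \<and> D \<in> mats v v \<and> set v \<subseteq> verts Q \<and> cyc_equiv A X (std v D)"

definition mod_std :: "(('v, 'e) qpath \<Rightarrow> 'k, 'm) module \<Rightarrow> 'v list \<Rightarrow> bool" where
  "mod_std M v \<longleftrightarrow> left_module A M \<and> finite (carrier M) \<and> set v \<subseteq> verts Q \<and> mod_iso A M (proj_sum v) \<noteq> {}"

lemma mod_std_dsum:
  assumes M: "mod_std M v" and N: "mod_std N w"
  shows "mod_std (M \<oplus>\<^sub>m N) (v @ w)"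
proof -
  have m: "left_module A M" "left_module A N" using M N by (auto simp: mod_std_def)
  obtain f g where "f \<in> mod_iso A M (proj_sum v)" "g \<in> mod_iso A N (proj_sum w)" using M N by (auto simp: mod_std_def)
  then have "pair_hom M N f g \<in> mod_iso A (M \<oplus>\<^sub>m N) (proj_sum v \<oplus>\<^sub>m proj_sum w)" using m by (intro pair_hom_iso)
  then have "compose (carrier (M \<oplus>\<^sub>m N)) (join v w) (pair_hom M N f g) \<in> mod_iso A (M \<oplus>\<^sub>m N) (proj_sum (v @ w))"
    using join_iso left_module_dsum[OF m] by (intro mod_iso_compose)
  then show ?thesis using M N left_module_dsum[OF m] by (auto simp: mod_std_def)
qed

lemma mod_std_projective: "mod_std M v \<Longrightarrow> projective A M"
  using projective_iso[OF projective_proj_sum] mod_iso_inv unfolding mod_std_def by blast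

lemma C_cyc_mod_std:
  assumes M: "mod_std M v"
  shows "is_std (C_cyc A M) v zero_mat"
proof -
  have m: "left_module A M" "finite (carrier M)" using M by (auto simp: mod_std_def)
  obtain f where f: "f \<in> mod_iso A M (proj_sum v)" using M by (auto simp: mod_std_def)
  note C = C_cyc_projective[OF mod_std_projective[OF M]]
  have "cyc_equiv A (M, zero_map M M) (std v zero_mat)"
  proof (rule cyc_equivI[of f])
    fix x assume "x \<in> carrier (fst (M, zero_map M M))"
    then show "f (snd (M, zero_map M M) x) = snd (std v zero_mat) (f x)"
      using mod_hom_zero[OF m(1) left_module_proj_sum mod_isoD(1)[OF f]] mod_homD(2)[OF mod_isoD(1)[OF f]]
      by (simp add: std_def mat_hom_zero_mat[of v v] zero_map_def)
  qed (use f in \<open>simp add: std_def\<close>)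
  then have "cyc_equiv A (C_cyc A M) (std v zero_mat)" by (rule cyc_equiv_trans[OF C(1) _ C(2)])
  then show ?thesis using C(2) M mats_zero_mat by (simp add: is_std_def mod_std_def)
qed

lemma is_std_dsum:
  assumes X: "is_std X v D" and Y: "is_std Y w E"
  shows "is_std (X \<oplus>\<^sub>c Y) (v @ w) (block (length v) D zero_mat E)"
proof -
  have p: "pre_cyc A X" "pre_cyc A Y" and D: "D \<in> mats v v" "E \<in> mats w w"
    and vs: "set v \<subseteq> verts Q" "set w \<subseteq> verts Q" using X Y by (auto simp: is_std_def)
  have l: "left_module A (fst X)" "left_module A (fst Y)" using p by (auto simp: pre_cyc_def)
  obtain f g where f: "f \<in> cyc_iso A X (std v D)" and g: "g \<in> cyc_iso A Y (std w E)"
    using X Y by (auto simp: is_std_def cyc_equiv_def)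
  have f': "f \<in> mod_hom A (fst X) (proj_sum v)" and g': "g \<in> mod_hom A (fst Y) (proj_sum w)"
    using mod_isoD(1)[OF cyc_isoD(1)[OF f]] mod_isoD(1)[OF cyc_isoD(1)[OF g]] by (auto simp: std_def)
  note Z = zero_map[OF l(2) l(1)]
  have "cyc_equiv A (ext_cyc X Y (zero_map (fst Y) (fst X))) (ext_cyc (std v D) (std w E) (mat_hom w zero_mat))"
  proof (rule ext_cyc_equiv[OF f g p(2,1) Z])
    fix y assume y: "y \<in> carrier (fst Y)"
    show "f (zero_map (fst Y) (fst X) y) = mat_hom w zero_mat (g y)"
      using y mod_hom_zero[OF l(1) left_module_proj_sum f'] mod_homD(2)[OF g' y]
      by (simp add: zero_map_def mat_hom_zero_mat[of w v])
  qed
  then have "cyc_equiv A (X \<oplus>\<^sub>c Y) (std (v @ w) (block (length v) D zero_mat E))"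
    unfolding cyc_dsum_eq_ext[OF p]
    by (rule cyc_equiv_trans[OF _ ext_std[OF D mats_zero_mat] pre_cyc_ext[OF p(2,1) Z]])
  then show ?thesis
    using pre_cyc_ext[OF p(2,1) Z] block_mats[OF D mats_zero_mat] vs
    by (simp add: is_std_def cyc_dsum_eq_ext[OF p])
qed

lemma is_std_upper:
  assumes M: "mod_std M v" and N: "mod_std N w" and d: "\<delta> \<in> mod_hom A N M"
    and a: "\<alpha> \<in> mod_iso A M (proj_sum v)" and b: "\<beta> \<in> mod_iso A N (proj_sum w)" and h: "h \<in> mats w v"
    and eq: "\<And>y. y \<in> carrier N \<Longrightarrow> \<alpha> (\<delta> y) = mat_hom w h (\<beta> y)"
  shows "is_std (upper_cyc M N \<delta>) (v @ w) (block (length v) zero_mat h zero_mat)"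
proof -
  have m: "left_module A M" "left_module A N" and fin: "finite (carrier M)" "finite (carrier N)"
    and vs: "set v \<subseteq> verts Q" "set w \<subseteq> verts Q" using M N by (auto simp: mod_std_def)
  note U = upper_cyc_eq_ext[OF m d]
  have p: "pre_cyc A (M, zero_map M M)" "pre_cyc A (N, zero_map N N)"
    using m fin zero_map by (auto simp: pre_cyc_def)
  have pe: "pre_cyc A (ext_cyc (M, zero_map M M) (N, zero_map N N) \<delta>)"
    using p d by (intro pre_cyc_ext) auto
  have i: "f \<in> cyc_iso A (L, zero_map L L) (std u zero_mat)"
    if "left_module A L" "f \<in> mod_iso A L (proj_sum u)" for f L u
  proof (rule cyc_isoI)
    fix x assume "x \<in> carrier (fst (L, zero_map L L))"
    then show "f (snd (L, zero_map L L) x) = snd (std u zero_mat) (f x)"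
      using mod_hom_zero[OF that(1) left_module_proj_sum mod_isoD(1)[OF that(2)]] mod_homD(2)[OF mod_isoD(1)[OF that(2)]]
      by (simp add: std_def mat_hom_zero_mat[of u u] zero_map_def)
  qed (use that in \<open>simp add: std_def\<close>)
  have "cyc_equiv A (ext_cyc (M, zero_map M M) (N, zero_map N N) \<delta>) (ext_cyc (std v zero_mat) (std w zero_mat) (mat_hom w h))"
    by (rule ext_cyc_equiv[OF i[OF m(1) a] i[OF m(2) b] p(2,1)]) (use d eq in auto)
  then have "cyc_equiv A (upper_cyc M N \<delta>) (std (v @ w) (block (length v) zero_mat h zero_mat))"
    unfolding U by (rule cyc_equiv_trans[OF _ ext_std[OF mats_zero_mat mats_zero_mat h] pe])
  then show ?thesis using pe block_mats[OF mats_zero_mat mats_zero_mat h] vs by (simp add: is_std_def U)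
qed

lemma K_cyc_std:
  assumes M: "mod_std M v"
  shows "is_std (K_cyc M) (v @ v) (block (length v) zero_mat (id_mat (length v)) zero_mat)"
proof -
  have m: "left_module A M" and vs: "set v \<subseteq> verts Q" using M by (auto simp: mod_std_def)
  obtain f where f: "f \<in> mod_iso A M (proj_sum v)" using M by (auto simp: mod_std_def)
  show ?thesis unfolding K_cyc_def
    by (rule is_std_upper[OF M M mod_isoD(1)[OF mod_iso_id[OF m]] f f mats_id_mat[OF vs]])
      (simp add: mat_hom_id_mat mod_homD(2)[OF mod_isoD(1)[OF f]])
qed

section \<open>Covers of the simple modules and the cokernel of a nonzero map\<close>

lemma simple_at_simps:
  "carrier (simple_at i A) = UNIV" "\<zero>\<^bsub>simple_at i A\<^esub> = 0" "x \<oplus>\<^bsub>simple_at i A\<^esub> y = x + y"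
  "a \<odot>\<^bsub>simple_at i A\<^esub> x = a (i, [], i) * x"
  by (simp_all add: simple_at_def)

text \<open>The projection of \<open>P_i\<close> onto its top: the coordinate at the trivial path.
  Its kernel is the radical.\<close>

definition top_map :: "'v \<Rightarrow> (nat \<Rightarrow> 'v \<Rightarrow> 'k) \<Rightarrow> 'k" where
  "top_map i = (\<lambda>x\<in>carrier (proj_sum [i]). x 0 i)"

lemma coef_diag: "i \<in> verts Q \<Longrightarrow> coef a i i = a (i, [], i)"
  by (simp add: coef_def reach_refl path_refl)

lemma proj_sum_single:
  assumes "x \<in> carrier (proj_sum [i])"
  shows "x 0 u \<noteq> 0 \<Longrightarrow> reach i u" "t \<noteq> 0 \<Longrightarrow> x t u = 0"
  using assms unfolding proj_sum_simps by fastforce+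

lemma top_map:
  assumes i: "i \<in> verts Q"
  shows "left_module A (simple_at i A)" "top_map i \<in> mod_hom A (proj_sum [i]) (simple_at i A)"
    "top_map i ` carrier (proj_sum [i]) = carrier (simple_at i A)"
proof -
  note M = left_moduleD[OF left_module_proj_sum[of "[i]"]]
  show h: "top_map i \<in> mod_hom A (proj_sum [i]) (simple_at i A)"
  proof (rule mod_homI)
    fix x y a assume x: "x \<in> carrier (proj_sum [i])"
    show "top_map i (x \<oplus>\<^bsub>proj_sum [i]\<^esub> y) = top_map i x \<oplus>\<^bsub>simple_at i A\<^esub> top_map i y" if "y \<in> carrier (proj_sum [i])"
      using x that M(4)[OF x that] by (simp add: top_map_def simple_at_simps proj_sum_simps(3))
    assume a: "a \<in> carrier A"
    \<comment> \<open>A further nonzero term would need a path from \<open>i\<close> to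
      \<open>m\<close> and another one back to \<open>i\<close>.\<close>
    have "coef a m i * x 0 m = (if m = i then coef a i i * x 0 i else 0)" for m
      using proj_sum_single(1)[OF x, of m] coef_nz[of a m i] reach_antisym[of m i] by auto
    then have "(\<Sum>m\<in>verts Q. coef a m i * x 0 m) = (\<Sum>m\<in>verts Q. if m = i then coef a i i * x 0 i else 0)"
      by (rule sum.cong[OF refl])
    then have "(\<Sum>m\<in>verts Q. coef a m i * x 0 m) = coef a i i * x 0 i" using i by simp
    then show "top_map i (a \<odot>\<^bsub>proj_sum [i]\<^esub> x) = a \<odot>\<^bsub>simple_at i A\<^esub> top_map i x"
      using x M(3)[OF a x] coef_diag[OF i, of a] by (simp add: top_map_def simple_at_simps proj_sum_simps(4))
  qed (auto simp: top_map_def simple_at_simps)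
  show s: "top_map i ` carrier (proj_sum [i]) = carrier (simple_at i A)"
  proof -
    have "c \<in> top_map i ` carrier (proj_sum [i])" for c :: 'k
    proof (rule image_eqI)
      show c: "(\<lambda>s u. if s = 0 \<and> u = i then c else 0) \<in> carrier (proj_sum [i])"
        using reach_refl[OF i] by (auto simp: proj_sum_simps)
      show "c = top_map i (\<lambda>s u. if s = 0 \<and> u = i then c else 0)" using c by (simp add: top_map_def)
    qed
    then show ?thesis by (auto simp: simple_at_simps)
  qed
  show "left_module A (simple_at i A)"
    by (rule left_module_image[OF left_module_proj_sum h s])
      (use M(5) in \<open>simp add: top_map_def simple_at_simps proj_sum_simps(2)\<close>)
qed

text \<open>A submodule that together with the radical gives everything contains an element
  \<open>u\<close> with coordinate 1 at \<open>i\<close>. As \<open>lift i\<close> reads only that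
  coordinate, \<open>u\<close> generates the whole module.\<close>

lemma projective_cover_single:
  assumes i: "i \<in> verts Q"
  shows "projective_cover A (proj_sum [i]) (top_map i) (simple_at i A)"
proof -
  have "U = carrier (proj_sum [i])"
    if U: "submodule U A (proj_sum [i])" and eq: "U <+>\<^bsub>proj_sum [i]\<^esub> a_kernel (proj_sum [i]) (simple_at i A) (top_map i) = carrier (proj_sum [i])" for U
  proof -
    interpret U: submodule U A "proj_sum [i]" by (fact U)
    have sub: "U \<subseteq> carrier (proj_sum [i])" using U.subset by simp
    have gc: "gen [i] 0 \<in> carrier (proj_sum [i])" using gen_closed[of 0 "[i]"] i by simp
    then have "gen [i] 0 \<in> U <+>\<^bsub>proj_sum [i]\<^esub> a_kernel (proj_sum [i]) (simple_at i A) (top_map i)"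
      by (simp only: eq)
    then obtain u k where uk: "u \<in> U" "k \<in> carrier (proj_sum [i])" "top_map i k = 0" "gen [i] 0 = u \<oplus>\<^bsub>proj_sum [i]\<^esub> k"
      by (auto simp: set_add_def' a_kernel_def' simple_at_simps)
    have "k 0 i = 0" using uk(2,3) by (simp add: top_map_def)
    then have u1: "u 0 i = 1" using fun_cong[OF fun_cong[OF uk(4)], of 0 i] by (simp add: gen_def proj_sum_simps(3))
    note uc = proj_sum_single[OF subsetD[OF sub uk(1)]]
    have "x \<in> U" if x: "x \<in> carrier (proj_sum [i])" for x
    proof -
      have "lift i (x 0) \<odot>\<^bsub>proj_sum [i]\<^esub> u = (\<lambda>s c. x 0 c * u s i)"
        using proj_sum_single(1)[OF x] by (rule lift_smult[OF i])
      also have "\<dots> = x"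
      proof (intro ext)
        fix s c
        show "x 0 c * u s i = x s c" using u1 uc(2)[of s i] proj_sum_single(2)[OF x, of s c] by (cases "s = 0") auto
      qed
      finally show ?thesis using U.smult_closed[OF lift_closed uk(1)] by metis
    qed
    then show ?thesis using sub by blast
  qed
  then show ?thesis
    using projective_proj_sum[of "[i]"] i top_map[OF i]
    by (auto simp: projective_cover_def fd_module_iff simple_at_simps)
qed

text \<open>The compatibility of \<open>\<alpha>\<close> with the projections to the top is kept
  because it later locates the image of a map from \<open>P_j\<close> in the radical of
  \<open>P_i\<close>.\<close>

lemma P_at:
  assumes i: "i \<in> verts Q"
  obtains \<pi> \<alpha> where "projective_cover A (P_at A i) \<pi> (simple_at i A)" "\<alpha> \<in> mod_iso A (P_at A i) (proj_sum [i])"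
    "\<And>x. x \<in> carrier (P_at A i) \<Longrightarrow> \<pi> x = top_map i (\<alpha> x)"
proof -
  note c = projective_cover_single[OF i] and S = top_map(1)[OF i]
  obtain P' :: "(('v, 'e) qpath \<Rightarrow> 'k, nat) module" and f where P': "left_module A P'" "f \<in> mod_iso A (proj_sum [i]) P'"
    by (rule transport_nat[OF left_module_proj_sum finite_proj_sum])
  have "\<exists>P \<pi>. projective_cover A (P :: (('v, 'e) qpath \<Rightarrow> 'k, nat) module) \<pi> (simple_at i A)"
    using cover_transport[OF c P'(2,1)] by blast
  from someI_ex[OF this] obtain \<pi> where p: "projective_cover A (P_at A i) \<pi> (simple_at i A)"
    unfolding P_at_def by blast
  obtain \<alpha> where "\<alpha> \<in> mod_iso A (P_at A i) (proj_sum [i])"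
    "\<And>x. x \<in> carrier (P_at A i) \<Longrightarrow> top_map i (\<alpha> x) = (\<lambda>x\<in>carrier (simple_at i A). x) (\<pi> x)"
    by (rule cover_unique[OF p c mod_iso_id[OF S]]) blast
  then show ?thesis using that[OF p] by (simp add: simple_at_simps)
qed

lemma mod_std_P_at:
  assumes "i \<in> verts Q"
  shows "mod_std (P_at A i) [i]"
proof -
  obtain \<pi> \<alpha> where "projective_cover A (P_at A i) \<pi> (simple_at i A)" "\<alpha> \<in> mod_iso A (P_at A i) (proj_sum [i])"
    using P_at[OF assms] by blast
  then show ?thesis using assms projectiveD by (auto simp: mod_std_def projective_cover_def)
qed

definition unit_mat :: "nat \<Rightarrow> nat \<Rightarrow> 'k \<Rightarrow> nat \<Rightarrow> nat \<Rightarrow> 'k" where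
  "unit_mat s0 t0 c = (\<lambda>s t. if s = s0 \<and> t = t0 then c else 0)"

lemma mats_single: "mats [j] [i] = (if reach i j then range (unit_mat 0 0) else {zero_mat})"
proof -
  have "g = unit_mat 0 0 (g 0 0)" if "g \<in> mats [j] [i]" for g
    using that unfolding mats_def unit_mat_def by (auto simp: fun_eq_iff)
  moreover have "unit_mat 0 0 c \<in> mats [j] [i]" if "reach i j" for c
    using that by (auto simp: mats_def unit_mat_def)
  moreover have "g = zero_mat" if "g \<in> mats [j] [i]" "\<not> reach i j" for g
  proof (intro ext)
    fix s t
    have "g s t \<noteq> 0 \<Longrightarrow> s = 0 \<and> t = 0 \<and> reach i j" using that(1) unfolding mats_def by fastforce
    then show "g s t = zero_mat s t" using that(2) by (auto simp: zero_mat_def)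
  qed
  ultimately show ?thesis using mats_zero_mat by auto
qed

text \<open>Every nonzero map \<open>P_j -> P_i\<close> is a 1 by 1 matrix with entry
  \<open>c\<close>. It is injective, and its image lies in the radical, so it is the minimal
  projective resolution of its cokernel. The value of \<open>c\<close> depends on the choices in
  \<open>M_at\<close> and \<open>P_at\<close> and is therefore only known to be nonzero.\<close>

lemma M_at_std:
  assumes i: "i \<in> verts Q" and j: "j \<in> verts Q" and ne: "i \<noteq> j" and r: "reach i j"
  shows "\<exists>c. c \<noteq> 0 \<and> is_std (C_cyc A (M_at A i j)) ([i] @ [j]) (block 1 zero_mat (unit_mat 0 0 c) zero_mat)"
proof -
  let ?P = "P_at A i" and ?O = "P_at A j"
  obtain \<pi> \<alpha> where p: "projective_cover A ?P \<pi> (simple_at i A)" and a: "\<alpha> \<in> mod_iso A ?P (proj_sum [i])"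
    and pa: "\<And>x. x \<in> carrier ?P \<Longrightarrow> \<pi> x = top_map i (\<alpha> x)"
    using P_at[OF i] by blast
  obtain \<beta> where b: "\<beta> \<in> mod_iso A ?O (proj_sum [j])"
    using P_at[OF j] by blast
  have MP: "mod_std ?P [i]" and MO: "mod_std ?O [j]" using mod_std_P_at i j by auto
  have P: "left_module A ?P" "finite (carrier ?P)" and O: "left_module A ?O" "finite (carrier ?O)"
    using MP MO by (auto simp: mod_std_def)
  have PO: "projective A ?O" using mod_std_projective[OF MO] .
  note A1 = mod_isoD[OF a] and B1 = mod_isoD[OF b] and AI = mod_isoD[OF mod_iso_inv[OF a P(1)]]
    and BI = mod_isoD[OF mod_iso_inv[OF b O(1)]]
  \<comment> \<open>The matrix with entry 1 shows that the map chosen in \<open>M_at\<close> is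
    indeed nonzero.\<close>
  have nonzero: "\<exists>f. f \<in> mod_hom A ?O ?P \<and> (\<exists>x\<in>carrier ?O. f x \<noteq> \<zero>\<^bsub>?P\<^esub>)"
  proof -
    let ?g = "unit_mat 0 0 1"
    have g: "?g \<in> mats [j] [i]" using r by (simp add: mats_single)
    define f where "f = compose (carrier ?O) (inv_hom ?P (proj_sum [i]) \<alpha>) (compose (carrier ?O) (mat_hom [j] ?g) \<beta>)"
    have "f \<in> mod_hom A ?O ?P" unfolding f_def
      by (intro mod_hom_compose[OF mod_hom_compose[OF B1(1) mat_hom_hom[OF g] O(1)] AI(1) O(1)])
    moreover have "\<exists>x\<in>carrier ?O. f x \<noteq> \<zero>\<^bsub>?P\<^esub>"
    proof -
      have gc: "gen [j] 0 \<in> carrier (proj_sum [j])" using gen_closed[of 0 "[j]"] j by simp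
      obtain x where x: "x \<in> carrier ?O" "\<beta> x = gen [j] 0" using gc B1(4) by (metis imageE)
      have "mat_hom [j] ?g (gen [j] 0) 0 j = 1" using mat_hom_gen[of 0 "[j]" ?g 0] j by (simp add: unit_mat_def)
      then have "mat_hom [j] ?g (gen [j] 0) \<noteq> \<zero>\<^bsub>proj_sum [i]\<^esub>" unfolding proj_sum_simps(2) by (metis zero_neq_one)
      moreover have "\<alpha> (f x) = mat_hom [j] ?g (gen [j] 0)"
        using x inv_hom(2)[OF a] mod_homD(2)[OF mat_hom_hom[OF g] gc] by (simp add: f_def compose_def)
      ultimately show ?thesis using x(1) mod_hom_zero[OF P(1) left_module_proj_sum A1(1)] by metis
    qed
    ultimately show ?thesis by blast
  qed
  define f where "f = (SOME f. f \<in> mod_hom A ?O ?P \<and> (\<exists>x\<in>carrier ?O. f x \<noteq> \<zero>\<^bsub>?P\<^esub>))"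
  have f: "f \<in> mod_hom A ?O ?P" and nz: "\<exists>x\<in>carrier ?O. f x \<noteq> \<zero>\<^bsub>?P\<^esub>"
    using someI_ex[OF nonzero] unfolding f_def by auto
  have M: "M_at A i j = quot_module ?P (f ` carrier ?O)" unfolding M_at_def coker_def f_def ..
  have "compose (carrier (proj_sum [j])) \<alpha> (compose (carrier (proj_sum [j])) f (inv_hom ?O (proj_sum [j]) \<beta>)) \<in> mod_hom A (proj_sum [j]) (proj_sum [i])"
    by (intro mod_hom_compose[OF mod_hom_compose[OF BI(1) f left_module_proj_sum] A1(1) left_module_proj_sum])
  then obtain g where g: "g \<in> mats [j] [i]"
    "compose (carrier (proj_sum [j])) \<alpha> (compose (carrier (proj_sum [j])) f (inv_hom ?O (proj_sum [j]) \<beta>)) = mat_hom [j] g"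
    using mat_hom_surj[of _ "[j]" "[i]"] j by (metis empty_set empty_subsetI insert_subset list.simps(15))
  have fg: "\<alpha> (f y) = mat_hom [j] g (\<beta> y)" if "y \<in> carrier ?O" for y
    using fun_cong[OF g(2), of "\<beta> y"] inv_hom(1)[OF b that] mod_homD(2)[OF B1(1) that] by (simp add: compose_def)
  obtain c where c: "g = unit_mat 0 0 c" using g(1) r by (auto simp: mats_single)
  have Phig: "mat_hom [j] g x = (\<lambda>s u. if s = 0 then c * x 0 u else 0)" if "x \<in> carrier (proj_sum [j])" for x
    using that by (auto simp: mat_hom_def c unit_mat_def fun_eq_iff)
  have c0: "c \<noteq> 0"
  proof
    assume "c = 0"
    obtain x where x: "x \<in> carrier ?O" "f x \<noteq> \<zero>\<^bsub>?P\<^esub>" using nz by blast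
    have "\<alpha> (f x) = \<zero>\<^bsub>proj_sum [i]\<^esub>"
      using fg[OF x(1)] Phig[OF mod_homD(2)[OF B1(1) x(1)]] \<open>c = 0\<close> by (simp add: proj_sum_simps(2) fun_eq_iff)
    then show False
      using x inj_onD[OF A1(3), of "f x" "\<zero>\<^bsub>?P\<^esub>"] mod_hom_zero[OF P(1) left_module_proj_sum A1(1)]
        mod_homD(2)[OF f x(1)] left_moduleD(5)[OF P(1)] by simp
  qed
  have inj: "inj_on f (carrier ?O)"
  proof (rule inj_onI)
    fix x y assume xy: "x \<in> carrier ?O" "y \<in> carrier ?O" "f x = f y"
    have b': "\<beta> x \<in> carrier (proj_sum [j])" "\<beta> y \<in> carrier (proj_sum [j])" using xy mod_homD(2)[OF B1(1)] by auto
    have "mat_hom [j] g (\<beta> x) = mat_hom [j] g (\<beta> y)" using fg[OF xy(1)] fg[OF xy(2)] xy(3) by simp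
    then have "c * \<beta> x 0 u = c * \<beta> y 0 u" for u
      unfolding Phig[OF b'(1)] Phig[OF b'(2)] by (metis (full_types))
    then have "\<beta> x t u = \<beta> y t u" for t u
      using c0 proj_sum_single(2)[OF b'(1), of t u] proj_sum_single(2)[OF b'(2), of t u] by (cases "t = 0") auto
    then have "\<beta> x = \<beta> y" by (intro ext)
    then show "x = y" using inj_onD[OF B1(3)] xy by blast
  qed
  \<comment> \<open>As \<open>j\<close> does not reach \<open>i\<close>, elements of
    \<open>P_j\<close> have no coordinate at \<open>i\<close>; their images lie in the radical of
    \<open>P_i\<close>.\<close>
  have ker: "f ` carrier ?O \<subseteq> a_kernel ?P (simple_at i A) \<pi>"
  proof
    fix z assume "z \<in> f ` carrier ?O"
    then obtain y where y: "y \<in> carrier ?O" "z = f y" by blast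
    have b': "\<beta> y \<in> carrier (proj_sum [j])" using mod_homD(2)[OF B1(1) y(1)] .
    have "\<beta> y 0 i = 0" using proj_sum_single(1)[OF b', of i] reach_antisym r ne by blast
    then have "\<pi> z = 0"
      using pa[OF mod_homD(2)[OF f y(1)]] fg[OF y(1)] Phig[OF b'] y(2)
        mod_homD(2)[OF mat_hom_hom[OF g(1)] b'] by (simp add: top_map_def)
    then show "z \<in> a_kernel ?P (simple_at i A) \<pi>"
      using mod_homD(2)[OF f y(1)] y(2) by (simp add: a_kernel_def' simple_at_simps)
  qed
  have sub: "submodule (f ` carrier ?O) A ?P" by (rule submodule_image[OF O(1) P(1) f submodule_carrier[OF O(1)]])
  define pr where "pr = (\<lambda>x\<in>carrier ?P. f ` carrier ?O +>\<^bsub>?P\<^esub> x)"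
  note quot = quot_module[OF P(1) sub, folded pr_def M]
  have "U = carrier ?P" if U: "submodule U A ?P" "U <+>\<^bsub>?P\<^esub> f ` carrier ?O = carrier ?P" for U
  proof -
    interpret U: submodule U A ?P by (fact U(1))
    have "U <+>\<^bsub>?P\<^esub> a_kernel ?P (simple_at i A) \<pi> = carrier ?P"
    proof
      show "U <+>\<^bsub>?P\<^esub> a_kernel ?P (simple_at i A) \<pi> \<subseteq> carrier ?P"
        using U.subset left_moduleD(4)[OF P(1)] by (auto simp: set_add_def' a_kernel_def' subset_iff)
      show "carrier ?P \<subseteq> U <+>\<^bsub>?P\<^esub> a_kernel ?P (simple_at i A) \<pi>"
        unfolding U(2)[symmetric] using ker by (auto simp: set_add_def')
    qed
    then show ?thesis using p U(1) by (simp add: projective_cover_def)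
  qed
  then have "projective_cover A ?P pr (M_at A i j)"
    unfolding projective_cover_def fd_module_iff quot(4)
    using quot(1-3) mod_std_projective[OF MP] finite_imageI[OF P(2), of pr] by simp
  then have res: "minimal_projective_resolution A ?O f ?P pr (M_at A i j)"
    using PO f inj quot by (auto simp: minimal_projective_resolution_def short_exact_def)
  note C = C_cyc_equiv[OF res quot(1) mod_iso_id[OF quot(1)]]
  have u: "is_std (upper_cyc ?P ?O f) ([i] @ [j]) (block (length [i]) zero_mat g zero_mat)"
    by (rule is_std_upper[OF MP MO f a b g(1) fg])
  have "cyc_equiv A (C_cyc A (M_at A i j)) (std ([i] @ [j]) (block (length [i]) zero_mat g zero_mat))"
    by (rule cyc_equiv_trans[OF C(1) _ C(2)]) (use u in \<open>simp add: is_std_def\<close>)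
  then have "is_std (C_cyc A (M_at A i j)) ([i] @ [j]) (block 1 zero_mat g zero_mat)"
    using u C(2) by (simp add: is_std_def)
  then show ?thesis using c c0 by blast
qed

section \<open>Products of matrices\<close>

lemma is_std_C1:
  assumes "is_std X v D" "mat_mult (length v) D D = zero_mat"
  shows "X \<in> C1_proj A" "std v D \<in> C1_proj A" "hall_basis A X = hall_basis A (std v D)"
proof -
  have D: "D \<in> mats v v" "set v \<subseteq> verts Q" and X: "pre_cyc A X" "cyc_equiv A X (std v D)"
    using assms by (auto simp: is_std_def)
  show s: "std v D \<in> C1_proj A" using std_C1_iff[OF D] assms(2) by simp
  note e = cyc_equiv_sym[OF X(2,1)]
  show c: "X \<in> C1_proj A" by (rule C1_proj_equiv[OF s e X(1)])
  show "hall_basis A X = hall_basis A (std v D)"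
    by (rule hall_basis_cong[OF c pre_cyc_std[OF D(1)] X(2)])
qed

lemma std_equiv_basis:
  assumes "D \<in> mats v v" "E \<in> mats w w" "set v \<subseteq> verts Q" "set w \<subseteq> verts Q"
    "mat_mult (length v) D D = zero_mat" "mat_isos v D w E \<noteq> {}"
  shows "hall_basis A (std v D) = hall_basis A (std w E)"
  using hall_basis_cong[of "std v D" "std w E"] assms std_C1_iff[of D v] pre_cyc_std[of E w] cyc_equiv_std[of D v E w]
  by auto

abbreviation std_basis :: "'v list \<Rightarrow> (nat \<Rightarrow> nat \<Rightarrow> 'k) \<Rightarrow> (('v, 'e) qpath \<Rightarrow> 'k, nat) cyc set \<Rightarrow> complex" where
  "std_basis v D \<equiv> hall_basis A (std v D)"

text \<open>\<open>hall_product\<close> in terms of matrices. The sets \<open>H i\<close> are only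
  required to lead to the \<open>i\<close>-th middle term and to cover all entries of square zero;
  since the middle terms are pairwise non-isomorphic, each \<open>H i\<close> is then the full
  fibre.\<close>

lemma std_product:
  fixes z :: "'i \<Rightarrow> 'v list" and F :: "'i \<Rightarrow> nat \<Rightarrow> nat \<Rightarrow> 'k" and H :: "'i \<Rightarrow> (nat \<Rightarrow> nat \<Rightarrow> 'k) set"
  assumes D: "D \<in> mats v v" and E: "E \<in> mats w w" and v: "set v \<subseteq> verts Q" and w: "set w \<subseteq> verts Q"
    and sq: "mat_mult (length v) D D = zero_mat" "mat_mult (length w) E E = zero_mat" and I: "finite I"
    and F: "\<And>i. i \<in> I \<Longrightarrow> F i \<in> mats (z i) (z i)" "\<And>i. i \<in> I \<Longrightarrow> set (z i) \<subseteq> verts Q"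
      "\<And>i. i \<in> I \<Longrightarrow> mat_mult (length (z i)) (F i) (F i) = zero_mat"
    and disj: "\<And>i j. i \<in> I \<Longrightarrow> j \<in> I \<Longrightarrow> mat_isos (z i) (F i) (z j) (F j) \<noteq> {} \<Longrightarrow> i = j"
    and cover: "\<And>h. h \<in> mats v w \<Longrightarrow>
      mat_mult (length w + length v) (block (length w) E h D) (block (length w) E h D) = zero_mat \<Longrightarrow> \<exists>i\<in>I. h \<in> H i"
    and H: "\<And>i. i \<in> I \<Longrightarrow> H i \<subseteq> mats v w"
      "\<And>i h. i \<in> I \<Longrightarrow> h \<in> H i \<Longrightarrow> mat_isos (w @ v) (block (length w) E h D) (z i) (F i) \<noteq> {}"
    and coeff: "\<And>i. i \<in> I \<Longrightarrow>
      r i * (of_nat (card (mats v w)) * of_nat (card (mat_isos v D v D)) * of_nat (card (mat_isos w E w E))) =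
      of_nat (card (H i)) * of_nat (card (mat_isos (z i) (F i) (z i) (F i)))"
  shows "std_basis v D \<otimes>\<^bsub>hall_algebra A\<^esub> std_basis w E = (\<lambda>c. \<Sum>i\<in>I. r i * std_basis (z i) (F i) c)"
proof (rule hall_product[OF _ _ I])
  note pX = pre_cyc_std[OF D] and pY = pre_cyc_std[OF E]
  show "std v D \<in> C1_proj A" "std w E \<in> C1_proj A" using std_C1_iff D E v w sq by auto
  show Z: "std (z i) (F i) \<in> C1_proj A" if "i \<in> I" for i using std_C1_iff F that by auto
  have disj': "i = j" if "i \<in> I" "j \<in> I" "cyc_equiv A (std (z i) (F i)) (std (z j) (F j))" for i j
    using disj[OF that(1,2)] cyc_equiv_std[of "F i" "z i" "F j" "z j"] F that by auto
  then show "i = j" if "i \<in> I" "j \<in> I" "cyc_equiv A (std (z i) (F i)) (std (z j) (F j))" for i j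
    using that .
  let ?X = "\<lambda>h. ext_cyc (std w E) (std v D) (mat_hom v h)" and ?b = "\<lambda>h. block (length w) E h D"
  have pe: "pre_cyc A (?X h)" if "h \<in> mats v w" for h
    using pre_cyc_ext[OF pX pY] mat_hom_hom[OF that] by (simp add: std_def)
  have bm: "?b h \<in> mats (w @ v) (w @ v)" if "h \<in> mats v w" for h using block_mats[OF E D that] .
  have wv: "set (w @ v) \<subseteq> verts Q" using v w by simp
  have eH: "cyc_equiv A (?X h) (std (z i) (F i))" if i: "i \<in> I" and h: "h \<in> H i" for i h
  proof -
    have hm: "h \<in> mats v w" using H(1)[OF i] h by blast
    have "cyc_equiv A (std (w @ v) (?b h)) (std (z i) (F i))"
      using cyc_equiv_std[OF bm[OF hm] F(1)[OF i] wv F(2)[OF i]] H(2)[OF i h] by simp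
    then show ?thesis by (rule cyc_equiv_trans[OF ext_std[OF E D hm] _ pe[OF hm]])
  qed
  \<comment> \<open>Square zero is carried back from the complex \<open>W\<close> to the block
    matrix along the isomorphism.\<close>
  have sqz: "mat_mult (length w + length v) (?b h) (?b h) = zero_mat"
    if h: "h \<in> mats v w" and W: "W \<in> C1_proj A" "cyc_equiv A (?X h) W" for h and W :: "(_, 'm) cyc"
  proof -
    have "cyc_equiv A (std (w @ v) (?b h)) W"
      by (rule cyc_equiv_trans[OF cyc_equiv_sym[OF ext_std[OF E D h] pe[OF h]] W(2) pre_cyc_std[OF bm[OF h]]])
    then have "std (w @ v) (?b h) \<in> C1_proj A"
      using C1_proj_equiv[OF W(1) cyc_equiv_sym] pre_cyc_std[OF bm[OF h]] by blast
    then show ?thesis using std_C1_iff[OF bm[OF h] wv] by simp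
  qed
  have hom: "mod_hom A (fst (std v D)) (fst (std w E)) = mat_hom v ` mats v w"
    using mod_hom_proj_sum[OF v] by (simp add: std_def)
  show "\<exists>i\<in>I. cyc_equiv A (ext_cyc (std w E) (std v D) h) (std (z i) (F i))"
    if hh: "h \<in> mod_hom A (fst (std v D)) (fst (std w E))" and W: "W \<in> C1_proj A" "cyc_equiv A (ext_cyc (std w E) (std v D) h) W"
    for h and W :: "(('v, 'e) qpath \<Rightarrow> 'k, nat) cyc"
  proof -
    obtain g where g: "g \<in> mats v w" "h = mat_hom v g" using hh unfolding hom by blast
    obtain i where "i \<in> I" "g \<in> H i" using cover[OF g(1) sqz[OF g(1) W[unfolded g(2)]]] by blast
    then show ?thesis using eH g(2) by blast
  qed
  fix i assume i: "i \<in> I"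
  have "{h \<in> mat_hom v ` mats v w. cyc_equiv A (ext_cyc (std w E) (std v D) h) (std (z i) (F i))} = mat_hom v ` H i"
  proof (intro equalityI subsetI)
    fix h assume "h \<in> {h \<in> mat_hom v ` mats v w. cyc_equiv A (ext_cyc (std w E) (std v D) h) (std (z i) (F i))}"
    then obtain g where g: "g \<in> mats v w" "h = mat_hom v g" "cyc_equiv A (?X g) (std (z i) (F i))" by blast
    \<comment> \<open>An entry in the fibre over \<open>i\<close> lies in some \<open>H k\<close>;
      non-isomorphic middle terms leave only \<open>k = i\<close>.\<close>
    obtain k where k: "k \<in> I" "g \<in> H k" using cover[OF g(1) sqz[OF g(1) Z[OF i] g(3)]] by blast
    have "cyc_equiv A (std (z k) (F k)) (std (z i) (F i))"
      by (rule cyc_equiv_trans[OF cyc_equiv_sym[OF eH[OF k] pe[OF g(1)]] g(3) pre_cyc_std[OF F(1)[OF k(1)]]])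
    then have "k = i" using disj'[OF k(1) i] by simp
    then show "h \<in> mat_hom v ` H i" using k g by blast
  next
    fix h assume "h \<in> mat_hom v ` H i"
    then show "h \<in> {h \<in> mat_hom v ` mats v w. cyc_equiv A (ext_cyc (std w E) (std v D) h) (std (z i) (F i))}"
      using eH[OF i] H(1)[OF i] by blast
  qed
  then have "card {h \<in> mat_hom v ` mats v w. cyc_equiv A (ext_cyc (std w E) (std v D) h) (std (z i) (F i))} = card (H i)"
    using card_image[OF inj_on_subset[OF inj_mat_hom[OF v] H(1)[OF i]]] by simp
  moreover have "card (mat_hom v ` mats v w) = card (mats v w)" by (rule card_image[OF inj_mat_hom[OF v]])
  ultimately show "r i * (of_nat (card (mod_hom A (fst (std v D)) (fst (std w E)))) *
      of_nat (card (cyc_iso A (std v D) (std v D))) * of_nat (card (cyc_iso A (std w E) (std w E)))) =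
    of_nat (card {h \<in> mod_hom A (fst (std v D)) (fst (std w E)). cyc_equiv A (ext_cyc (std w E) (std v D) h) (std (z i) (F i))} *
      card (cyc_iso A (std (z i) (F i)) (std (z i) (F i))))"
    unfolding hom using coeff[OF i] card_cyc_iso_std[OF D D v v] card_cyc_iso_std[OF E E w w]
      card_cyc_iso_std[OF F(1)[OF i] F(1)[OF i] F(2)[OF i] F(2)[OF i]] by simp
qed

end

text \<open>Explicit matrices on which simplification can compute. Extension by zero forgets the
  format, which is why equality of matrices is reduced to equality of lists for equal row lengths
  only.\<close>

definition mx :: "'a::zero list list \<Rightarrow> nat \<Rightarrow> nat \<Rightarrow> 'a" where
  "mx R s t = (if s < length R \<and> t < length (R ! s) then R ! s ! t else 0)"

lemma mx_eq_iff:
  assumes "map length R = map length S"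
  shows "mx R = mx S \<longleftrightarrow> R = S"
proof
  assume eq: "mx R = mx S"
  have l: "length R = length S" using assms map_eq_imp_length_eq by blast
  have ls: "length (R ! s) = length (S ! s)" if "s < length R" for s
    using arg_cong[OF assms, of "\<lambda>x. x ! s"] that l by simp
  show "R = S"
  proof (intro nth_equalityI l ls)
    fix s t assume "s < length R" "t < length (R ! s)"
    then show "R ! s ! t = S ! s ! t"
      using fun_cong[OF fun_cong[OF eq, of s], of t] l ls[of s] by (simp add: mx_def)
  qed
qed simp

context thin_algebra
begin

lemma mats_mx:
  assumes "g \<in> mats v w"
  shows "g = mx (map (\<lambda>s. map (g s) [0..<length v]) [0..<length w])"
proof (intro ext)
  fix s t
  have "g s t \<noteq> 0 \<Longrightarrow> s < length w \<and> t < length v" using assms by (auto simp: mats_def)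
  then show "g s t = mx (map (\<lambda>s. map (g s) [0..<length v]) [0..<length w]) s t"
    by (auto simp: mx_def)
qed

lemma mx_mats_iff: "mx R \<in> mats v w \<longleftrightarrow> (\<forall>s<length R. \<forall>t<length (R ! s).
    R ! s ! t \<noteq> 0 \<longrightarrow> s < length w \<and> t < length v \<and> reach (w ! s) (v ! t))"
  unfolding mats_def mx_def by auto

text \<open>The right factor is split into its first row and the rest so that its width can be read
  off as \<open>length row\<close>.\<close>

lemma mat_mult_mx:
  assumes "n = length (row # S)" "\<forall>r\<in>set R. length r = n" "\<forall>r\<in>set S. length r = length row"
  shows "mat_mult n (mx R) (mx (row # S)) =
    mx (map (\<lambda>r. map (\<lambda>t. \<Sum>k<n. r ! k * (row # S) ! k ! t) [0..<length row]) R)" (is "_ = mx ?T")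
proof (intro ext)
  fix s t
  have l: "length ((row # S) ! k) = length row" if "k < n" for k
    using assms(1,3) that by (cases k) auto
  show "mat_mult n (mx R) (mx (row # S)) s t = mx ?T s t"
  proof (cases "s < length R \<and> t < length row")
    case True
    then have "length (R ! s) = n" using assms(2) by simp
    then show ?thesis using True l assms(1) by (auto simp: mat_mult_def mx_def intro!: sum.cong)
  next
    case False
    have "mx R s k * mx (row # S) k t = 0" if "k < n" for k
      using False l[OF that] that assms(1) by (auto simp: mx_def)
    then show ?thesis using False by (auto simp: mat_mult_def mx_def intro!: sum.neutral)
  qed
qed

lemma id_mat_mx: "id_mat n = mx (map (\<lambda>s. map (\<lambda>t. if s = t then 1 else 0) [0..<n]) [0..<n])"
  by (auto simp: id_mat_def mx_def fun_eq_iff)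

lemma zero_mat_mx: "mx R = zero_mat \<longleftrightarrow> (\<forall>r\<in>set R. \<forall>c\<in>set r. c = 0)"
proof
  assume eq: "mx R = zero_mat"
  show "\<forall>r\<in>set R. \<forall>c\<in>set r. c = 0"
  proof (intro ballI)
    fix r c assume "r \<in> set R" "c \<in> set r"
    then obtain s t where "s < length R" "r = R ! s" "t < length r" "c = r ! t" by (metis in_set_conv_nth)
    then show "c = 0" using fun_cong[OF fun_cong[OF eq, of s], of t] by (simp add: mx_def zero_mat_def)
  qed
next
  assume z: "\<forall>r\<in>set R. \<forall>c\<in>set r. c = 0"
  then have "R ! s ! t = 0" if "s < length R" "t < length (R ! s)" for s t using that by (metis nth_mem)
  then show "mx R = zero_mat" by (auto simp: mx_def zero_mat_def fun_eq_iff)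
qed

lemma nat_cases3:
  obtains "s = 0" | "s = Suc 0" | "s = Suc (Suc 0)" | k where "s = Suc (Suc (Suc k))"
  by (metis nat.exhaust)

lemma block_mx:
  "block (Suc 0) (mx [[a]]) (mx [[b]]) (mx [[d]]) = mx [[a, b], [0, d]]"
  "block (Suc 0) (mx [[a]]) (mx [[b, c]]) (mx [[e, f], [h, k]]) = mx [[a, b, c], [0, e, f], [0, h, k]]"
  "block (Suc (Suc 0)) (mx [[a, b], [d, e]]) (mx [[c], [f]]) (mx [[k]]) = mx [[a, b, c], [d, e, f], [0, 0, k]]"
  by (intro ext, rename_tac s t, rule_tac s = s in nat_cases3; rule_tac s = t in nat_cases3;
      simp add: block_def mx_def)+

lemmas mx_simps = mx_mats_iff All_less_Suc mat_mult_mx mx_eq_iff id_mat_mx zero_mat_mx lessThan_Suc mat_isos_def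

lemma invertibleI:
  assumes "mx S \<in> mats w v" "mat_mult (length w) (mx S) g = id_mat (length v)" "mat_mult (length v) g (mx S) = id_mat (length w)"
  shows "invertible v w g"
  using assms by (auto simp: invertible_def)

lemma invertibleE:
  assumes "invertible v w g"
  obtains S where "S \<in> mats w v" "mat_mult (length w) S g = id_mat (length v)" "mat_mult (length v) g S = id_mat (length w)"
    "S = mx (map (\<lambda>s. map (S s) [0..<length w]) [0..<length v])"
  using assms mats_mx by (auto simp: invertible_def)

text \<open>Multiplicativity of the determinant: the assumptions say that a product of two 2 by 2
  matrices is the identity.\<close>

lemma det2_nonzero:
  fixes a b c d :: 'k
  assumes "a * a' + b * c' = 1" "a * b' + b * d' = 0" "c * a' + d * c' = 0" "c * b' + d * d' = 1"
  shows "a * d - b * c \<noteq> 0"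
proof
  assume "a * d - b * c = 0"
  have "(a * d - b * c) * (a' * d' - b' * c') =
    (a * a' + b * c') * (c * b' + d * d') - (a * b' + b * d') * (c * a' + d * c')"
    by (simp add: algebra_simps)
  then show False using assms \<open>a * d - b * c = 0\<close> by simp
qed

section \<open>Parameter sets for automorphism groups and their sizes\<close>

definition nonzeros :: "'k set" where "nonzeros = {x. x \<noteq> 0}"

definition gl2 :: "('k \<times> 'k \<times> 'k \<times> 'k) set" where
  "gl2 = {(a, b, c, d). a * d - b * c \<noteq> 0}"

lemma card_U: "card (nonzeros :: 'k set) = CARD('k) - 1"
proof -
  have "(nonzeros :: 'k set) = UNIV - {0}" by (auto simp: nonzeros_def)
  moreover have "card (UNIV - {0 :: 'k}) = CARD('k) - 1" by (rule card_Diff_singleton) simp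
  ultimately show ?thesis by (simp only:)
qed

lemma card_k_gt_1: "1 < CARD('k)"
proof -
  have "card {0, 1 :: 'k} \<le> CARD('k)" by (rule card_mono) auto
  then show ?thesis by simp
qed

text \<open>The first row is any nonzero vector \<open>p\<close>, and the second row any vector off
  the line spanned by \<open>p\<close>, which has \<open>CARD('k)\<close> points.\<close>

lemma card_GL: "card (gl2 :: ('k \<times> 'k \<times> 'k \<times> 'k) set) = (CARD('k) * CARD('k) - 1) * (CARD('k) * CARD('k) - CARD('k))"
proof -
  let ?A = "UNIV - {(0, 0)} :: ('k \<times> 'k) set"
  let ?N = "\<lambda>p. UNIV - {r :: 'k \<times> 'k. fst p * snd r = snd p * fst r}"
  have c: "card (?N p) = CARD('k) * CARD('k) - CARD('k)" if "p \<in> ?A" for p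
  proof -
    obtain a b where p: "p = (a, b)" by (cases p)
    have "card {r :: 'k \<times> 'k. fst p * snd r = snd p * fst r} = CARD('k)"
    proof (cases "a = 0")
      case True
      then have b: "b \<noteq> 0" using that p by auto
      have "{r :: 'k \<times> 'k. fst p * snd r = snd p * fst r} = (\<lambda>d. (0, d)) ` UNIV" using True b p by auto
      then show ?thesis by (simp add: card_image inj_on_def)
    next
      case False
      have "{r :: 'k \<times> 'k. fst p * snd r = snd p * fst r} = (\<lambda>c. (c, b * c / a)) ` UNIV"
        using False p by (auto simp: field_simps)
      then show ?thesis by (simp add: card_image inj_on_def)
    qed
    then show ?thesis by (simp add: card_Diff_subset card_prod del: UNIV_Times_UNIV)
  qed
  have "(gl2 :: ('k \<times> 'k \<times> 'k \<times> 'k) set) = (\<lambda>(p, r). (fst p, snd p, fst r, snd r)) ` (SIGMA p:?A. ?N p)"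
    by (force simp: gl2_def image_iff)
  then have "card (gl2 :: ('k \<times> 'k \<times> 'k \<times> 'k) set) = card ((\<lambda>(p, r). (fst p, snd p, fst r, snd r)) ` (SIGMA p:?A. ?N p))"
    by (rule arg_cong)
  also have "\<dots> = card (SIGMA p:?A. ?N p)"
    by (rule card_image) (auto simp: inj_on_def prod_eq_iff)
  also have "\<dots> = (\<Sum>p\<in>?A. card (?N p))" by (rule card_SigmaI) auto
  also have "\<dots> = card ?A * (CARD('k) * CARD('k) - CARD('k))" using c by simp
  also have "card ?A = CARD('k) * CARD('k) - 1" by (simp add: card_Diff_singleton card_prod)
  finally show ?thesis .
qed

text \<open>A conjugate of the zero matrix is zero, while \<open>z\<close> says that exactly one of
  the two differentials vanishes.\<close>

lemma mat_isos_zero: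
  assumes D: "D \<in> mats v v" and E: "E \<in> mats w w" and v: "set v \<subseteq> verts Q" and w: "set w \<subseteq> verts Q"
    and z: "D = zero_mat \<longleftrightarrow> E \<noteq> zero_mat"
  shows "mat_isos v D w E = {}"
proof (rule ccontr)
  assume "mat_isos v D w E \<noteq> {}"
  then obtain g where g: "g \<in> mats v w" "invertible v w g" "mat_mult (length v) g D = mat_mult (length w) E g" by (auto simp: mat_isos_def)
  obtain g' where g': "g' \<in> mats w v" "mat_mult (length w) g' g = id_mat (length v)" "mat_mult (length v) g g' = id_mat (length w)"
    using g(2) by (auto simp: invertible_def)
  have assoc: "mat_mult n (mat_mult m a b) c = mat_mult m a (mat_mult n b c)" for n m a b c
  proof (intro ext)
    fix s t
    have "(\<Sum>r<n. \<Sum>l<m. a s l * b l r * c r t) = (\<Sum>l<m. \<Sum>r<n. a s l * b l r * c r t)" by (rule sum.swap)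
    then show "mat_mult n (mat_mult m a b) c s t = mat_mult m a (mat_mult n b c) s t"
      by (simp add: mat_mult_def sum_distrib_left sum_distrib_right mult.assoc)
  qed
  have zl: "mat_mult n zero_mat a = zero_mat" "mat_mult n a zero_mat = zero_mat" for n a by (auto simp: mat_mult_def zero_mat_def)
  have idl: "mat_mult (length u) (id_mat (length u)) a = a" "mat_mult (length u) a (id_mat (length u)) = a" if "a \<in> mats u u" for a u
  proof -
    have a: "a s t \<noteq> 0 \<Longrightarrow> s < length u \<and> t < length u" for s t using that by (auto simp: mats_def)
    have "(\<Sum>r<length u. id_mat (length u) s r * a r t) = (\<Sum>r<length u. if r = s then a s t else 0)" for s t
      by (rule sum.cong) (auto simp: id_mat_def)
    then show "mat_mult (length u) (id_mat (length u)) a = a" using a by (auto simp: mat_mult_def fun_eq_iff)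
    have "(\<Sum>r<length u. a s r * id_mat (length u) r t) = (\<Sum>r<length u. if r = t then a s t else 0)" for s t
      by (rule sum.cong) (auto simp: id_mat_def)
    then show "mat_mult (length u) a (id_mat (length u)) = a" using a by (auto simp: mat_mult_def fun_eq_iff)
  qed
  show False
  proof (cases "D = zero_mat")
    case True
    then have "mat_mult (length w) E g = zero_mat" using g(3) zl by simp
    then have "mat_mult (length v) (mat_mult (length w) E g) g' = zero_mat" using zl by simp
    then have "E = zero_mat" using assoc g'(3) idl(2)[OF E] by simp
    then show False using z True by simp
  next
    case False
    then have "mat_mult (length v) g D = zero_mat" using g(3) z zl by simp
    then have "mat_mult (length w) g' (mat_mult (length v) g D) = zero_mat" using zl by simp
    then have "D = zero_mat" using assoc[symmetric] g'(2) idl(1)[OF D] by simp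
    then show False using False by simp
  qed
qed

end

context thin_algebra
begin

section \<open>Automorphisms\<close>

abbreviation O2 :: "nat \<Rightarrow> nat \<Rightarrow> 'k" where "O2 \<equiv> mx [[0, 0], [0, 0]]"

abbreviation O3 :: "nat \<Rightarrow> nat \<Rightarrow> 'k" where "O3 \<equiv> mx [[0, 0, 0], [0, 0, 0], [0, 0, 0]]"

abbreviation N2 :: "nat \<Rightarrow> nat \<Rightarrow> 'k" where "N2 \<equiv> mx [[0, 1], [0, 0]]"

abbreviation E12 :: "nat \<Rightarrow> nat \<Rightarrow> 'k" where "E12 \<equiv> mx [[0, 1, 0], [0, 0, 0], [0, 0, 0]]"

abbreviation E13 :: "nat \<Rightarrow> nat \<Rightarrow> 'k" where "E13 \<equiv> mx [[0, 0, 1], [0, 0, 0], [0, 0, 0]]"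

abbreviation E23 :: "nat \<Rightarrow> nat \<Rightarrow> 'k" where "E23 \<equiv> mx [[0, 0, 0], [0, 0, 1], [0, 0, 0]]"

abbreviation Us :: "'k set" where "Us \<equiv> nonzeros"

abbreviation Ks :: "'k set" where "Ks \<equiv> UNIV"

abbreviation GLs :: "('k \<times> 'k \<times> 'k \<times> 'k) set" where "GLs \<equiv> gl2"

text \<open>Membership in \<open>mats\<close> under another name, so that the elimination rules
  below, which expand a member of \<open>mats\<close> into its entries, do not apply to their own
  result.\<close>

definition fits :: "'k list list \<Rightarrow> 'v list \<Rightarrow> 'v list \<Rightarrow> bool" where
  "fits R v w \<longleftrightarrow> (\<forall>s<length R. \<forall>t<length (R ! s).
    R ! s ! t \<noteq> 0 \<longrightarrow> s < length w \<and> t < length v \<and> reach (w ! s) (v ! t))"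

lemma fits_iff: "fits R v w \<longleftrightarrow> mx R \<in> mats v w"
  by (simp add: fits_def mx_mats_iff)

lemma ex3:
  assumes "g \<in> mats v w" "length v = 3" "length w = 3"
  obtains a b c d e f h k l where "g = mx [[a, b, c], [d, e, f], [h, k, l]]"
    "fits [[a, b, c], [d, e, f], [h, k, l]] v w"
proof -
  define R where "R = map (\<lambda>s. map (g s) [0..<length v]) [0..<length w]"
  have "R = [[g 0 0, g 0 (Suc 0), g 0 (Suc (Suc 0))],
      [g (Suc 0) 0, g (Suc 0) (Suc 0), g (Suc 0) (Suc (Suc 0))],
      [g (Suc (Suc 0)) 0, g (Suc (Suc 0)) (Suc 0), g (Suc (Suc 0)) (Suc (Suc 0))]]"
    using assms(2,3) by (simp add: R_def upt_rec)
  then have e: "g = mx [[g 0 0, g 0 (Suc 0), g 0 (Suc (Suc 0))],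
      [g (Suc 0) 0, g (Suc 0) (Suc 0), g (Suc 0) (Suc (Suc 0))],
      [g (Suc (Suc 0)) 0, g (Suc (Suc 0)) (Suc 0), g (Suc (Suc 0)) (Suc (Suc 0))]]"
    using mats_mx[OF assms(1)] unfolding R_def by metis
  show thesis by (rule that[OF e]) (simp only: fits_iff e[symmetric] assms(1))
qed

lemma ex2:
  assumes "g \<in> mats v w" "length v = 2" "length w = 2"
  obtains a b c d where "g = mx [[a, b], [c, d]]"
    "fits [[a, b], [c, d]] v w"
proof -
  define R where "R = map (\<lambda>s. map (g s) [0..<length v]) [0..<length w]"
  have "R = [[g 0 0, g 0 (Suc 0)], [g (Suc 0) 0, g (Suc 0) (Suc 0)]]"
    using assms(2,3) by (simp add: R_def upt_rec)
  then have e: "g = mx [[g 0 0, g 0 (Suc 0)], [g (Suc 0) 0, g (Suc 0) (Suc 0)]]"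
    using mats_mx[OF assms(1)] unfolding R_def by metis
  show thesis by (rule that[OF e]) (simp only: fits_iff e[symmetric] assms(1))
qed

lemma ex1:
  assumes "g \<in> mats v w" "length v = 1" "length w = 1"
  obtains a where "g = mx [[a]]"
    "fits [[a]] v w"
proof -
  define R where "R = map (\<lambda>s. map (g s) [0..<length v]) [0..<length w]"
  have "R = [[g 0 0]]"
    using assms(2,3) by (simp add: R_def upt_rec)
  then have e: "g = mx [[g 0 0]]"
    using mats_mx[OF assms(1)] unfolding R_def by metis
  show thesis by (rule that[OF e]) (simp only: fits_iff e[symmetric] assms(1))
qed

lemma ex12:
  assumes "g \<in> mats v w" "length v = 2" "length w = 1"
  obtains a b where "g = mx [[a, b]]"
    "fits [[a, b]] v w"
proof -
  define R where "R = map (\<lambda>s. map (g s) [0..<length v]) [0..<length w]"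
  have "R = [[g 0 0, g 0 (Suc 0)]]"
    using assms(2,3) by (simp add: R_def upt_rec)
  then have e: "g = mx [[g 0 0, g 0 (Suc 0)]]"
    using mats_mx[OF assms(1)] unfolding R_def by metis
  show thesis by (rule that[OF e]) (simp only: fits_iff e[symmetric] assms(1))
qed

lemma ex21:
  assumes "g \<in> mats v w" "length v = 1" "length w = 2"
  obtains a b where "g = mx [[a], [b]]"
    "fits [[a], [b]] v w"
proof -
  define R where "R = map (\<lambda>s. map (g s) [0..<length v]) [0..<length w]"
  have "R = [[g 0 0], [g (Suc 0) 0]]"
    using assms(2,3) by (simp add: R_def upt_rec)
  then have e: "g = mx [[g 0 0], [g (Suc 0) 0]]"
    using mats_mx[OF assms(1)] unfolding R_def by metis
  show thesis by (rule that[OF e]) (simp only: fits_iff e[symmetric] assms(1))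
qed

lemma invertible_1:
  assumes "x \<in> verts Q"
  shows "invertible [x] [x] (mx [[a]]) \<longleftrightarrow> a \<noteq> 0"
proof
  assume "invertible [x] [x] (mx [[a]])"
  then obtain S where S: "S \<in> mats [x] [x]" "mat_mult (Suc 0) (mx [[a]]) S = id_mat (Suc 0)"
    by (rule invertibleE) simp
  obtain a' where s: "S = mx [[a']]" by (rule ex1[OF S(1)]) auto
  show "a \<noteq> 0" using S(2) unfolding s by (auto simp: mx_simps)
next
  assume "a \<noteq> 0"
  then show "invertible [x] [x] (mx [[a]])"
    using assms by (intro invertibleI[of "[[1 / a]]"]) (auto simp: mx_simps reach_refl)
qed

lemma invertible_same:
  assumes "x \<in> verts Q"
  shows "invertible [x, x] [x, x] (mx [[a, b], [c, d]]) \<longleftrightarrow> a * d - b * c \<noteq> 0"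
proof
  assume "invertible [x, x] [x, x] (mx [[a, b], [c, d]])"
  then obtain S where S: "S \<in> mats [x, x] [x, x]" "mat_mult (Suc (Suc 0)) (mx [[a, b], [c, d]]) S = id_mat (Suc (Suc 0))"
    by (rule invertibleE) simp
  obtain a' b' c' d' where s: "S = mx [[a', b'], [c', d']]" by (rule ex2[OF S(1)]) auto
  show "a * d - b * c \<noteq> 0"
    using S(2) unfolding s by (intro det2_nonzero[of a a' b c' b' d' c d]) (auto simp: mx_simps algebra_simps)
next
  assume nz: "a * d - b * c \<noteq> 0"
  \<comment> \<open>The inverse is the adjugate over the determinant. The determinant stays an atom
    while denominators are cleared and is unfolded afterwards.\<close>
  define D where "D = a * d - b * c"
  have D: "D \<noteq> 0" using nz by (simp add: D_def)
  show "invertible [x, x] [x, x] (mx [[a, b], [c, d]])"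
    by (rule invertibleI[of "[[d / D, - b / D], [- c / D, a / D]]"])
      (use D assms in \<open>auto simp: mx_simps reach_refl field_simps\<close>, auto simp: D_def algebra_simps)
qed

text \<open>The inverse must be supported on the reachability order as well, hence is upper
  triangular, and only the diagonal decides. The condition on \<open>b\<close> also admits the case
  \<open>b = 0\<close> of unrelated vertices.\<close>

lemma invertible_two:
  assumes "x \<in> verts Q" "y \<in> verts Q" "b \<noteq> 0 \<Longrightarrow> reach x y" "\<not> reach y x"
  shows "invertible [x, y] [x, y] (mx [[a, b], [0, d]]) \<longleftrightarrow> a \<noteq> 0 \<and> d \<noteq> 0"
proof
  assume "invertible [x, y] [x, y] (mx [[a, b], [0, d]])"
  then obtain S where S: "S \<in> mats [x, y] [x, y]" "mat_mult (Suc (Suc 0)) (mx [[a, b], [0, d]]) S = id_mat (Suc (Suc 0))"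
    by (rule invertibleE) simp
  obtain a' b' c' d' where s: "S = mx [[a', b'], [c', d']]" by (rule ex2[OF S(1)]) auto
  have "c' = 0" using S(1) assms unfolding s by (auto simp: mx_simps)
  then show "a \<noteq> 0 \<and> d \<noteq> 0" using S(2) unfolding s by (auto simp: mx_simps)
next
  assume nz: "a \<noteq> 0 \<and> d \<noteq> 0"
  show "invertible [x, y] [x, y] (mx [[a, b], [0, d]])"
    by (rule invertibleI[of "[[1 / a, - b / (a * d)], [0, 1 / d]]"])
      (use nz assms in \<open>auto simp: mx_simps reach_refl field_simps\<close>)
qed

lemma invertible_diag:
  assumes "x \<in> verts Q" "y \<in> verts Q" "\<not> reach y x"
  shows "invertible [x, y] [x, y] (mx [[a, 0], [0, d]]) \<longleftrightarrow> a \<noteq> 0 \<and> d \<noteq> 0"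
  using assms by (intro invertible_two) auto

lemma card_param:
  assumes "S = f ` T" "inj_on f T"
  shows "card S = card T"
  using assms by (simp add: card_image)

lemma card_aut_1: "x \<in> verts Q \<Longrightarrow> card (mat_isos [x] (mx [[0]]) [x] (mx [[0]])) = card Us"
  by (rule card_param[of _ "\<lambda>a. mx [[a]]"])
    (auto simp: mx_simps invertible_1 nonzeros_def inj_on_def reach_refl image_iff fits_def elim!: ex1)

lemma card_aut_same:
  "x \<in> verts Q \<Longrightarrow> card (mat_isos [x, x] O2 [x, x] O2) = card GLs"
  by (rule card_param[of _ "\<lambda>(a, b, c, d). mx [[a, b], [c, d]]"])
    (auto simp: mx_simps invertible_same gl2_def inj_on_def reach_refl image_iff fits_def elim!: ex2)

text \<open>The centralizer of a regular nilpotent matrix consists of the polynomials in it, here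
  \<open>a + b N2\<close>.\<close>

lemma card_aut_K:
  "x \<in> verts Q \<Longrightarrow> card (mat_isos [x, x] N2 [x, x] N2) = card (Us \<times> Ks)"
  by (rule card_param[of _ "\<lambda>(a, b). mx [[a, b], [0, a]]"])
    (auto simp: mx_simps invertible_same nonzeros_def inj_on_def reach_refl image_iff fits_def elim!: ex2)

lemma card_aut_unrelated:
  "x \<in> verts Q \<Longrightarrow> y \<in> verts Q \<Longrightarrow> \<not> reach x y \<Longrightarrow> \<not> reach y x \<Longrightarrow>
    card (mat_isos [x, y] O2 [x, y] O2) = card (Us \<times> Us)"
  by (rule card_param[of _ "\<lambda>(a, b). mx [[a, 0], [0, b]]"])
    (auto simp: mx_simps invertible_diag nonzeros_def inj_on_def reach_refl image_iff fits_def elim!: ex2)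

end

text \<open>As \<open>j\<close> does not reach \<open>i\<close>, matrices over a list with each
  \<open>i\<close> before each \<open>j\<close> are block upper triangular; the normal forms use the
  lists \<open>[i, j]\<close>, \<open>[i, j, j]\<close> and \<open>[i, i, j]\<close>.\<close>

locale two_vertices = thin_algebra Q A
  for Q :: "('v, 'e) pre_digraph" and A :: "('k::{field,finite}, ('v, 'e) qpath \<Rightarrow> 'k) module" +
  fixes i j :: 'v
  assumes i: "i \<in> verts Q" and j: "j \<in> verts Q" and ne: "i \<noteq> j" and ij: "reach i j"
begin

lemma reaches [simp]: "reach i i" "reach j j" "reach i j" "\<not> reach j i" "i \<in> verts Q" "j \<in> verts Q"
  using i j ne ij reach_refl reach_antisym by blast+

lemma invertible_ijj:
  "invertible [i, j, j] [i, j, j] (mx [[a, b, c], [0, e, f], [0, h, k]]) \<longleftrightarrow> a \<noteq> 0 \<and> e * k - f * h \<noteq> 0"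
proof
  assume "invertible [i, j, j] [i, j, j] (mx [[a, b, c], [0, e, f], [0, h, k]])"
  then obtain S where S: "S \<in> mats [i, j, j] [i, j, j]"
    "mat_mult (Suc (Suc (Suc 0))) (mx [[a, b, c], [0, e, f], [0, h, k]]) S = id_mat (Suc (Suc (Suc 0)))"
    by (rule invertibleE) simp
  obtain a' b' c' d' e' f' h' k' l' where s: "S = mx [[a', b', c'], [d', e', f'], [h', k', l']]"
    by (rule ex3[OF S(1)]) auto
  have z: "d' = 0" "h' = 0" using S(1) unfolding s by (auto simp: mx_simps)
  then show "a \<noteq> 0 \<and> e * k - f * h \<noteq> 0"
    using S(2) det2_nonzero[of e e' f k' f' l' h k] unfolding s z by (auto simp: mx_simps algebra_simps)
next
  assume nz: "a \<noteq> 0 \<and> e * k - f * h \<noteq> 0"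
  define D where "D = e * k - f * h"
  have D: "D \<noteq> 0" "a \<noteq> 0" using nz by (auto simp: D_def)
  show "invertible [i, j, j] [i, j, j] (mx [[a, b, c], [0, e, f], [0, h, k]])"
    \<comment> \<open>Inverse of a block triangular matrix: the upper right block is minus the row
      \<open>(b, c)\<close> times the inverse of the lower block, divided by
      \<open>a\<close>.\<close>
    by (rule invertibleI[of "[[1 / a, (c * h - b * k) / (a * D), (b * f - c * e) / (a * D)],
        [0, k / D, - f / D], [0, - h / D, e / D]]"])
      (use D in \<open>auto simp: mx_simps field_simps\<close>, auto simp: D_def algebra_simps)
qed

lemma invertible_iij:
  "invertible [i, i, j] [i, i, j] (mx [[a, b, c], [d, e, f], [0, 0, k]]) \<longleftrightarrow> a * e - b * d \<noteq> 0 \<and> k \<noteq> 0"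
proof
  assume "invertible [i, i, j] [i, i, j] (mx [[a, b, c], [d, e, f], [0, 0, k]])"
  then obtain S where S: "S \<in> mats [i, i, j] [i, i, j]"
    "mat_mult (Suc (Suc (Suc 0))) (mx [[a, b, c], [d, e, f], [0, 0, k]]) S = id_mat (Suc (Suc (Suc 0)))"
    by (rule invertibleE) simp
  obtain a' b' c' d' e' f' h' k' l' where s: "S = mx [[a', b', c'], [d', e', f'], [h', k', l']]"
    by (rule ex3[OF S(1)]) auto
  have z: "h' = 0" "k' = 0" using S(1) unfolding s by (auto simp: mx_simps)
  then show "a * e - b * d \<noteq> 0 \<and> k \<noteq> 0"
    using S(2) det2_nonzero[of a a' b d' b' e' d e] unfolding s z by (auto simp: mx_simps algebra_simps)
next
  assume nz: "a * e - b * d \<noteq> 0 \<and> k \<noteq> 0"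
  define D where "D = a * e - b * d"
  have D: "D \<noteq> 0" "k \<noteq> 0" using nz by (auto simp: D_def)
  show "invertible [i, i, j] [i, i, j] (mx [[a, b, c], [d, e, f], [0, 0, k]])"
    \<comment> \<open>Here the last column is minus the inverse of the upper block applied to the
      column \<open>(c, f)\<close>, divided by \<open>k\<close>.\<close>
    by (rule invertibleI[of "[[e / D, - b / D, (b * f - c * e) / (D * k)],
        [- d / D, a / D, (c * d - a * f) / (D * k)], [0, 0, 1 / k]]"])
      (use D in \<open>auto simp: mx_simps field_simps\<close>, auto simp: D_def algebra_simps)
qed

lemma card_aut_ij:
  "card (mat_isos [i, j] O2 [i, j] O2) = card (Us \<times> Us \<times> Ks)"
  by (rule card_param[of _ "\<lambda>(a, d, b). mx [[a, b], [0, d]]"])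
    (auto simp: mx_simps invertible_two nonzeros_def inj_on_def image_iff fits_def elim!: ex2)

lemma card_aut_C:
  "card (mat_isos [i, j] N2 [i, j] N2) = card (Us \<times> Ks)"
  by (rule card_param[of _ "\<lambda>(a, b). mx [[a, b], [0, a]]"])
    (auto simp: mx_simps invertible_two nonzeros_def inj_on_def image_iff fits_def elim!: ex2)

lemma card_aut_ijj:
  "card (mat_isos [i, j, j] O3 [i, j, j] O3) =
    card ((Us \<times> Ks \<times> Ks) \<times> GLs)"
  by (rule card_param[of _ "\<lambda>((a, b, c), (e, f, h, k)). mx [[a, b, c], [0, e, f], [0, h, k]]"])
    (auto simp: mx_simps invertible_ijj nonzeros_def gl2_def inj_on_def image_iff fits_def elim!: ex3)

text \<open>For the matrix unit with its entry in row \<open>r\<close> and column \<open>s\<close>,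
  multiplying \<open>g\<close> by it on the right moves column \<open>r\<close> of \<open>g\<close>
  to column \<open>s\<close>, and multiplying on the left moves row \<open>s\<close> to row
  \<open>r\<close>. Commuting thus equates two diagonal entries of \<open>g\<close> and kills the
  other entries of that column and that row. The same comparison gives the centralizers of
  \<open>E23\<close> and \<open>E12\<close> below.\<close>

lemma card_aut_ijj_C:
  "card (mat_isos [i, j, j] E13 [i, j, j] E13) =
    card (Us \<times> Us \<times> Ks \<times> Ks \<times> Ks)"
  by (rule card_param[of _ "\<lambda>(a, e, b, c, f). mx [[a, b, c], [0, e, f], [0, 0, a]]"])
    (auto simp: mx_simps invertible_ijj nonzeros_def inj_on_def image_iff fits_def elim!: ex3)

lemma card_aut_ijj_K:
  "card (mat_isos [i, j, j] E23 [i, j, j] E23) =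
    card (Us \<times> Us \<times> Ks \<times> Ks)"
  by (rule card_param[of _ "\<lambda>(a, e, c, f). mx [[a, 0, c], [0, e, f], [0, 0, e]]"])
    (auto simp: mx_simps invertible_ijj nonzeros_def inj_on_def image_iff fits_def elim!: ex3)

lemma card_aut_iij:
  "card (mat_isos [i, i, j] O3 [i, i, j] O3) =
    card ((Us \<times> Ks \<times> Ks) \<times> GLs)"
  by (rule card_param[of _ "\<lambda>((k, c, f), (a, b, d, e)). mx [[a, b, c], [d, e, f], [0, 0, k]]"])
    (auto simp: mx_simps invertible_iij nonzeros_def gl2_def inj_on_def image_iff fits_def elim!: ex3)

lemma card_aut_iij_C:
  "card (mat_isos [i, i, j] E13 [i, i, j] E13) =
    card (Us \<times> Us \<times> Ks \<times> Ks \<times> Ks)"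
  by (rule card_param[of _ "\<lambda>(a, e, b, c, f). mx [[a, b, c], [0, e, f], [0, 0, a]]"])
    (auto simp: mx_simps invertible_iij nonzeros_def inj_on_def image_iff fits_def elim!: ex3)

lemma card_aut_iij_K:
  "card (mat_isos [i, i, j] E12 [i, i, j] E12) =
    card (Us \<times> Us \<times> Ks \<times> Ks)"
  by (rule card_param[of _ "\<lambda>(a, k, b, c). mx [[a, b, c], [0, a, 0], [0, 0, k]]"])
    (auto simp: mx_simps invertible_iij nonzeros_def inj_on_def image_iff fits_def elim!: ex3)

text \<open>\<open>E23\<close> restricts to an isomorphism between two copies of \<open>P_j\<close>
  and so is nonzero modulo the radical, whereas \<open>E13\<close> maps into the radical. In
  entries, an intertwiner has a zero corner or a singular lower block.\<close>

lemma not_iso_ijj: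
  "mat_isos [i, j, j] E13 [i, j, j] E23 = {}"
  "mat_isos [i, j, j] E23 [i, j, j] E13 = {}"
  by (auto simp: mx_simps invertible_ijj fits_def elim!: ex3)

lemma not_iso_iij:
  "mat_isos [i, i, j] E13 [i, i, j] E12 = {}"
  "mat_isos [i, i, j] E12 [i, i, j] E13 = {}"
  by (auto simp: mx_simps invertible_iij fits_def elim!: ex3)

end

section \<open>Products\<close>

context thin_algebra
begin

lemma mat_isosI:
  assumes "mx R \<in> mats v w" "mx S \<in> mats w v" "mat_mult (length w) (mx S) (mx R) = id_mat (length v)"
    "mat_mult (length v) (mx R) (mx S) = id_mat (length w)" "mat_mult (length v) (mx R) D = mat_mult (length w) E (mx R)"
  shows "mat_isos v D w E \<noteq> {}"
  using assms unfolding mat_isos_def invertible_def by blast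

text \<open>The cardinalities involve truncated subtraction; as the field is nonempty, it agrees
  with subtraction of complex numbers.\<close>

lemma card_of_nat:
  "(of_nat (card Us) :: complex) = of_nat CARD('k) - 1"
  "(of_nat (card GLs) :: complex) =
    (of_nat CARD('k) * of_nat CARD('k) - 1) * (of_nat CARD('k) * of_nat CARD('k) - of_nat CARD('k))"
  "(of_nat (card (S \<times> T)) :: complex) = of_nat (card S) * of_nat (card T)"
proof -
  have 1: "1 \<le> CARD('k)" using card_k_gt_1 by simp
  then have 2: "CARD('k) \<le> CARD('k) * CARD('k)" by simp
  then have 3: "1 \<le> CARD('k) * CARD('k)" using 1 by (rule le_trans[rotated])
  show "(of_nat (card Us) :: complex) = of_nat CARD('k) - 1" unfolding card_U using 1 by (simp add: of_nat_diff)
  show "(of_nat (card GLs) :: complex) =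
    (of_nat CARD('k) * of_nat CARD('k) - 1) * (of_nat CARD('k) * of_nat CARD('k) - of_nat CARD('k))"
    unfolding card_GL of_nat_mult using 2 3 by (simp add: of_nat_diff)
qed (simp_all add: card_cartesian_product)

text \<open>The products needed have at most three middle terms. This lemma and the next two replace
  the index set of \<open>std_product\<close> by separate hypotheses for each middle term.\<close>

lemma product_single:
  assumes "D \<in> mats v v" "E \<in> mats w w" "set v \<subseteq> verts Q" "set w \<subseteq> verts Q"
    and "mat_mult (length v) D D = zero_mat" "mat_mult (length w) E E = zero_mat"
    and "F \<in> mats z z" "set z \<subseteq> verts Q" "mat_mult (length z) F F = zero_mat"
    and "\<And>h. h \<in> mats v w \<Longrightarrow>
      mat_mult (length w + length v) (block (length w) E h D) (block (length w) E h D) = zero_mat \<Longrightarrow> h \<in> H"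
    and "H \<subseteq> mats v w" "\<And>h. h \<in> H \<Longrightarrow> mat_isos (w @ v) (block (length w) E h D) z F \<noteq> {}"
    and "r * (of_nat (card (mats v w)) * of_nat (card (mat_isos v D v D)) * of_nat (card (mat_isos w E w E))) =
      of_nat (card H) * of_nat (card (mat_isos z F z F))"
  shows "std_basis v D \<otimes>\<^bsub>hall_algebra A\<^esub> std_basis w E = (\<lambda>c. r * std_basis z F c)"
  using std_product[of D v E w "{()}" "\<lambda>_. F" "\<lambda>_. z" "\<lambda>_. H" "\<lambda>_. r"] assms by simp

lemma product_double:
  assumes "D \<in> mats v v" "E \<in> mats w w" "set v \<subseteq> verts Q" "set w \<subseteq> verts Q"
    and "mat_mult (length v) D D = zero_mat" "mat_mult (length w) E E = zero_mat"
    and "F \<in> mats z z" "G \<in> mats z z" "set z \<subseteq> verts Q" "mat_mult (length z) F F = zero_mat" "mat_mult (length z) G G = zero_mat"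
    and "mat_isos z F z G = {}" "mat_isos z G z F = {}"
    and "\<And>h. h \<in> mats v w \<Longrightarrow>
      mat_mult (length w + length v) (block (length w) E h D) (block (length w) E h D) = zero_mat \<Longrightarrow> h \<in> H \<or> h \<in> K"
    and "H \<subseteq> mats v w" "\<And>h. h \<in> H \<Longrightarrow> mat_isos (w @ v) (block (length w) E h D) z F \<noteq> {}"
    and "K \<subseteq> mats v w" "\<And>h. h \<in> K \<Longrightarrow> mat_isos (w @ v) (block (length w) E h D) z G \<noteq> {}"
    and "r * (of_nat (card (mats v w)) * of_nat (card (mat_isos v D v D)) * of_nat (card (mat_isos w E w E))) =
      of_nat (card H) * of_nat (card (mat_isos z F z F))"
    and "s * (of_nat (card (mats v w)) * of_nat (card (mat_isos v D v D)) * of_nat (card (mat_isos w E w E))) =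
      of_nat (card K) * of_nat (card (mat_isos z G z G))"
  shows "std_basis v D \<otimes>\<^bsub>hall_algebra A\<^esub> std_basis w E = (\<lambda>c. r * std_basis z F c + s * std_basis z G c)"
proof -
  have "std_basis v D \<otimes>\<^bsub>hall_algebra A\<^esub> std_basis w E =
    (\<lambda>c. \<Sum>b\<in>{True, False}. (if b then r else s) * std_basis z (if b then F else G) c)"
  proof (rule std_product[where H = "\<lambda>b. if b then H else K"])
    fix h assume "h \<in> mats v w" "mat_mult (length w + length v) (block (length w) E h D) (block (length w) E h D) = zero_mat"
    then have "h \<in> H \<or> h \<in> K" by (rule assms)
    then show "\<exists>i\<in>{True, False}. h \<in> (if i then H else K)" by auto
  qed (use assms in \<open>auto split: if_splits\<close>)
  then show ?thesis by simp
qed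

lemma product_triple:
  assumes "D \<in> mats v v" "E \<in> mats w w" "set v \<subseteq> verts Q" "set w \<subseteq> verts Q"
    and "mat_mult (length v) D D = zero_mat" "mat_mult (length w) E E = zero_mat"
    and "F \<in> mats z z" "G \<in> mats z z" "L \<in> mats z z" "set z \<subseteq> verts Q"
      "mat_mult (length z) F F = zero_mat" "mat_mult (length z) G G = zero_mat" "mat_mult (length z) L L = zero_mat"
    and "mat_isos z F z G = {}" "mat_isos z G z F = {}" "mat_isos z F z L = {}" "mat_isos z L z F = {}"
      "mat_isos z G z L = {}" "mat_isos z L z G = {}"
    and "\<And>h. h \<in> mats v w \<Longrightarrow>
      mat_mult (length w + length v) (block (length w) E h D) (block (length w) E h D) = zero_mat \<Longrightarrow> h \<in> H \<or> h \<in> K \<or> h \<in> M"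
    and "H \<subseteq> mats v w" "\<And>h. h \<in> H \<Longrightarrow> mat_isos (w @ v) (block (length w) E h D) z F \<noteq> {}"
    and "K \<subseteq> mats v w" "\<And>h. h \<in> K \<Longrightarrow> mat_isos (w @ v) (block (length w) E h D) z G \<noteq> {}"
    and "M \<subseteq> mats v w" "\<And>h. h \<in> M \<Longrightarrow> mat_isos (w @ v) (block (length w) E h D) z L \<noteq> {}"
    and "r * (of_nat (card (mats v w)) * of_nat (card (mat_isos v D v D)) * of_nat (card (mat_isos w E w E))) =
      of_nat (card H) * of_nat (card (mat_isos z F z F))"
    and "s * (of_nat (card (mats v w)) * of_nat (card (mat_isos v D v D)) * of_nat (card (mat_isos w E w E))) =
      of_nat (card K) * of_nat (card (mat_isos z G z G))"
    and "t * (of_nat (card (mats v w)) * of_nat (card (mat_isos v D v D)) * of_nat (card (mat_isos w E w E))) =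
      of_nat (card M) * of_nat (card (mat_isos z L z L))"
  shows "std_basis v D \<otimes>\<^bsub>hall_algebra A\<^esub> std_basis w E = (\<lambda>c. r * std_basis z F c + s * std_basis z G c + t * std_basis z L c)"
proof -
  let ?I = "{0, 1, 2 :: nat}"
  have "std_basis v D \<otimes>\<^bsub>hall_algebra A\<^esub> std_basis w E =
    (\<lambda>c. \<Sum>b\<in>?I. (if b = 0 then r else if b = 1 then s else t) * std_basis z (if b = 0 then F else if b = 1 then G else L) c)"
  proof (rule std_product[where H = "\<lambda>b. if b = 0 then H else if b = 1 then K else M"])
    fix h assume "h \<in> mats v w" "mat_mult (length w + length v) (block (length w) E h D) (block (length w) E h D) = zero_mat"
    then have "h \<in> H \<or> h \<in> K \<or> h \<in> M" by (rule assms)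
    then show "\<exists>i\<in>?I. h \<in> (if i = 0 then H else if i = 1 then K else M)" by auto
  qed (use assms in \<open>auto split: if_splits\<close>)
  then show ?thesis by (simp add: add.assoc)
qed

lemmas mx_rules = mx_mats_iff All_less_Suc mat_mult_mx mx_eq_iff id_mat_mx zero_mat_mx lessThan_Suc block_mx

lemma mats_same: "x \<in> verts Q \<Longrightarrow> mats [x] [x] = (\<lambda>a. mx [[a]]) ` Ks"
  by (auto simp: mx_simps image_iff reach_refl fits_def elim!: ex1)

lemma iso_scale:
  assumes "x \<in> verts Q" "y \<in> verts Q" "c \<noteq> 0"
  shows "mat_isos [x, y] (mx [[0, c], [0, 0]]) [x, y] N2 \<noteq> {}"
  by (rule mat_isosI[of "[[1, 0], [0, c]]" _ _ "[[1, 0], [0, 1 / c]]"])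
    (use assms in \<open>auto simp: mx_rules reach_refl\<close>)

lemma iso_id:
  assumes "D \<in> mats v v" "set v \<subseteq> verts Q"
  shows "mat_isos v D v D \<noteq> {}"
  using cyc_equiv_refl[OF pre_cyc_std[OF assms(1)]] cyc_equiv_std[OF assms(1,1) assms(2,2)] by simp

lemma card_mx:
  "card ((\<lambda>a. mx [[a]]) ` S) = card S" "card ((\<lambda>b. mx [[0, b]]) ` S) = card S"
  "card ((\<lambda>a. mx [[a], [0]]) ` S) = card S" "card ((\<lambda>(a, b). mx [[a, b]]) ` P) = card P"
  "card ((\<lambda>(a, b). mx [[a], [b]]) ` P) = card P"
  "(of_nat (card (UNIV - {(0 :: 'k, 0 :: 'k)})) :: complex) = of_nat CARD('k) * of_nat CARD('k) - 1"
proof -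
  have "card (UNIV - {(0 :: 'k, 0 :: 'k)}) = CARD('k) * CARD('k) - 1"
    using card_Diff_singleton[of "(0 :: 'k, 0 :: 'k)" UNIV] by (simp add: card_prod)
  moreover have "1 \<le> CARD('k) * CARD('k)" using card_k_gt_1 by simp
  ultimately show "(of_nat (card (UNIV - {(0 :: 'k, 0 :: 'k)})) :: complex) = of_nat CARD('k) * of_nat CARD('k) - 1"
    by (simp add: of_nat_diff)
qed (rule card_image, auto simp: inj_on_def mx_eq_iff)+

lemma mx_image_iff:
  "mx [[a]] \<in> (\<lambda>a. mx [[a]]) ` S \<longleftrightarrow> a \<in> S"
  "mx [[a, b]] \<in> (\<lambda>b. mx [[0, b]]) ` S \<longleftrightarrow> a = 0 \<and> b \<in> S"
  "mx [[a], [b]] \<in> (\<lambda>a. mx [[a], [0]]) ` S \<longleftrightarrow> b = 0 \<and> a \<in> S"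
  "mx [[a, b]] \<in> (\<lambda>(a, b). mx [[a, b]]) ` P \<longleftrightarrow> (a, b) \<in> P"
  "mx [[a], [b]] \<in> (\<lambda>(a, b). mx [[a], [b]]) ` P \<longleftrightarrow> (a, b) \<in> P"
  by (auto simp: image_iff mx_eq_iff split_beta prod_eq_iff intro: bexI[of _ "(a, b)"])

lemma iso_id2:
  assumes "x \<in> verts Q" "y \<in> verts Q"
  shows "mat_isos [x, y] O2 [x, y] O2 \<noteq> {}"
  by (rule iso_id) (use assms in \<open>auto simp: mx_rules\<close>)

lemma iso_id3:
  assumes "x \<in> verts Q" "y \<in> verts Q" "z \<in> verts Q"
  shows "mat_isos [x, y, z] O3 [x, y, z] O3 \<noteq> {}"
  by (rule iso_id) (use assms in \<open>auto simp: mx_rules\<close>)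

lemma iso_swap:
  assumes "x \<in> verts Q" "y \<in> verts Q"
  shows "mat_isos [x, y] O2 [y, x] O2 \<noteq> {}"
  by (rule mat_isosI[of "[[0, 1], [1, 0]]" _ _ "[[0, 1], [1, 0]]"])
    (use assms in \<open>auto simp: mx_rules reach_refl\<close>)

lemma mats_unrelated: "\<not> reach y x \<Longrightarrow> mats [x] [y] = {mx [[0]]}"
  by (auto simp: mx_simps fits_def elim!: ex1)

text \<open>With no homomorphisms in either direction the direct sum is the only middle term, and
  its automorphism group is the product of those of the factors.\<close>

lemma product_unrelated:
  assumes "x \<in> verts Q" "y \<in> verts Q" "\<not> reach x y" "\<not> reach y x"
  shows "std_basis [x] (mx [[0]]) \<otimes>\<^bsub>hall_algebra A\<^esub> std_basis [y] (mx [[0]]) = (\<lambda>c. (1) * std_basis [y, x] O2 c)"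
proof (rule product_single[where H = "{mx [[0]]}"], goal_cases)
  \<comment> \<open>The hypotheses of \<open>product_single\<close> by number: 10 lists the
    admissible entries \<open>h\<close>, 12 identifies the middle term, 13 is the count.\<close>
  case (10 h)
  then show ?case using assms by (auto simp: mats_unrelated mx_rules mx_image_iff)
next
  case (12 h)
  then show ?case using assms by (auto simp: block_mx iso_id2)
next
  case 13
  then show ?case using assms by (simp add: mats_unrelated card_mx card_aut_1 card_aut_unrelated card_of_nat algebra_simps)
qed (use assms in \<open>auto simp: mx_rules reach_refl\<close>)

text \<open>The entry \<open>h\<close> ranges over the ground field: zero gives the direct sum and
  any other value gives \<open>K\<close>. Riedtmann's formula yields the order of the general linear
  group over \<open>q (q - 1)^2\<close>, which is \<open>q + 1\<close>, and for \<open>K\<close> it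
  yields 1.\<close>

lemma square:
  assumes "x \<in> verts Q"
  shows "std_basis [x] (mx [[0]]) \<otimes>\<^bsub>hall_algebra A\<^esub> std_basis [x] (mx [[0]]) =
    (\<lambda>c. (of_nat CARD('k) + 1) * std_basis [x, x] O2 c + (1) * std_basis [x, x] N2 c)"
proof (rule product_double[where H = "{mx [[0]]}"
    and K = "(\<lambda>a. mx [[a]]) ` Us"], goal_cases)
  \<comment> \<open>The hypotheses of \<open>product_double\<close> by number: 12 and 13 separate
    the middle terms, 14 exhausts the entries \<open>h\<close>, 16 and 18 identify the middle terms,
    19 and 20 are the counts.\<close>
  case (14 h)
  then show ?case using assms by (auto simp: mats_same mx_rules nonzeros_def mx_image_iff)
next
  case (16 h)
  then show ?case using assms by (auto simp: block_mx iso_id2)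
next
  case (18 h)
  then show ?case using assms by (auto simp: block_mx nonzeros_def iso_scale)
next
  case 19
  then show ?case using assms by (simp add: mats_same card_mx card_aut_1 card_aut_same card_aut_K card_of_nat algebra_simps)
next
  case 20
  then show ?case using assms by (simp add: mats_same card_mx card_aut_1 card_aut_same card_aut_K card_of_nat algebra_simps)
next
  case 12
  show ?case using assms by (intro mat_isos_zero) (auto simp: mx_rules reach_refl)
next
  case 13
  show ?case using assms by (intro mat_isos_zero) (auto simp: mx_rules reach_refl)
qed (use assms in \<open>auto simp: mx_rules nonzeros_def reach_refl\<close>)

end

context two_vertices
begin

section \<open>Homomorphisms and changes of basis over two related vertices\<close>

lemma mats_11: "mats [j] [i] = (\<lambda>a. mx [[a]]) ` Ks" "mats [i] [j] = {mx [[0]]}"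
  by (auto simp: mx_simps mx_image_iff fits_def elim!: ex1)

lemma mats_12: "mats [j, j] [i] = (\<lambda>(a, b). mx [[a, b]]) ` UNIV" "mats [i, j] [j] = (\<lambda>b. mx [[0, b]]) ` Ks"
  "mats [i, i] [j] = {mx [[0, 0]]}" "mats [i, j] [i] = (\<lambda>(a, b). mx [[a, b]]) ` UNIV"
  by (auto simp: mx_simps mx_image_iff fits_def simp del: range_eqI elim!: ex12)

lemma mats_21: "mats [i] [j, j] = {mx [[0], [0]]}" "mats [j] [i, i] = (\<lambda>(a, b). mx [[a], [b]]) ` UNIV"
  by (auto simp: mx_simps mx_image_iff fits_def elim!: ex21)

lemmas mats_small = mats_11 mats_12 mats_21

lemmas count_rules = mats_small card_mx card_aut_1 card_aut_same card_aut_K card_aut_ij card_aut_C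
  card_aut_ijj card_aut_ijj_C card_aut_ijj_K card_aut_iij card_aut_iij_C card_aut_iij_K
  card_of_nat algebra_simps

text \<open>Left multiplication by \<open>E13\<close> moves the last row of the witness to the top,
  so that row has to be \<open>(0, a, b)\<close>; the others complete it to an invertible
  matrix.\<close>

lemma iso_C_last:
  assumes "b \<noteq> 0"
  shows "mat_isos [i, j, j] (mx [[0, a, b], [0, 0, 0], [0, 0, 0]]) [i, j, j] E13 \<noteq> {}"
  by (rule mat_isosI[of "[[1, 0, 0], [0, 1, 0], [0, a, b]]" _ _ "[[1, 0, 0], [0, 1, 0], [0, (-a/b), (1/b)]]"])
    (use assms in \<open>auto simp: mx_rules field_simps\<close>)

lemma iso_C_mid:
  assumes "a \<noteq> 0"
  shows "mat_isos [i, j, j] (mx [[0, a, 0], [0, 0, 0], [0, 0, 0]]) [i, j, j] E13 \<noteq> {}"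
  by (rule mat_isosI[of "[[1, 0, 0], [0, 0, 1], [0, a, 0]]" _ _ "[[1, 0, 0], [0, 0, (1/a)], [0, 1, 0]]"])
    (use assms in \<open>auto simp: mx_rules field_simps\<close>)

text \<open>Which completion of \<open>(a, b)\<close> to an invertible block works depends on which
  entry is nonzero.\<close>

lemma iso_C_row:
  assumes "(a, b) \<noteq> (0, 0)"
  shows "mat_isos [i, j, j] (mx [[0, a, b], [0, 0, 0], [0, 0, 0]]) [i, j, j] E13 \<noteq> {}"
  using assms iso_C_last[of b a] iso_C_mid[of a] by (cases "b = 0") auto

text \<open>\<open>K\<close> is contractible, so an extension by it splits: subtracting
  \<open>b\<close> times the second row from the first clears \<open>b\<close>.\<close>

lemma iso_K_shear:
  "mat_isos [i, j, j] (mx [[0, 0, b], [0, 0, 1], [0, 0, 0]]) [i, j, j] E23 \<noteq> {}"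
  by (rule mat_isosI[of "[[1, (-b), 0], [0, 1, 0], [0, 0, 1]]" _ _ "[[1, b, 0], [0, 1, 0], [0, 0, 1]]"])
    (auto simp: mx_rules)

lemma iso_jji_zero:
  "mat_isos [j, j, i] O3 [i, j, j] O3 \<noteq> {}"
  by (rule mat_isosI[of "[[0, 0, 1], [1, 0, 0], [0, 1, 0]]" _ _ "[[0, 1, 0], [0, 0, 1], [1, 0, 0]]"])
    (auto simp: mx_rules)

lemma iso_jji_K:
  "mat_isos [j, j, i] E12 [i, j, j] E23 \<noteq> {}"
  by (rule mat_isosI[of "[[0, 0, 1], [1, 0, 0], [0, 1, 0]]" _ _ "[[0, 1, 0], [0, 0, 1], [1, 0, 0]]"])
    (auto simp: mx_rules)

lemma iso_jij_zero:
  "mat_isos [j, i, j] O3 [i, j, j] O3 \<noteq> {}"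
  by (rule mat_isosI[of "[[0, 1, 0], [1, 0, 0], [0, 0, 1]]" _ _ "[[0, 1, 0], [1, 0, 0], [0, 0, 1]]"])
    (auto simp: mx_rules)

lemma iso_jij_K:
  assumes "b \<noteq> 0"
  shows "mat_isos [j, i, j] (mx [[0, 0, b], [0, 0, 0], [0, 0, 0]]) [i, j, j] E23 \<noteq> {}"
  by (rule mat_isosI[of "[[0, 1, 0], [1, 0, 0], [0, 0, b]]" _ _ "[[0, 1, 0], [1, 0, 0], [0, 0, (1/b)]]"])
    (use assms in \<open>auto simp: mx_rules field_simps\<close>)

lemma iso_jij_C:
  assumes "c \<noteq> 0"
  shows "mat_isos [j, i, j] (mx [[0, 0, 0], [0, 0, c], [0, 0, 0]]) [i, j, j] E13 \<noteq> {}"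
  by (rule mat_isosI[of "[[0, 1, 0], [1, 0, 0], [0, 0, c]]" _ _ "[[0, 1, 0], [1, 0, 0], [0, 0, (1/c)]]"])
    (use assms in \<open>auto simp: mx_rules field_simps\<close>)

lemma iso_iij_C:
  assumes "c \<noteq> 0"
  shows "mat_isos [i, i, j] (mx [[0, 0, 0], [0, 0, c], [0, 0, 0]]) [i, i, j] E13 \<noteq> {}"
  by (rule mat_isosI[of "[[0, 1, 0], [1, 0, 0], [0, 0, c]]" _ _ "[[0, 1, 0], [1, 0, 0], [0, 0, (1/c)]]"])
    (use assms in \<open>auto simp: mx_rules field_simps\<close>)

text \<open>The differential maps the last \<open>P_j\<close> both to \<open>P_j\<close> and to
  \<open>P_i\<close>. The first component is invertible and can be used to clear the second, so the
  complex is of type \<open>K\<close> and not of type \<open>C\<close>.\<close>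

lemma iso_jij_CK:
  assumes "b \<noteq> 0"
  shows "mat_isos [j, i, j] (mx [[0, 0, b], [0, 0, 1], [0, 0, 0]]) [i, j, j] E23 \<noteq> {}"
  by (rule mat_isosI[of "[[(-1/b), 1, 0], [(1/b), 0, 0], [0, 0, 1]]" _ _ "[[0, b, 0], [1, 1, 0], [0, 0, 1]]"])
    (use assms in \<open>auto simp: mx_rules field_simps\<close>)

lemma iso_jii_zero:
  "mat_isos [j, i, i] O3 [i, i, j] O3 \<noteq> {}"
  by (rule mat_isosI[of "[[0, 1, 0], [0, 0, 1], [1, 0, 0]]" _ _ "[[0, 0, 1], [1, 0, 0], [0, 1, 0]]"])
    (auto simp: mx_rules)

lemma iso_jii_K:
  "mat_isos [j, i, i] E23 [i, i, j] E12 \<noteq> {}"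
  by (rule mat_isosI[of "[[0, 1, 0], [0, 0, 1], [1, 0, 0]]" _ _ "[[0, 0, 1], [1, 0, 0], [0, 1, 0]]"])
    (auto simp: mx_rules)

lemma iso_iij_C_scale:
  assumes "b \<noteq> 0"
  shows "mat_isos [i, i, j] (mx [[0, 0, b], [0, 0, 0], [0, 0, 0]]) [i, i, j] E13 \<noteq> {}"
  by (rule mat_isosI[of "[[1, 0, 0], [0, 1, 0], [0, 0, b]]" _ _ "[[1, 0, 0], [0, 1, 0], [0, 0, (1/b)]]"])
    (use assms in \<open>auto simp: mx_rules field_simps\<close>)

text \<open>The invertible component \<open>a\<close> absorbs the map \<open>b\<close> from
  \<open>P_j\<close>: the second row of the witness is the row \<open>(0, a, b)\<close>
  itself.\<close>

lemma iso_iij_K_row: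
  assumes "a \<noteq> 0"
  shows "mat_isos [i, i, j] (mx [[0, a, b], [0, 0, 0], [0, 0, 0]]) [i, i, j] E12 \<noteq> {}"
  by (rule mat_isosI[of "[[1, 0, 0], [0, a, b], [0, 0, 1]]" _ _ "[[1, 0, 0], [0, (1/a), (-b/a)], [0, 0, 1]]"])
    (use assms in \<open>auto simp: mx_rules field_simps\<close>)

lemma iso_iij_C_first:
  assumes "a \<noteq> 0"
  shows "mat_isos [i, i, j] (mx [[0, 0, a], [0, 0, b], [0, 0, 0]]) [i, i, j] E13 \<noteq> {}"
  by (rule mat_isosI[of "[[(1/a), 0, 0], [(-b/a), 1, 0], [0, 0, 1]]" _ _ "[[a, 0, 0], [b, 1, 0], [0, 0, 1]]"])
    (use assms in \<open>auto simp: mx_rules field_simps\<close>)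

lemma iso_iij_C_second:
  assumes "b \<noteq> 0"
  shows "mat_isos [i, i, j] (mx [[0, 0, 0], [0, 0, b], [0, 0, 0]]) [i, i, j] E13 \<noteq> {}"
  by (rule mat_isosI[of "[[0, (1/b), 0], [1, 0, 0], [0, 0, 1]]" _ _ "[[0, 1, 0], [b, 0, 0], [0, 0, 1]]"])
    (use assms in \<open>auto simp: mx_rules field_simps\<close>)

lemma iso_iij_C_col:
  assumes "(a, b) \<noteq> (0, 0)"
  shows "mat_isos [i, i, j] (mx [[0, 0, a], [0, 0, b], [0, 0, 0]]) [i, i, j] E13 \<noteq> {}"
  using assms iso_iij_C_first[of a b] iso_iij_C_second[of b] by (cases "a = 0") auto

lemma iso_iij_K_shear:
  "mat_isos [i, i, j] (mx [[0, 1, a], [0, 0, 0], [0, 0, 0]]) [i, i, j] E12 \<noteq> {}"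
  by (rule mat_isosI[of "[[1, 0, 0], [0, 1, a], [0, 0, 1]]" _ _ "[[1, 0, 0], [0, 1, (-a)], [0, 0, 1]]"])
    (auto simp: mx_rules)

section \<open>The Hall products that enter the relations\<close>

lemma product_jj_i:
  "std_basis [j, j] O2 \<otimes>\<^bsub>hall_algebra A\<^esub> std_basis [i] (mx [[0]]) =
    (\<lambda>c. (1) * std_basis [i, j, j] O3 c + (1) * std_basis [i, j, j] E13 c)"
proof (rule product_double[where H = "{mx [[0, 0]]}"
    and K = "(\<lambda>(a, b). mx [[a, b]]) ` (UNIV - {(0, 0)})"], goal_cases)
  case (14 h)
  then show ?case by (auto simp: mats_small mx_rules nonzeros_def mx_image_iff)
next
  case (16 h)
  then show ?case by (auto simp: block_mx iso_id2 iso_id3)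
next
  case (18 h)
  then obtain a b where h: "h = mx [[a, b]]" "(a, b) \<noteq> (0, 0)" by auto
  show ?case unfolding h(1) using iso_C_row[OF h(2)] by (simp add: block_mx)
next
  case 19
  then show ?case by (simp add: count_rules)
next
  case 20
  then show ?case by (simp add: count_rules)
next
  case 12
  show ?case by (rule mat_isos_zero) (auto simp: mx_rules)
next
  case 13
  show ?case by (rule mat_isos_zero) (auto simp: mx_rules)
qed (auto simp: mx_rules nonzeros_def reach_refl)

text \<open>Square zero of the block matrix makes \<open>h\<close> vanish on the image of the
  differential of \<open>K\<close>, so the first entry of \<open>h\<close> is 0; the second one is
  free, and every choice splits.\<close>

lemma product_Kj_i:
  "std_basis [j, j] N2 \<otimes>\<^bsub>hall_algebra A\<^esub> std_basis [i] (mx [[0]]) = (\<lambda>c. (1) * std_basis [i, j, j] E23 c)"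
proof (rule product_single[where H = "(\<lambda>b. mx [[0, b]]) ` Ks"], goal_cases)
  case (10 h)
  then show ?case by (auto simp: mats_small mx_rules mx_image_iff)
next
  case (12 h)
  then show ?case by (auto simp: block_mx iso_K_shear)
next
  case 13
  then show ?case by (simp add: count_rules)
qed (auto simp: mx_rules reach_refl)

text \<open>Only \<open>h = 0\<close> exists. The coefficient is the number of homomorphisms from
  \<open>2 P_j\<close> to \<open>P_i\<close>, by which the automorphism group of the direct sum
  exceeds the product of those of the summands.\<close>

lemma product_i_jj:
  "std_basis [i] (mx [[0]]) \<otimes>\<^bsub>hall_algebra A\<^esub> std_basis [j, j] O2 = (\<lambda>c. (of_nat CARD('k) * of_nat CARD('k)) * std_basis [i, j, j] O3 c)"
proof (rule product_single[where H = "{mx [[0], [0]]}"], goal_cases)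
  case (10 h)
  then show ?case by (auto simp: mats_small mx_rules mx_image_iff)
next
  case (12 h)
  then show ?case by (auto simp: block_mx iso_jji_zero)
next
  case 13
  then show ?case by (simp add: count_rules)
qed (auto simp: mx_rules reach_refl)

lemma product_i_Kj:
  "std_basis [i] (mx [[0]]) \<otimes>\<^bsub>hall_algebra A\<^esub> std_basis [j, j] N2 = (\<lambda>c. (of_nat CARD('k)) * std_basis [i, j, j] E23 c)"
proof (rule product_single[where H = "{mx [[0], [0]]}"], goal_cases)
  case (10 h)
  then show ?case by (auto simp: mats_small mx_rules mx_image_iff)
next
  case (12 h)
  then show ?case by (auto simp: block_mx iso_jji_K)
next
  case 13
  then show ?case by (simp add: count_rules)
qed (auto simp: mx_rules reach_refl)

lemma product_j_i:
  "std_basis [j] (mx [[0]]) \<otimes>\<^bsub>hall_algebra A\<^esub> std_basis [i] (mx [[0]]) =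
    (\<lambda>c. (1) * std_basis [i, j] O2 c + (1) * std_basis [i, j] N2 c)"
proof (rule product_double[where H = "{mx [[0]]}"
    and K = "(\<lambda>a. mx [[a]]) ` Us"], goal_cases)
  case (14 h)
  then show ?case by (auto simp: mats_small mx_rules nonzeros_def mx_image_iff)
next
  case (16 h)
  then show ?case by (auto simp: block_mx iso_id2 iso_id3)
next
  case (18 h)
  then show ?case by (auto simp: block_mx nonzeros_def iso_scale)
next
  case 19
  then show ?case by (simp add: count_rules)
next
  case 20
  then show ?case by (simp add: count_rules)
next
  case 12
  show ?case by (rule mat_isos_zero) (auto simp: mx_rules)
next
  case 13
  show ?case by (rule mat_isos_zero) (auto simp: mx_rules)
qed (auto simp: mx_rules nonzeros_def reach_refl)

lemma product_ij_j:
  "std_basis [i, j] O2 \<otimes>\<^bsub>hall_algebra A\<^esub> std_basis [j] (mx [[0]]) =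
    (\<lambda>c. (of_nat CARD('k) * (of_nat CARD('k) + 1)) * std_basis [i, j, j] O3 c + (1) * std_basis [i, j, j] E23 c)"
proof (rule product_double[where H = "{mx [[0, 0]]}"
    and K = "(\<lambda>b. mx [[0, b]]) ` Us"], goal_cases)
  case (14 h)
  then show ?case by (auto simp: mats_small mx_rules nonzeros_def mx_image_iff)
next
  case (16 h)
  then show ?case by (auto simp: block_mx iso_jij_zero)
next
  case (18 h)
  then show ?case by (auto simp: block_mx nonzeros_def iso_jij_K)
next
  case 19
  then show ?case by (simp add: count_rules)
next
  case 20
  then show ?case by (simp add: count_rules)
next
  case 12
  show ?case by (rule mat_isos_zero) (auto simp: mx_rules)
next
  case 13
  show ?case by (rule mat_isos_zero) (auto simp: mx_rules)
qed (auto simp: mx_rules nonzeros_def reach_refl)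

text \<open>The nonzero entries \<open>b\<close> produce \<open>K\<close>, although the quotient has
  differential \<open>N2\<close>. Their coefficient \<open>q - 1\<close> later combines with the 1
  of \<open>product_ij_j\<close> to give \<open>q\<close>.\<close>

lemma product_C_j:
  "std_basis [i, j] N2 \<otimes>\<^bsub>hall_algebra A\<^esub> std_basis [j] (mx [[0]]) =
    (\<lambda>c. (of_nat CARD('k)) * std_basis [i, j, j] E13 c + (of_nat CARD('k) - 1) * std_basis [i, j, j] E23 c)"
proof (rule product_double[where H = "{mx [[0, 0]]}"
    and K = "(\<lambda>b. mx [[0, b]]) ` Us"], goal_cases)
  case (14 h)
  then show ?case by (auto simp: mats_small mx_rules nonzeros_def mx_image_iff)
next
  case (16 h)
  then show ?case by (auto simp: block_mx iso_jij_C)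
next
  case (18 h)
  then show ?case by (auto simp: block_mx nonzeros_def iso_jij_CK)
next
  case 19
  then show ?case by (simp add: count_rules)
next
  case 20
  then show ?case by (simp add: count_rules)
next
  case 12
  show ?case by (rule not_iso_ijj)
next
  case 13
  show ?case by (rule not_iso_ijj)
qed (auto simp: mx_rules nonzeros_def reach_refl)

lemma product_ii_j:
  "std_basis [i, i] O2 \<otimes>\<^bsub>hall_algebra A\<^esub> std_basis [j] (mx [[0]]) = (\<lambda>c. (of_nat CARD('k) * of_nat CARD('k)) * std_basis [i, i, j] O3 c)"
proof (rule product_single[where H = "{mx [[0, 0]]}"], goal_cases)
  case (10 h)
  then show ?case by (auto simp: mats_small mx_rules mx_image_iff)
next
  case (12 h)
  then show ?case by (auto simp: block_mx iso_jii_zero)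
next
  case 13
  then show ?case by (simp add: count_rules)
qed (auto simp: mx_rules reach_refl)

lemma product_Ki_j:
  "std_basis [i, i] N2 \<otimes>\<^bsub>hall_algebra A\<^esub> std_basis [j] (mx [[0]]) = (\<lambda>c. (of_nat CARD('k)) * std_basis [i, i, j] E12 c)"
proof (rule product_single[where H = "{mx [[0, 0]]}"], goal_cases)
  case (10 h)
  then show ?case by (auto simp: mats_small mx_rules mx_image_iff)
next
  case (12 h)
  then show ?case by (auto simp: block_mx iso_jii_K)
next
  case 13
  then show ?case by (simp add: count_rules)
qed (auto simp: mx_rules reach_refl)

lemma product_i_j:
  "std_basis [i] (mx [[0]]) \<otimes>\<^bsub>hall_algebra A\<^esub> std_basis [j] (mx [[0]]) = (\<lambda>c. (of_nat CARD('k)) * std_basis [i, j] O2 c)"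
proof (rule product_single[where H = "{mx [[0]]}"], goal_cases)
  case (10 h)
  then show ?case by (auto simp: mats_small mx_rules mx_image_iff)
next
  case (12 h)
  then show ?case by (auto simp: block_mx iso_swap)
next
  case 13
  then show ?case by (simp add: count_rules)
qed (auto simp: mx_rules reach_refl)

lemma product_j_ii:
  "std_basis [j] (mx [[0]]) \<otimes>\<^bsub>hall_algebra A\<^esub> std_basis [i, i] O2 =
    (\<lambda>c. (1) * std_basis [i, i, j] O3 c + (1) * std_basis [i, i, j] E13 c)"
proof (rule product_double[where H = "{mx [[0], [0]]}"
    and K = "(\<lambda>(a, b). mx [[a], [b]]) ` (UNIV - {(0, 0)})"], goal_cases)
  case (14 h)
  then show ?case by (auto simp: mats_small mx_rules nonzeros_def mx_image_iff)
next
  case (16 h)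
  then show ?case by (auto simp: block_mx iso_id2 iso_id3)
next
  case (18 h)
  then obtain a b where h: "h = mx [[a], [b]]" "(a, b) \<noteq> (0, 0)" by auto
  show ?case unfolding h(1) using iso_iij_C_col[OF h(2)] by (simp add: block_mx)
next
  case 19
  then show ?case by (simp add: count_rules)
next
  case 20
  then show ?case by (simp add: count_rules)
next
  case 12
  show ?case by (rule mat_isos_zero) (auto simp: mx_rules)
next
  case 13
  show ?case by (rule mat_isos_zero) (auto simp: mx_rules)
qed (auto simp: mx_rules nonzeros_def reach_refl)

text \<open>Dual to \<open>product_Kj_i\<close>: the image of \<open>h\<close> must lie in the
  kernel of the differential of \<open>K\<close>, which makes the second entry vanish.\<close>

lemma product_j_Ki:
  "std_basis [j] (mx [[0]]) \<otimes>\<^bsub>hall_algebra A\<^esub> std_basis [i, i] N2 = (\<lambda>c. (1) * std_basis [i, i, j] E12 c)"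
proof (rule product_single[where H = "(\<lambda>a. mx [[a], [0]]) ` Ks"], goal_cases)
  case (10 h)
  then show ?case by (auto simp: mats_small mx_rules mx_image_iff)
next
  case (12 h)
  then show ?case by (auto simp: block_mx iso_iij_K_shear)
next
  case 13
  then show ?case by (simp add: count_rules)
qed (auto simp: mx_rules reach_refl)

text \<open>The entry \<open>h\<close> is a pair: its component \<open>a\<close> from
  \<open>P_i\<close> decides for \<open>K\<close> as soon as it is nonzero; otherwise the component
  \<open>b\<close> from \<open>P_j\<close> distinguishes the cokernel complex from the direct
  sum.\<close>

lemma product_ij_i:
  "std_basis [i, j] O2 \<otimes>\<^bsub>hall_algebra A\<^esub> std_basis [i] (mx [[0]]) =
    (\<lambda>c. (of_nat CARD('k) + 1) * std_basis [i, i, j] O3 c + 1 * std_basis [i, i, j] E13 c + 1 * std_basis [i, i, j] E12 c)"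
proof (rule product_triple[where H = "{mx [[0, 0]]}"
    and K = "(\<lambda>b. mx [[0, b]]) ` Us"
    and M = "(\<lambda>(a, b). mx [[a, b]]) ` (Us \<times> Ks)"], goal_cases)
  \<comment> \<open>The hypotheses of \<open>product_triple\<close> by number: 14 to 19 separate the
    middle terms, 20 exhausts the entries \<open>h\<close>, 22, 24 and 26 identify the middle terms,
    27 to 29 are the counts.\<close>
  case (20 h)
  then show ?case by (auto simp: mats_small mx_rules nonzeros_def mx_image_iff)
next
  case (22 h)
  then show ?case by (auto simp: block_mx iso_id2 iso_id3)
next
  case (24 h)
  then show ?case by (auto simp: block_mx nonzeros_def iso_iij_C_scale)
next
  case (26 h)
  then show ?case by (auto simp: block_mx nonzeros_def iso_iij_K_row)
next
  case 27
  then show ?case by (simp add: count_rules)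
next
  case 28
  then show ?case by (simp add: count_rules)
next
  case 29
  then show ?case by (simp add: count_rules)
next
  case 14
  show ?case by (rule mat_isos_zero) (auto simp: mx_rules)
next
  case 15
  show ?case by (rule mat_isos_zero) (auto simp: mx_rules)
next
  case 16
  show ?case by (rule mat_isos_zero) (auto simp: mx_rules)
next
  case 17
  show ?case by (rule mat_isos_zero) (auto simp: mx_rules)
next
  case 18
  show ?case by (rule not_iso_iij)
next
  case 19
  show ?case by (rule not_iso_iij)
qed (auto simp: mx_rules nonzeros_def reach_refl)

end

section \<open>The relations\<close>

lemma hall_mult_combination:
  assumes "fin_supp f" "fin_supp g" "fin_supp h"
  shows "(\<lambda>c. r * f c + s * g c) \<otimes>\<^bsub>hall_algebra A\<^esub> h =
      (\<lambda>c. r * (f \<otimes>\<^bsub>hall_algebra A\<^esub> h) c + s * (g \<otimes>\<^bsub>hall_algebra A\<^esub> h) c)"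
    "h \<otimes>\<^bsub>hall_algebra A\<^esub> (\<lambda>c. r * f c + s * g c) =
      (\<lambda>c. r * (h \<otimes>\<^bsub>hall_algebra A\<^esub> f) c + s * (h \<otimes>\<^bsub>hall_algebra A\<^esub> g) c)"
  using assms by (simp_all add: hall_mult_add_left hall_mult_add_right hall_mult_smult fin_supp_smult)

context thin_algebra
begin

lemma is_std_basis:
  assumes X: "is_std X v D" and "mat_mult (length v) D D = zero_mat" and E: "E \<in> mats w w" "set w \<subseteq> verts Q"
    and i: "mat_isos v D w E \<noteq> {}"
  shows "hall_basis A X = std_basis w E"
proof -
  have "D \<in> mats v v" "set v \<subseteq> verts Q" using X by (auto simp: is_std_def)
  then show ?thesis using is_std_C1(3)[OF X assms(2)] std_equiv_basis[OF _ E(1) _ E(2) assms(2) i] by simp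
qed

lemma zero_mx: "mx [[0]] = zero_mat" "mx [[0, 0]] = zero_mat" "O2 = zero_mat"
  "O3 = zero_mat"
  by (simp_all add: zero_mat_mx)

lemma mat_mult_zero_mat: "mat_mult n zero_mat zero_mat = zero_mat"
  by (simp add: mat_mult_def zero_mat_def)

lemma basis_P:
  assumes "x \<in> verts Q"
  shows "hall_basis A (C_cyc A (P_at A x)) = std_basis [x] (mx [[0]])"
  unfolding zero_mx
  by (rule is_std_basis[OF C_cyc_mod_std[OF mod_std_P_at[OF assms]] mat_mult_zero_mat mats_zero_mat _ iso_id[OF mats_zero_mat]])
    (use assms in auto)

lemma basis_P_P:
  assumes x: "x \<in> verts Q" and y: "y \<in> verts Q"
  shows "hall_basis A (C_cyc A (P_at A x \<oplus>\<^sub>m P_at A y)) = std_basis [x, y] O2"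
proof -
  have "is_std (C_cyc A (P_at A x \<oplus>\<^sub>m P_at A y)) [x, y] zero_mat"
    using C_cyc_mod_std[OF mod_std_dsum[OF mod_std_P_at[OF x] mod_std_P_at[OF y]]] by simp
  then show ?thesis unfolding zero_mx
    by (rule is_std_basis[OF _ mat_mult_zero_mat mats_zero_mat _ iso_id[OF mats_zero_mat]]) (use x y in auto)
qed

lemma is_std_P_P_P:
  assumes x: "x \<in> verts Q" and y: "y \<in> verts Q"
  shows "is_std (C_cyc A (P_at A x \<oplus>\<^sub>m (P_at A y \<oplus>\<^sub>m P_at A y))) [x, y, y] zero_mat"
  using C_cyc_mod_std[OF mod_std_dsum[OF mod_std_P_at[OF x] mod_std_dsum[OF mod_std_P_at[OF y] mod_std_P_at[OF y]]]]
  by simp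

lemma block_zero_mat:
  "block (Suc 0) zero_mat (mx [[b]]) zero_mat = mx [[0, b], [0, 0]]"
  "block (Suc 0) zero_mat zero_mat (mx [[e, f], [h, k]]) = mx [[0, 0, 0], [0, e, f], [0, h, k]]"
  using block_mx(1)[of 0 b 0] block_mx(2)[of 0 0 0 e f h k] by (simp_all add: zero_mx(1,2))

lemma is_std_K:
  assumes "x \<in> verts Q"
  shows "is_std (K_cyc (P_at A x)) [x, x] N2"
proof -
  have "id_mat (Suc 0) = mx [[1]]" by (simp add: id_mat_mx)
  then show ?thesis using K_cyc_std[OF mod_std_P_at[OF assms]] block_zero_mat(1)[of 1] by simp
qed

lemma is_std_P_dsum:
  assumes x: "x \<in> verts Q" and X: "is_std X [y, z] (mx [[e, f], [h, k]])"
  shows "is_std (C_cyc A (P_at A x) \<oplus>\<^sub>c X) [x, y, z] (mx [[0, 0, 0], [0, e, f], [0, h, k]])"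
  using is_std_dsum[OF C_cyc_mod_std[OF mod_std_P_at[OF x]] X] by (simp add: block_zero_mat)

lemma unrelated_relation:
  assumes x: "x \<in> verts Q" and y: "y \<in> verts Q" and "\<not> reach x y" "\<not> reach y x"
  shows "hall_basis A (C_cyc A (P_at A y)) \<otimes>\<^bsub>hall_algebra A\<^esub> hall_basis A (C_cyc A (P_at A x)) =
    hall_basis A (C_cyc A (P_at A x \<oplus>\<^sub>m P_at A y))"
  unfolding basis_P[OF x] basis_P[OF y] basis_P_P[OF x y]
  using product_unrelated[of y x] assms by simp

text \<open>Each product yields the direct sum with the subobject first, that is, in the opposite
  order of its factors; the two sums have to be identified.\<close>

lemma basis_P_P_swap:
  assumes x: "x \<in> verts Q" and y: "y \<in> verts Q"
  shows "hall_basis A (C_cyc A (P_at A x \<oplus>\<^sub>m P_at A y)) = hall_basis A (C_cyc A (P_at A y \<oplus>\<^sub>m P_at A x))"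
  unfolding basis_P_P[OF x y] basis_P_P[OF y x]
  by (rule std_equiv_basis[OF _ _ _ _ _ iso_swap[OF x y]])
    (use x y in \<open>auto simp: zero_mx mats_zero_mat mat_mult_zero_mat\<close>)

end

context two_vertices
begin

lemma is_std_M:
  obtains c where "c \<noteq> 0" "is_std (C_cyc A (M_at A i j)) [i, j] (mx [[0, c], [0, 0]])"
proof -
  have "unit_mat 0 0 c = mx [[c]]" for c :: 'k
    by (auto simp: unit_mat_def mx_def fun_eq_iff)
  then show ?thesis using M_at_std[OF i j ne ij] that block_zero_mat(1) by auto
qed

text \<open>The summands are sorted into the order of the normal forms, and the unknown scalar
  \<open>c\<close> of the cokernel complex is scaled to 1.\<close>

lemma bases:
  "hall_basis A (C_cyc A (P_at A i \<oplus>\<^sub>m (P_at A j \<oplus>\<^sub>m P_at A j))) = std_basis [i, j, j] O3"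
  "hall_basis A (C_cyc A (P_at A j) \<oplus>\<^sub>c C_cyc A (M_at A i j)) = std_basis [i, j, j] E13"
  "hall_basis A (C_cyc A (P_at A i) \<oplus>\<^sub>c K_cyc (P_at A j)) = std_basis [i, j, j] E23"
  "hall_basis A (C_cyc A (P_at A j \<oplus>\<^sub>m (P_at A i \<oplus>\<^sub>m P_at A i))) = std_basis [i, i, j] O3"
  "hall_basis A (C_cyc A (P_at A i) \<oplus>\<^sub>c C_cyc A (M_at A i j)) = std_basis [i, i, j] E13"
  "hall_basis A (C_cyc A (P_at A j) \<oplus>\<^sub>c K_cyc (P_at A i)) = std_basis [i, i, j] E12"
proof -
  obtain c where c: "c \<noteq> 0" and M: "is_std (C_cyc A (M_at A i j)) [i, j] (mx [[0, c], [0, 0]])" by (rule is_std_M)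
  show "hall_basis A (C_cyc A (P_at A i \<oplus>\<^sub>m (P_at A j \<oplus>\<^sub>m P_at A j))) = std_basis [i, j, j] O3"
    unfolding zero_mx
    by (rule is_std_basis[OF is_std_P_P_P[OF i j] mat_mult_zero_mat mats_zero_mat _ iso_id[OF mats_zero_mat]]) auto
  show "hall_basis A (C_cyc A (P_at A j) \<oplus>\<^sub>c C_cyc A (M_at A i j)) = std_basis [i, j, j] E13"
    by (rule is_std_basis[OF is_std_P_dsum[OF j M] _ _ _ iso_jij_C[OF c]]) (auto simp: mx_rules)
  show "hall_basis A (C_cyc A (P_at A i) \<oplus>\<^sub>c K_cyc (P_at A j)) = std_basis [i, j, j] E23"
    by (rule is_std_basis[OF is_std_P_dsum[OF i is_std_K[OF j]] _ _ _ iso_id]) (auto simp: mx_rules)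
  show "hall_basis A (C_cyc A (P_at A j \<oplus>\<^sub>m (P_at A i \<oplus>\<^sub>m P_at A i))) = std_basis [i, i, j] O3"
    unfolding zero_mx
    by (rule is_std_basis[OF is_std_P_P_P[OF j i] mat_mult_zero_mat mats_zero_mat _ iso_jii_zero[unfolded zero_mx]]) auto
  show "hall_basis A (C_cyc A (P_at A i) \<oplus>\<^sub>c C_cyc A (M_at A i j)) = std_basis [i, i, j] E13"
    by (rule is_std_basis[OF is_std_P_dsum[OF i M] _ _ _ iso_iij_C[OF c]]) (auto simp: mx_rules)
  show "hall_basis A (C_cyc A (P_at A j) \<oplus>\<^sub>c K_cyc (P_at A i)) = std_basis [i, i, j] E12"
    by (rule is_std_basis[OF is_std_P_dsum[OF j is_std_K[OF i]] _ _ _ iso_jii_K]) (auto simp: mx_rules)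
qed

lemmas relation_rules = fin_supp_basis hall_mult_combination[OF fin_supp_basis fin_supp_basis fin_supp_basis]
  hall_mult_smult[OF fin_supp_basis fin_supp_basis] hall_algebra_simps fun_eq_iff algebra_simps power2_eq_square

text \<open>The product of two factors is expanded first and each of its terms is multiplied by the
  third. For instance the coefficient \<open>q\<close> of the \<open>K\<close> term in the product
  of \<open>x\<^sub>j\<close>, \<open>x\<^sub>i\<close>, \<open>x\<^sub>j\<close> arises as
  \<open>1 + (q - 1)\<close> from the direct sum and the cokernel complex.\<close>

lemma related_relations:
  fixes q :: complex
  assumes q: "q = of_nat CARD('k)"
  defines "x\<^sub>i \<equiv> hall_basis A (C_cyc A (P_at A i))" and "x\<^sub>j \<equiv> hall_basis A (C_cyc A (P_at A j))"
    and "H \<equiv> hall_algebra A"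
  shows "(x\<^sub>j \<otimes>\<^bsub>H\<^esub> x\<^sub>j) \<otimes>\<^bsub>H\<^esub> x\<^sub>i =
      (q + 1) \<odot>\<^bsub>H\<^esub> hall_basis A (C_cyc A (P_at A i \<oplus>\<^sub>m (P_at A j \<oplus>\<^sub>m P_at A j)))
      \<oplus>\<^bsub>H\<^esub> (q + 1) \<odot>\<^bsub>H\<^esub> hall_basis A (C_cyc A (P_at A j) \<oplus>\<^sub>c C_cyc A (M_at A i j))
      \<oplus>\<^bsub>H\<^esub> hall_basis A (C_cyc A (P_at A i) \<oplus>\<^sub>c K_cyc (P_at A j))"
    "(x\<^sub>j \<otimes>\<^bsub>H\<^esub> x\<^sub>i) \<otimes>\<^bsub>H\<^esub> x\<^sub>j =
      (q * (q + 1)) \<odot>\<^bsub>H\<^esub> hall_basis A (C_cyc A (P_at A i \<oplus>\<^sub>m (P_at A j \<oplus>\<^sub>m P_at A j)))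
      \<oplus>\<^bsub>H\<^esub> q \<odot>\<^bsub>H\<^esub> hall_basis A (C_cyc A (P_at A j) \<oplus>\<^sub>c C_cyc A (M_at A i j))
      \<oplus>\<^bsub>H\<^esub> q \<odot>\<^bsub>H\<^esub> hall_basis A (C_cyc A (P_at A i) \<oplus>\<^sub>c K_cyc (P_at A j))"
    "x\<^sub>i \<otimes>\<^bsub>H\<^esub> (x\<^sub>j \<otimes>\<^bsub>H\<^esub> x\<^sub>j) =
      (q\<^sup>2 * (q + 1)) \<odot>\<^bsub>H\<^esub> hall_basis A (C_cyc A (P_at A i \<oplus>\<^sub>m (P_at A j \<oplus>\<^sub>m P_at A j)))
      \<oplus>\<^bsub>H\<^esub> q \<odot>\<^bsub>H\<^esub> hall_basis A (C_cyc A (P_at A i) \<oplus>\<^sub>c K_cyc (P_at A j))"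
    "(x\<^sub>i \<otimes>\<^bsub>H\<^esub> x\<^sub>i) \<otimes>\<^bsub>H\<^esub> x\<^sub>j =
      (q\<^sup>2 * (q + 1)) \<odot>\<^bsub>H\<^esub> hall_basis A (C_cyc A (P_at A j \<oplus>\<^sub>m (P_at A i \<oplus>\<^sub>m P_at A i)))
      \<oplus>\<^bsub>H\<^esub> q \<odot>\<^bsub>H\<^esub> hall_basis A (C_cyc A (P_at A j) \<oplus>\<^sub>c K_cyc (P_at A i))"
    "(x\<^sub>i \<otimes>\<^bsub>H\<^esub> x\<^sub>j) \<otimes>\<^bsub>H\<^esub> x\<^sub>i =
      (q * (q + 1)) \<odot>\<^bsub>H\<^esub> hall_basis A (C_cyc A (P_at A j \<oplus>\<^sub>m (P_at A i \<oplus>\<^sub>m P_at A i)))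
      \<oplus>\<^bsub>H\<^esub> q \<odot>\<^bsub>H\<^esub> hall_basis A (C_cyc A (P_at A i) \<oplus>\<^sub>c C_cyc A (M_at A i j))
      \<oplus>\<^bsub>H\<^esub> q \<odot>\<^bsub>H\<^esub> hall_basis A (C_cyc A (P_at A j) \<oplus>\<^sub>c K_cyc (P_at A i))"
    "x\<^sub>j \<otimes>\<^bsub>H\<^esub> (x\<^sub>i \<otimes>\<^bsub>H\<^esub> x\<^sub>i) =
      (q + 1) \<odot>\<^bsub>H\<^esub> hall_basis A (C_cyc A (P_at A j \<oplus>\<^sub>m (P_at A i \<oplus>\<^sub>m P_at A i)))
      \<oplus>\<^bsub>H\<^esub> (q + 1) \<odot>\<^bsub>H\<^esub> hall_basis A (C_cyc A (P_at A i) \<oplus>\<^sub>c C_cyc A (M_at A i j))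
      \<oplus>\<^bsub>H\<^esub> hall_basis A (C_cyc A (P_at A j) \<oplus>\<^sub>c K_cyc (P_at A i))"
  unfolding x\<^sub>i_def x\<^sub>j_def H_def bases basis_P[OF i] basis_P[OF j] square[OF i] square[OF j]
    product_j_i product_i_j relation_rules(2-5)
    product_jj_i product_Kj_i product_ij_j product_C_j product_i_jj product_i_Kj
    product_ii_j product_Ki_j product_ij_i product_j_ii product_j_Ki q
  by (simp_all add: hall_algebra_simps fun_eq_iff algebra_simps power2_eq_square)

end

theorem proposition6p1:
  fixes Q :: "(nat, 'e) pre_digraph" and n i j :: nat
    and A :: "('k::{field,finite}, (nat, 'e) qpath \<Rightarrow> 'k) module"
    and q :: complex
  assumes "dynkin_quiver Q" and "verts Q = {1..n}"
    and "A = path_algebra Q" and "q = of_nat CARD('k)"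
    and "i \<in> {1..n}" and "j \<in> {1..n}" and "i \<noteq> j"
  shows
    "let H = hall_algebra A;
         P\<^sub>i = P_at A i; P\<^sub>j = P_at A j; M\<^sub>i\<^sub>j = M_at A i j;
         x\<^sub>i = hall_basis A (C_cyc A P\<^sub>i); x\<^sub>j = hall_basis A (C_cyc A P\<^sub>j)
     in
      (path_matrix Q i j = 0 \<longrightarrow>
         x\<^sub>i \<otimes>\<^bsub>H\<^esub> x\<^sub>j = x\<^sub>j \<otimes>\<^bsub>H\<^esub> x\<^sub>i \<and>
         x\<^sub>j \<otimes>\<^bsub>H\<^esub> x\<^sub>i = hall_basis A (C_cyc A (P\<^sub>i \<oplus>\<^sub>m P\<^sub>j))) \<and>
      (path_matrix Q i j = 1 \<longrightarrow>
         (x\<^sub>j \<otimes>\<^bsub>H\<^esub> x\<^sub>j) \<otimes>\<^bsub>H\<^esub> x\<^sub>i =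
           (q + 1) \<odot>\<^bsub>H\<^esub> hall_basis A (C_cyc A (P\<^sub>i \<oplus>\<^sub>m (P\<^sub>j \<oplus>\<^sub>m P\<^sub>j)))
           \<oplus>\<^bsub>H\<^esub> (q + 1) \<odot>\<^bsub>H\<^esub> hall_basis A (C_cyc A P\<^sub>j \<oplus>\<^sub>c C_cyc A M\<^sub>i\<^sub>j)
           \<oplus>\<^bsub>H\<^esub> hall_basis A (C_cyc A P\<^sub>i \<oplus>\<^sub>c K_cyc P\<^sub>j) \<and>
         (x\<^sub>j \<otimes>\<^bsub>H\<^esub> x\<^sub>i) \<otimes>\<^bsub>H\<^esub> x\<^sub>j =
           (q * (q + 1)) \<odot>\<^bsub>H\<^esub> hall_basis A (C_cyc A (P\<^sub>i \<oplus>\<^sub>m (P\<^sub>j \<oplus>\<^sub>m P\<^sub>j)))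
           \<oplus>\<^bsub>H\<^esub> q \<odot>\<^bsub>H\<^esub> hall_basis A (C_cyc A P\<^sub>j \<oplus>\<^sub>c C_cyc A M\<^sub>i\<^sub>j)
           \<oplus>\<^bsub>H\<^esub> q \<odot>\<^bsub>H\<^esub> hall_basis A (C_cyc A P\<^sub>i \<oplus>\<^sub>c K_cyc P\<^sub>j) \<and>
         x\<^sub>i \<otimes>\<^bsub>H\<^esub> (x\<^sub>j \<otimes>\<^bsub>H\<^esub> x\<^sub>j) =
           (q\<^sup>2 * (q + 1)) \<odot>\<^bsub>H\<^esub> hall_basis A (C_cyc A (P\<^sub>i \<oplus>\<^sub>m (P\<^sub>j \<oplus>\<^sub>m P\<^sub>j)))
           \<oplus>\<^bsub>H\<^esub> q \<odot>\<^bsub>H\<^esub> hall_basis A (C_cyc A P\<^sub>i \<oplus>\<^sub>c K_cyc P\<^sub>j) \<and>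
         (x\<^sub>i \<otimes>\<^bsub>H\<^esub> x\<^sub>i) \<otimes>\<^bsub>H\<^esub> x\<^sub>j =
           (q\<^sup>2 * (q + 1)) \<odot>\<^bsub>H\<^esub> hall_basis A (C_cyc A (P\<^sub>j \<oplus>\<^sub>m (P\<^sub>i \<oplus>\<^sub>m P\<^sub>i)))
           \<oplus>\<^bsub>H\<^esub> q \<odot>\<^bsub>H\<^esub> hall_basis A (C_cyc A P\<^sub>j \<oplus>\<^sub>c K_cyc P\<^sub>i) \<and>
         (x\<^sub>i \<otimes>\<^bsub>H\<^esub> x\<^sub>j) \<otimes>\<^bsub>H\<^esub> x\<^sub>i =
           (q * (q + 1)) \<odot>\<^bsub>H\<^esub> hall_basis A (C_cyc A (P\<^sub>j \<oplus>\<^sub>m (P\<^sub>i \<oplus>\<^sub>m P\<^sub>i)))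
           \<oplus>\<^bsub>H\<^esub> q \<odot>\<^bsub>H\<^esub> hall_basis A (C_cyc A P\<^sub>i \<oplus>\<^sub>c C_cyc A M\<^sub>i\<^sub>j)
           \<oplus>\<^bsub>H\<^esub> q \<odot>\<^bsub>H\<^esub> hall_basis A (C_cyc A P\<^sub>j \<oplus>\<^sub>c K_cyc P\<^sub>i) \<and>
         x\<^sub>j \<otimes>\<^bsub>H\<^esub> (x\<^sub>i \<otimes>\<^bsub>H\<^esub> x\<^sub>i) =
           (q + 1) \<odot>\<^bsub>H\<^esub> hall_basis A (C_cyc A (P\<^sub>j \<oplus>\<^sub>m (P\<^sub>i \<oplus>\<^sub>m P\<^sub>i)))
           \<oplus>\<^bsub>H\<^esub> (q + 1) \<odot>\<^bsub>H\<^esub> hall_basis A (C_cyc A P\<^sub>i \<oplus>\<^sub>c C_cyc A M\<^sub>i\<^sub>j)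
           \<oplus>\<^bsub>H\<^esub> hall_basis A (C_cyc A P\<^sub>j \<oplus>\<^sub>c K_cyc P\<^sub>i))"
proof -
  have "fin_digraph Q" using assms(1) by (auto simp: dynkin_quiver_def)
  then interpret thin_algebra Q A
    by (intro thin_algebra.intro thin_quiver.intro thin_algebra_axioms.intro thin_quiver_axioms.intro)
      (use dynkin_walk_unique[OF assms(1)] assms(3) in blast)+
  have i: "i \<in> verts Q" and j: "j \<in> verts Q" using assms by auto
  \<comment> \<open>For \<open>i \<noteq> j\<close> the entry 0 of the path matrix means that there
    is no path in either direction.\<close>
  have unrelated: "\<not> reach i j" "\<not> reach j i" if "path_matrix Q i j = 0"
    using that assms(7) by (auto simp: path_matrix_def reach_def split: if_splits)
  have related: "two_vertices Q A i j" if "path_matrix Q i j = 1"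
    using that assms(7) i j by unfold_locales (auto simp: path_matrix_def reach_def split: if_splits)
  show ?thesis
    unfolding Let_def
    using unrelated_relation[OF i j unrelated] unrelated_relation[OF j i unrelated(2,1)] basis_P_P_swap[OF i j]
      two_vertices.related_relations[OF related assms(4)]
    by simp
qed

end
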